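(* Let $n\geq2$ be such that all the eigenvalues in both $S_n$ and $\widetilde S_n$ are simple, and let $K\geq 1$ be an integer. Consider the eigenvalue problem $$\mathcal{A}v=\lambda\,\mathcal{C}v,\qquad v\in S_K^{(n)},\ v\neq0, \qquad ( * )$$ with all the notation as in the context. 1. The spectrum of problem $( * )$ consists of $\widetilde S_n$ and the numbers $\{\lambda_k^{(l)}\}_{l=1}^n$, $k=1,\dots,K-1$, none of which belongs to $\widetilde S_n$, where for each $k=1,\dots,K-1$ the numbers $\lambda_k^{(1)},\dots,\lambda_k^{(n)}$ are all $n$ (and all positive real) solutions $\lambda$ to the equation $$a_0-\lambda c_0+\sum_{l=1}^{n-1}\frac{(a^{(l)}-\lambda c^{(l)})^2}{\lambda-\lambda_0^{(l)}}=-\theta\Big(a_n-\lambda c_n+\sum_{l=1}^{n-1}\frac{(\check a^{(l)}-\lambda\check c^{(l)})(a^{(l)}-\lambda c^{(l)})}{\lambda-\lambda_0^{(l)}}\Big)$$ with $\theta=\theta_k:=\cos\frac{\pi k}{K}$, and they are different for fixed $k$. 2. To the eigenvalue $\lambda_0^{(l)}$, $l=1,\dots,n-1$, there corresponds the eigenvector $s_0^{(l)}\in S_K^{(n)}$ given by $$s_{0,j}^{(l)}=0,\ j=1,\dots,K-1,\qquad s_{0,j-1/2}^{(l)}=(-P)^{j-1}e^{(l)},\ j=1,\dots,K .$$ (Here $(-P)^{j-1}e=(-1)^{j-1}e$ for even $e$ and $(-P)^{j-1}e=e$ for odd $e$.) 3. To the eigenvalue $\lambda_k^{(l)}$, $k=1,\dots,K-1$,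 $l=1,\dots,n$, there corresponds the eigenvector $s_k^{(l)}\in S_K^{(n)}$ given by $$s_{k,j}^{(l)}=\sin\frac{\pi kj}{K},\ j=1,\dots,K-1,\qquad s_{k,j-1/2}^{(l)}=p_k^{(l)}\sin\frac{\pi k(j-1)}{K}+\check p_k^{(l)}\sin\frac{\pi kj}{K},\ j=1,\dots,K,$$ where $p_k^{(l)}\in\mathbb{R}^{n-1}$ is the solution to the non-degenerate algebraic system $\widetilde G(\lambda_k^{(l)})p_k^{(l)}=-g(\lambda_k^{(l)})$. 4. These eigenvectors are $\mathcal{C}$-orthogonal, i.e. $(\mathcal{C}s_k^{(l)},s_{\tilde k}^{(\tilde l)})_{S_K^{(n)}}=0$ for any $k,\tilde k\in\{0,\dots,K-1\}$, $l\in\{1,\dots,n-\delta_{k0}\}$ and $\tilde l\in\{1,\dots,n-\delta_{\tilde k0}\}$ such that $k\neq\tilde k$ and/or $l\neq\tilde l$. They form a basis in $S_K^{(n)}$, i.e. any $w\in S_K^{(n)}$ can be uniquely expanded as $$w=\sum_{l=1}^{n-1}w_{0l}s_0^{(l)}+\sum_{k=1}^{K-1}\sum_{l=1}^n w_{kl}s_k^{(l)} .$$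
   Context: Local matrices. Let $\mathcal{P}_n$ be the space of real polynomials of degree at most $n$ and $\{e_l\}_{l=0}^n$ its Lagrange basis with $e_l(-1+2k/n)=\delta_{kl}$, $k,l=0,\dots,n$. Let $A=\{A_{kl}\}_{k,l=0}^n$, $C=\{C_{kl}\}_{k,l=0}^n$ with $A_{kl}=\int_{-1}^1 e_k'e_l'\,dx$, $C_{kl}=\int_{-1}^1e_ke_l\,dx$. For $p\in\mathbb{R}^{n-1}$ set $\check p_l=(Pp)_l=p_{n-l}$, $l=1,\dots,n-1$; $p$ is even if $Pp=p$ and odd if $Pp=-p$. The matrices have the block form $$A=\begin{pmatrix} a_0 & a^T & a_n \\ a & \widetilde A & \check a \\ a_n & \check a^T & a_0 \end{pmatrix},\qquad C=\begin{pmatrix} c_0 & c^T & c_n \\ c & \widetilde C & \check c \\ c_n & \check c^T & c_0 \end{pmatrix},$$ where $\widetilde A,\widetilde C$ are of order $n-1$ and $a,c\in\mathbb{R}^{n-1}$. Set $\widetilde G(\lambda)=\widetilde A-\lambda\widetilde C$, $g(\lambda)=a-\lambda c$. The symbol $\cdot$ denotes the inner product in $\mathbb{R}^{n-1}$. Local spectra. $S_n$ is the spectrum of $Ae=\lambda Ce$, $e\in\mathbb{R}^{n+1}$, $e\ne0$, and $\widetilde S_n$ is the spectrum of $\widetilde Ae=\lambda\widetilde Ce$, $e\in\mathbb{R}^{n-1}$, $e\neq0$. Let $\{\lambda_0^{(l)},e^{(l)}\}_{l=1}^{n-1}$ be the eigenpairs of the second problem; each $e^{(l)}$ is even or odd,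 and they are scaled so that $\widetilde Ce^{(l)}\cdot e^{(l)}=1$. Set $a^{(l)}=a\cdot e^{(l)}$, $c^{(l)}=c\cdot e^{(l)}$, $\check a^{(l)}=\check a\cdot e^{(l)}$, $\check c^{(l)}=\check c\cdot e^{(l)}$. Global problem. $S_K^{(n)}$ is the space of vector functions $w$ consisting of $w_j\in\mathbb{R}$, $j=0,\dots,K$, with $w_0=w_K=0$, and $w_{j-1/2}\in\mathbb{R}^{n-1}$, $j=1,\dots,K$; its dimension is $nK-1$. Its inner product is $$(y,v)_{S_K^{(n)}}=\sum_{j=1}^{K-1}y_jv_j+\sum_{j=1}^Ky_{j-1/2}\cdot v_{j-1/2}.$$ The global (scaled) stiffness and mass operators $\mathcal{A},\mathcal{C}$ in $S_K^{(n)}$ (assembled from $A$ and $C$ over $K$ equal elements with zero Dirichlet conditions, from the finite element method of order $n$ for $-u''=\lambda u$, $u(0)=u(X)=0$) are given by $$(\mathcal{C}w)_j=c_nw_{j-1}+\check c\cdot w_{j-1/2}+2c_0w_j+c\cdot w_{j+1/2}+c_nw_{j+1},\ j=1,\dots,K-1,$$ $$(\mathcal{C}w)_{j-1/2}=c\,w_{j-1}+\widetilde Cw_{j-1/2}+\check c\,w_j,\ j=1,\dots,K,$$ with $(\mathcal{C}w)_0=(\mathcal{C}w)_K=0$, and $\mathcal{A}$ is given by the same formulas with $a_0,a_n,a,\check a,\widetilde A$ in place of $c_0,c_n,c,\check c,\widetilde C$. The equation for $\lambda$ in item 1 is considered for $\lambda\in\mathbb{C}\setminus\widetilde S_n$.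 *)

theory Defs
  imports "HOL-Analysis.Analysis" "Jordan_Normal_Form.Char_Poly"
begin

unbundle no inner_syntax
unbundle no vec_syntax
hide_const (open) Finite_Cartesian_Product.vec Determinants.det

definition fem_node :: "nat \<Rightarrow> nat \<Rightarrow> real" where
  "fem_node n k = -1 + 2 * real k / real n"

definition lagrange :: "nat \<Rightarrow> nat \<Rightarrow> real poly" where
  "lagrange n l = (THE p. degree p \<le> n \<and>
     (\<forall>k\<le>n. poly p (fem_node n k) = (if k = l then 1 else 0)))"

text \<open>The description in the definition of \<^const>\<open>lagrange\<close> is proper.\<close>

lemma lagrange_ex1:
  assumes "n \<ge> 1" "l \<le> n"
  shows "\<exists>!p. degree p \<le> n \<and>
     (\<forall>k\<le>n. poly p (fem_node n k) = (if k = l then 1 else 0))"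
proof -
  have inj: "fem_node n i = fem_node n j \<longleftrightarrow> i = j" for i j
    using assms by (auto simp: fem_node_def field_simps)
  define c where "c = (\<Prod>k\<in>{..n}-{l}. fem_node n l - fem_node n k)"
  define q where "q = (\<Prod>k\<in>{..n}-{l}. [:- fem_node n k, 1:])"
  have c0: "c \<noteq> 0"
    unfolding c_def by (auto simp: inj)
  have "degree q \<le> (\<Sum>k\<in>{..n}-{l}. degree [:- fem_node n k, 1:])"
    unfolding q_def by (rule degree_prod_sum_le[unfolded o_def]) simp
  also have "\<dots> = n" using assms by simp
  finally have dq: "degree q \<le> n" .
  have pq: "poly q x = (\<Prod>k\<in>{..n}-{l}. x - fem_node n k)" for x
    unfolding q_def by (simp add: poly_prod)
  have ql: "poly q (fem_node n l) = c" by (simp add: pq c_def)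
  have qk: "poly q (fem_node n k) = 0" if "k \<le> n" "k \<noteq> l" for k
    unfolding pq using that by (intro prod_zero) auto
  show ?thesis
  proof (rule ex1I[of _ "Polynomial.smult (inverse c) q"])
    show "degree (Polynomial.smult (inverse c) q) \<le> n \<and>
      (\<forall>k\<le>n. poly (Polynomial.smult (inverse c) q) (fem_node n k) = (if k = l then 1 else 0))"
      using dq ql qk c0 by auto
  next
    fix p assume p: "degree p \<le> n \<and>
      (\<forall>k\<le>n. poly p (fem_node n k) = (if k = l then 1 else 0))"
    have "card (fem_node n ` {..n}) = n + 1"
      by (subst card_image) (auto intro!: inj_onI simp: inj)
    then show "p = Polynomial.smult (inverse c) q"
      using p dq ql qk c0
      by (intro poly_eqI_degree[of "fem_node n ` {..n}"]) auto
  qed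
qed

definition stiff :: "nat \<Rightarrow> real mat" where
  "stiff n = mat (n + 1) (n + 1) (\<lambda>(k, l).
     integral {-1..1} (\<lambda>x. poly (pderiv (lagrange n k)) x * poly (pderiv (lagrange n l)) x))"

definition mass :: "nat \<Rightarrow> real mat" where
  "mass n = mat (n + 1) (n + 1) (\<lambda>(k, l).
     integral {-1..1} (\<lambda>x. poly (lagrange n k) x * poly (lagrange n l) x))"

text \<open>A vector \<open>p\<close> with entries \<open>p\<^sub>1, \<dots>, p\<^sub>n\<^sub>-\<^sub>1\<close> is stored with indices
  \<open>0, \<dots>, n - 2\<close>, so \<open>(Pp)\<^sub>l = p\<^sub>n\<^sub>-\<^sub>l\<close> reads as below.\<close>

definition flip :: "real vec \<Rightarrow> real vec" where
  "flip p = vec (dim_vec p) (\<lambda>i. p $ (dim_vec p - 1 - i))"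

definition even_vec :: "real vec \<Rightarrow> bool" where
  "even_vec p \<longleftrightarrow> flip p = p"

definition odd_vec :: "real vec \<Rightarrow> bool" where
  "odd_vec p \<longleftrightarrow> flip p = - p"

text \<open>Blocks \<open>m\<^sub>0\<close>, \<open>m\<^sub>n\<close>, \<open>m\<close> and \<open>M\<close> with tilde of a local matrix
  of order \<open>n + 1\<close>.\<close>

definition corner0 :: "real mat \<Rightarrow> real" where
  "corner0 M = M $$ (0, 0)"

definition cornern :: "nat \<Rightarrow> real mat \<Rightarrow> real" where
  "cornern n M = M $$ (0, n)"

definition side :: "nat \<Rightarrow> real mat \<Rightarrow> real vec" where
  "side n M = vec (n - 1) (\<lambda>i. M $$ (i + 1, 0))"

definition inner_block :: "nat \<Rightarrow> real mat \<Rightarrow> real mat" where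
  "inner_block n M = mat (n - 1) (n - 1) (\<lambda>(i, j). M $$ (i + 1, j + 1))"

definition Gtilde :: "nat \<Rightarrow> real \<Rightarrow> real mat" where
  "Gtilde n \<nu> = inner_block n (stiff n) - \<nu> \<cdot>\<^sub>m inner_block n (mass n)"

definition gvec :: "nat \<Rightarrow> real \<Rightarrow> real vec" where
  "gvec n \<nu> = side n (stiff n) - \<nu> \<cdot>\<^sub>v side n (mass n)"

definition pencil_spectrum :: "nat \<Rightarrow> real mat \<Rightarrow> real mat \<Rightarrow> real set" where
  "pencil_spectrum d M N =
     {\<nu>. \<exists>e \<in> carrier_vec d. e \<noteq> 0\<^sub>v d \<and> M *\<^sub>v e = \<nu> \<cdot>\<^sub>v (N *\<^sub>v e)}"

text \<open>The polynomial \<open>det (M - \<nu> N)\<close> in \<open>\<nu>\<close>.\<close>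

definition pencil_poly :: "nat \<Rightarrow> real mat \<Rightarrow> real mat \<Rightarrow> real poly" where
  "pencil_poly d M N = det (mat d d (\<lambda>(i, j). [: M $$ (i, j), - N $$ (i, j) :]))"

text \<open>Simple means of algebraic multiplicity one, i.e. a simple zero of that polynomial.\<close>

definition simple_eigenvalue :: "nat \<Rightarrow> real mat \<Rightarrow> real mat \<Rightarrow> real \<Rightarrow> bool" where
  "simple_eigenvalue d M N \<nu> \<longleftrightarrow>
     \<nu> \<in> pencil_spectrum d M N \<and> Polynomial.order \<nu> (pencil_poly d M N) = 1"

definition S_full :: "nat \<Rightarrow> real set" where
  "S_full n = pencil_spectrum (n + 1) (stiff n) (mass n)"

definition S_tilde :: "nat \<Rightarrow> real set" where
  "S_tilde n = pencil_spectrum (n - 1) (inner_block n (stiff n)) (inner_block n (mass n))"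

definition S_full_simple :: "nat \<Rightarrow> bool" where
  "S_full_simple n \<longleftrightarrow>
     (\<forall>\<nu> \<in> S_full n. simple_eigenvalue (n + 1) (stiff n) (mass n) \<nu>)"

definition S_tilde_simple :: "nat \<Rightarrow> bool" where
  "S_tilde_simple n \<longleftrightarrow>
     (\<forall>\<nu> \<in> S_tilde n. simple_eigenvalue (n - 1)
        (inner_block n (stiff n)) (inner_block n (mass n)) \<nu>)"

definition local_eigenpairs :: "nat \<Rightarrow> (nat \<Rightarrow> real) \<Rightarrow> (nat \<Rightarrow> real vec) \<Rightarrow> bool" where
  "local_eigenpairs n lam0 e \<longleftrightarrow>
     bij_betw lam0 {1..n-1} (S_tilde n) \<and>
     (\<forall>l\<in>{1..n-1}. e l \<in> carrier_vec (n - 1) \<and>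
        inner_block n (stiff n) *\<^sub>v e l = lam0 l \<cdot>\<^sub>v (inner_block n (mass n) *\<^sub>v e l) \<and>
        (inner_block n (mass n) *\<^sub>v e l) \<bullet> e l = 1)"

text \<open>Primed coefficients are those with the check accent.\<close>

definition char_equation ::
  "nat \<Rightarrow> (nat \<Rightarrow> real) \<Rightarrow> (nat \<Rightarrow> real vec) \<Rightarrow> real \<Rightarrow> complex \<Rightarrow> bool" where
  "char_equation n lam0 e \<theta> z \<longleftrightarrow>
    (let a0 = complex_of_real (corner0 (stiff n));
         c0 = complex_of_real (corner0 (mass n));
         an = complex_of_real (cornern n (stiff n));
         cn = complex_of_real (cornern n (mass n));
         a = (\<lambda>l. complex_of_real (side n (stiff n) \<bullet> e l));
         c = (\<lambda>l. complex_of_real (side n (mass n) \<bullet> e l));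
         a' = (\<lambda>l. complex_of_real (flip (side n (stiff n)) \<bullet> e l));
         c' = (\<lambda>l. complex_of_real (flip (side n (mass n)) \<bullet> e l));
         \<mu> = (\<lambda>l. complex_of_real (lam0 l))
     in a0 - z * c0 + (\<Sum>l=1..n-1. (a l - z * c l)^2 / (z - \<mu> l))
        = - complex_of_real \<theta> *
          (an - z * cn + (\<Sum>l=1..n-1. (a' l - z * c' l) * (a l - z * c l) / (z - \<mu> l))))"

definition char_solutions ::
  "nat \<Rightarrow> (nat \<Rightarrow> real) \<Rightarrow> (nat \<Rightarrow> real vec) \<Rightarrow> real \<Rightarrow> complex set" where
  "char_solutions n lam0 e \<theta> =
     {z. z \<notin> complex_of_real ` S_tilde n \<and> char_equation n lam0 e \<theta> z}"

text \<open>An element \<open>w\<close> is a pair: \<open>fst w j\<close> is \<open>w\<^sub>j\<close>, and \<open>snd w j\<close> is the vector with the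
  half-integer index \<open>j - 1/2\<close>.  Values outside the index range are fixed to zero, so that
  equality of pairs is equality in the space.\<close>

type_synonym gvector = "(nat \<Rightarrow> real) \<times> (nat \<Rightarrow> real vec)"

definition SK :: "nat \<Rightarrow> nat \<Rightarrow> gvector set" where
  "SK n K = {w. (\<forall>j. j \<notin> {1..K-1} \<longrightarrow> fst w j = 0) \<and>
                (\<forall>j\<in>{1..K}. snd w j \<in> carrier_vec (n - 1)) \<and>
                (\<forall>j. j \<notin> {1..K} \<longrightarrow> snd w j = 0\<^sub>v (n - 1))}"

definition SK_zero :: "nat \<Rightarrow> gvector" where
  "SK_zero n = ((\<lambda>j. 0), (\<lambda>j. 0\<^sub>v (n - 1)))"

definition SK_scale :: "real \<Rightarrow> gvector \<Rightarrow> gvector" where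
  "SK_scale c w = ((\<lambda>j. c * fst w j), (\<lambda>j. c \<cdot>\<^sub>v snd w j))"

definition SK_lincomb ::
  "nat \<Rightarrow> 'i set \<Rightarrow> ('i \<Rightarrow> real) \<Rightarrow> ('i \<Rightarrow> gvector) \<Rightarrow> gvector" where
  "SK_lincomb n I c s =
     ((\<lambda>j. \<Sum>i\<in>I. c i * fst (s i) j),
      (\<lambda>j. vec (n - 1) (\<lambda>m. \<Sum>i\<in>I. c i * snd (s i) j $ m)))"

definition SK_inner :: "nat \<Rightarrow> gvector \<Rightarrow> gvector \<Rightarrow> real" where
  "SK_inner K y v = (\<Sum>j=1..K-1. fst y j * fst v j) + (\<Sum>j=1..K. snd y j \<bullet> snd v j)"

definition assemble :: "nat \<Rightarrow> nat \<Rightarrow> real mat \<Rightarrow> gvector \<Rightarrow> gvector" where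
  "assemble n K M w =
    ((\<lambda>j. if j \<in> {1..K-1} then
            cornern n M * fst w (j - 1) + flip (side n M) \<bullet> snd w j
            + 2 * corner0 M * fst w j
            + side n M \<bullet> snd w (j + 1) + cornern n M * fst w (j + 1)
          else 0),
     (\<lambda>j. if j \<in> {1..K} then
            fst w (j - 1) \<cdot>\<^sub>v side n M + inner_block n M *\<^sub>v snd w j
            + fst w j \<cdot>\<^sub>v flip (side n M)
          else 0\<^sub>v (n - 1)))"

definition stiff_op :: "nat \<Rightarrow> nat \<Rightarrow> gvector \<Rightarrow> gvector" where
  "stiff_op n K = assemble n K (stiff n)"

definition mass_op :: "nat \<Rightarrow> nat \<Rightarrow> gvector \<Rightarrow> gvector" where
  "mass_op n K = assemble n K (mass n)"

definition is_eigenpair :: "nat \<Rightarrow> nat \<Rightarrow> real \<Rightarrow> gvector \<Rightarrow> bool" where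
  "is_eigenpair n K \<nu> v \<longleftrightarrow>
     v \<in> SK n K \<and> v \<noteq> SK_zero n \<and> stiff_op n K v = SK_scale \<nu> (mass_op n K v)"

definition global_spectrum :: "nat \<Rightarrow> nat \<Rightarrow> real set" where
  "global_spectrum n K = {\<nu>. \<exists>v. is_eigenpair n K \<nu> v}"

definition neg_flip_pow :: "nat \<Rightarrow> real vec \<Rightarrow> real vec" where
  "neg_flip_pow m = (\<lambda>p. - flip p) ^^ m"

definition s_zero :: "nat \<Rightarrow> nat \<Rightarrow> real vec \<Rightarrow> gvector" where
  "s_zero n K e =
    ((\<lambda>j. 0), (\<lambda>j. if j \<in> {1..K} then neg_flip_pow (j - 1) e else 0\<^sub>v (n - 1)))"

definition s_vec :: "nat \<Rightarrow> nat \<Rightarrow> nat \<Rightarrow> real vec \<Rightarrow> gvector" where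
  "s_vec n K k p =
    ((\<lambda>j. if j \<in> {1..K-1} then sin (pi * real k * real j / real K) else 0),
     (\<lambda>j. if j \<in> {1..K} then
             sin (pi * real k * (real j - 1) / real K) \<cdot>\<^sub>v p
             + sin (pi * real k * real j / real K) \<cdot>\<^sub>v flip p
           else 0\<^sub>v (n - 1)))"

text \<open>The solution of \<open>G p = - g\<close> (with \<^const>\<open>Gtilde\<close> and \<^const>\<open>gvec\<close> at \<open>\<nu>\<close>); to be
  used only where the system is non-degenerate.\<close>

definition p_sol :: "nat \<Rightarrow> real \<Rightarrow> real vec" where
  "p_sol n \<nu> = (THE p. p \<in> carrier_vec (n - 1) \<and> Gtilde n \<nu> *\<^sub>v p = - gvec n \<nu>)"

definition modes :: "nat \<Rightarrow> nat \<Rightarrow> (nat \<times> nat) set" where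
  "modes n K = {(k, l). k \<le> K - 1 \<and> 1 \<le> l \<and> l \<le> (if k = 0 then n - 1 else n)}"

definition s_mode ::
  "nat \<Rightarrow> nat \<Rightarrow> (nat \<Rightarrow> real vec) \<Rightarrow> (nat \<Rightarrow> nat \<Rightarrow> real) \<Rightarrow> nat \<times> nat \<Rightarrow> gvector" where
  "s_mode n K e lam = (\<lambda>(k, l).
     if k = 0 then s_zero n K (e l) else s_vec n K k (p_sol n (lam k l)))"

end

theory Submission
  imports Defs
begin

text \<open>
  On the vectors \<open>v\<^sub>j = sin (\<pi> k j / K)\<close>, \<open>v\<^sub>j\<^sub>-\<^sub>1\<^sub>/\<^sub>2 = p sin (\<pi> k (j - 1) / K) + flip p sin (\<pi> k j / K)\<close>
  the global pencil acts through the local blocks and \<open>\<theta> = cos (\<pi> k / K)\<close> alone.  Eliminating \<open>p\<close> leaves the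
  scalar secular equation, a rational function of \<open>\<lambda>\<close> with a pole at every inner eigenvalue.  Its residues are
  positive multiples of \<open>(g(\<mu>) \<bullet> e)\<^sup>2\<close>, and they do not vanish: otherwise a polynomial \<open>f\<close> of degree at most \<open>n\<close>
  vanishing at both ends would satisfy \<open>\<integral> f' v' = \<mu> \<integral> f v\<close> for all \<open>v\<close> of degree at most \<open>n\<close>, which the choice \<open>v = x f'\<close>
  refutes by Pohozaev's identity.  As the secular function is positive at \<open>0\<close> and negative at infinity, its
  zeros interlace with the poles, which gives \<open>n\<close> distinct positive roots, and a degree count excludes others.
  Eigenvectors of different eigenvalues are orthogonal by symmetry, those of different \<open>k\<close> by orthogonality of
  sampled sines, and \<open>(n - 1) + (K - 1) n = n K - 1\<close> orthogonal vectors form a basis.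
\<close>

subsection \<open>Integrals of polynomials and Pohozaev's identity\<close>

text \<open>Three obstacles shape the argument. The equation carries two sums, and theta multiplies
  only one side. As reversal commutes with both inner blocks and the inner eigenvalues are distinct,
  each \<open>e l\<close> has a parity \<open>\<sigma> l\<close>, an accented coefficient is
  \<open>\<sigma> l\<close> times the plain one, and everything collects into one sum with weights
  \<open>1 + \<theta> * \<sigma> l\<close>, positive for |theta| < 1. Next, complex solutions have
  to be excluded and the function is undefined at its poles, so denominators are cleared:
  \<open>secpoly\<close> has degree at most n, at a pole it is the residue times a product of
  differences, and n real roots leave no room for others. Its signs at 0 and at infinity come from
  one fact, the positivity of a Schur complement, applied to the stiffness and to the mass matrix.
  Finally, eigenvalues for different k are not shown to differ, so orthogonality cannot rest on
  eigenvalues alone. That the spectrum is exhausted follows from the basis: an eigenvector with any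
  other eigenvalue would be orthogonal to all basis vectors, hence to itself.\<close>

definition Ip :: "real poly \<Rightarrow> real" where
  "Ip p = integral {-1..1} (poly p)"

lemma integrable_poly: "poly (p :: real poly) integrable_on {a..b}"
  by (intro integrable_continuous_real continuous_intros)

lemma poly_0_fun: "poly 0 = (\<lambda>x. 0)"
  and poly_add_fun: "poly (p + q) = (\<lambda>x. poly p x + poly q x)"
  and poly_mult_fun: "poly (p * q) = (\<lambda>x. poly p x * poly q x)"
  and poly_diff_fun: "poly (p - q) = (\<lambda>x. poly p x - poly q x)"
  and poly_smult_fun: "poly (Polynomial.smult c p) = (\<lambda>x. c * poly p x)"
  for p q :: "'a :: comm_ring_1 poly"
  by (simp_all add: fun_eq_iff)

lemma Ip_0 [simp]: "Ip 0 = 0"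
  by (simp add: Ip_def poly_0_fun)

lemma Ip_add: "Ip (p + q) = Ip p + Ip q"
  unfolding Ip_def poly_add_fun by (rule integral_add[OF integrable_poly integrable_poly])

lemma Ip_diff: "Ip (p - q) = Ip p - Ip q"
  unfolding Ip_def poly_diff_fun by (rule integral_diff[OF integrable_poly integrable_poly])

lemma Ip_smult: "Ip (Polynomial.smult c p) = c * Ip p"
  unfolding Ip_def poly_smult_fun by (rule integral_mult_right)

lemma Ip_sum: "Ip (sum f A) = (\<Sum>i\<in>A. Ip (f i))"
  by (induction A rule: infinite_finite_induct) (simp_all add: Ip_add)

lemma Ip_pderiv: "Ip (pderiv p) = poly p 1 - poly p (-1)"
proof -
  have "(poly p has_vector_derivative poly (pderiv p) x) (at x within {-1..1})" for x
    using poly_DERIV[of p x]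
    by (simp add: has_real_derivative_iff_has_vector_derivative has_vector_derivative_at_within)
  then have "(poly (pderiv p) has_integral poly p 1 - poly p (-1)) {-1..1}"
    by (intro fundamental_theorem_of_calculus) auto
  then show ?thesis by (simp add: Ip_def integral_unique)
qed

lemma Ip_square_nonneg: "Ip (p * p) \<ge> 0"
  unfolding Ip_def by (rule integral_nonneg[OF integrable_poly]) simp

text \<open>A continuous non-negative integrand with zero integral vanishes on the whole interval,
  and a polynomial with infinitely many roots is zero.\<close>

lemma Ip_square_eq_0:
  assumes "Ip (p * p) = 0"
  shows "p = 0"
proof -
  have int0: "(poly (p * p) has_integral 0) (cbox (-1) 1)"
    using assms integrable_integral[OF integrable_poly[of "p * p" "-1" 1]] by (simp add: Ip_def)
  have "poly (p * p) x = 0" if "x \<in> {-1..1}" for x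
    by (rule has_integral_0_cbox_imp_0[OF _ _ int0])
       (use that in \<open>auto intro!: continuous_on_mult continuous_on_poly continuous_on_id\<close>)
  then have "{-1..1} \<subseteq> {x. poly p x = 0}" by auto
  then have "infinite {x. poly p x = 0}"
    using infinite_Icc[of "-1::real" 1] infinite_super[of "{-1..1::real}"] by simp
  then show ?thesis using poly_roots_finite by blast
qed

lemma Ip_square_pos: "p \<noteq> 0 \<Longrightarrow> Ip (p * p) > 0"
  using Ip_square_nonneg[of p] Ip_square_eq_0[of p] by fastforce

text \<open>Substitution of -x. It exchanges the nodes k and n - k, which is the source of the
  symmetry of the local matrices under simultaneous reversal of rows and columns.\<close>

definition mirror_poly :: "real poly \<Rightarrow> real poly" where
  "mirror_poly p = pcompose p [:0, -1:]"

lemma poly_reflect [simp]: "poly (mirror_poly p) x = poly p (- x)"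
  by (simp add: mirror_poly_def poly_pcompose)

lemma Ip_reflect: "Ip (mirror_poly p) = Ip p"
proof -
  have "poly (mirror_poly p) = (\<lambda>x. poly p (- x))" by (simp add: fun_eq_iff)
  then show ?thesis
    using Henstock_Kurzweil_Integration.integral_reflect_real[of 1 "-1" "poly p"] by (simp add: Ip_def)
qed

lemma reflect_mult: "mirror_poly (p * q) = mirror_poly p * mirror_poly q"
  by (simp add: mirror_poly_def pcompose_mult)

lemma pderiv_reflect: "pderiv (mirror_poly p) = - mirror_poly (pderiv p)"
  by (simp add: mirror_poly_def pderiv_pcompose pderiv_pCons)

text \<open>Here \<open>pCons 0 (pderiv f)\<close> is the test polynomial \<open>x f'\<close>.\<close>

lemma poly_eqI_eval: "(\<And>x. poly p x = poly q x) \<Longrightarrow> p = (q :: real poly)"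
  by (simp add: poly_eq_poly_eq_iff[symmetric] fun_eq_iff)

text \<open>By the product rule, twice the left integral is the integral of f'^2 plus f'(1)^2 +
  f'(-1)^2, while twice \<open>Ip (f * pCons 0 (pderiv f))\<close> is minus the integral of f^2,
  since f vanishes at the ends. So the left side is non-negative and the right side
  negative.\<close>

lemma pohozaev:
  assumes "f \<noteq> 0" "poly f 1 = 0" "poly f (-1) = 0" "\<nu> > 0"
  shows "Ip (pderiv f * pderiv (pCons 0 (pderiv f))) \<noteq> \<nu> * Ip (f * pCons 0 (pderiv f))"
proof
  assume *: "Ip (pderiv f * pderiv (pCons 0 (pderiv f))) = \<nu> * Ip (f * pCons 0 (pderiv f))"
  let ?d = "pderiv f"
  have 1: "Polynomial.smult 2 (?d * pderiv (pCons 0 ?d)) = ?d * ?d + pderiv (pCons 0 (?d * ?d))"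
    by (rule poly_eqI_eval, simp add: pderiv_pCons pderiv_mult algebra_simps)
  have 2: "Polynomial.smult 2 (f * pCons 0 ?d) = pderiv (pCons 0 (f * f)) - f * f"
    by (rule poly_eqI_eval, simp add: pderiv_pCons pderiv_mult algebra_simps)
  have "2 * Ip (?d * pderiv (pCons 0 ?d)) = Ip (?d * ?d + pderiv (pCons 0 (?d * ?d)))"
    unfolding 1[symmetric] by (rule Ip_smult[symmetric])
  also have "\<dots> = Ip (?d * ?d) + ((poly ?d 1)^2 + (poly ?d (-1))^2)"
    unfolding Ip_add Ip_pderiv by (simp add: power2_eq_square)
  finally have X: "2 * Ip (?d * pderiv (pCons 0 ?d)) = Ip (?d * ?d) + ((poly ?d 1)^2 + (poly ?d (-1))^2)" .
  have "2 * Ip (f * pCons 0 ?d) = Ip (pderiv (pCons 0 (f * f)) - f * f)"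
    unfolding 2[symmetric] by (rule Ip_smult[symmetric])
  also have "\<dots> = - Ip (f * f)"
    unfolding Ip_diff Ip_pderiv by (simp add: assms)
  finally have Y: "2 * Ip (f * pCons 0 ?d) = - Ip (f * f)" .
  have "\<nu> * Ip (f * f) > 0" using assms(1,4) by (simp add: Ip_square_pos)
  moreover have "\<nu> * Ip (f * f) = - (2 * Ip (?d * pderiv (pCons 0 ?d)))"
    unfolding * using Y by (metis add.inverse_inverse mult.left_commute mult_minus_right)
  ultimately show False
    unfolding X using Ip_square_nonneg[of ?d] zero_le_power2[of "poly ?d 1"] zero_le_power2[of "poly ?d (-1)"]
    by linarith
qed

section \<open>Lagrange interpolation at the nodes and the local bilinear forms\<close>

lemma fem_node_inject: "n \<ge> 1 \<Longrightarrow> fem_node n i = fem_node n j \<longleftrightarrow> i = j"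
  by (auto simp: fem_node_def field_simps)

lemma fem_node_0 [simp]: "fem_node n 0 = -1"
  by (simp add: fem_node_def)

lemma fem_node_n [simp]: "n \<ge> 1 \<Longrightarrow> fem_node n n = 1"
  by (simp add: fem_node_def)

lemma fem_node_reflect: "n \<ge> 1 \<Longrightarrow> k \<le> n \<Longrightarrow> fem_node n (n - k) = - fem_node n k"
  by (simp add: fem_node_def of_nat_diff field_simps)

lemma poly_eqI_nodes:
  assumes "n \<ge> 1" "degree p \<le> n" "degree q \<le> n"
    "\<And>k. k \<le> n \<Longrightarrow> poly p (fem_node n k) = poly q (fem_node n k)"
  shows "p = q"
proof -
  have "card (fem_node n ` {..n}) = n + 1"
    using assms(1) by (subst card_image) (auto intro!: inj_onI simp: fem_node_inject)
  then show ?thesis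
    using assms by (intro poly_eqI_degree[of "fem_node n ` {..n}"]) auto
qed

lemma
  assumes "n \<ge> 1" "l \<le> n"
  shows degree_lagrange: "degree (lagrange n l) \<le> n"
    and poly_lagrange: "k \<le> n \<Longrightarrow> poly (lagrange n l) (fem_node n k) = (if k = l then 1 else 0)"
  using theI'[OF lagrange_ex1[OF assms]] by (auto simp: lagrange_def)

text \<open>The nodes are symmetric about 0, so both polynomials have the same values at all n + 1
  nodes.\<close>

lemma reflect_lagrange:
  assumes "n \<ge> 1" "l \<le> n"
  shows "mirror_poly (lagrange n l) = lagrange n (n - l)"
proof (rule poly_eqI_nodes[OF assms(1)])
  show "degree (mirror_poly (lagrange n l)) \<le> n"
    using degree_lagrange[OF assms] by (simp add: mirror_poly_def degree_pcompose)
  show "degree (lagrange n (n - l)) \<le> n" using degree_lagrange[of n "n - l"] assms by simp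
  fix k assume "k \<le> n"
  then show "poly (mirror_poly (lagrange n l)) (fem_node n k) = poly (lagrange n (n - l)) (fem_node n k)"
    using assms poly_lagrange[of n l "n - k"] poly_lagrange[of n "n - l" k]
    by (auto simp: fem_node_reflect)
qed

text \<open>Coefficients in the Lagrange basis are nodal values, so this identifies nodal vectors
  with polynomials of degree at most n and turns statements about the matrices into statements about
  integrals.\<close>

definition interp :: "nat \<Rightarrow> (nat \<Rightarrow> real) \<Rightarrow> real poly" where
  "interp n U = (\<Sum>k\<le>n. Polynomial.smult (U k) (lagrange n k))"

lemma degree_interp: "n \<ge> 1 \<Longrightarrow> degree (interp n U) \<le> n"
  unfolding interp_def
  by (intro degree_sum_le) (auto intro: order_trans[OF degree_smult_le] degree_lagrange)

lemma poly_interp: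
  assumes "n \<ge> 1" "k \<le> n"
  shows "poly (interp n U) (fem_node n k) = U k"
proof -
  have "poly (interp n U) (fem_node n k) = (\<Sum>i\<le>n. if i = k then U i else 0)"
    unfolding interp_def poly_sum using assms by (intro sum.cong) (auto simp: poly_lagrange)
  then show ?thesis using assms by simp
qed

lemma interp_nodes:
  assumes "n \<ge> 1" "degree f \<le> n"
  shows "interp n (\<lambda>k. poly f (fem_node n k)) = f"
  using assms by (intro poly_eqI_nodes[of n]) (auto simp: degree_interp poly_interp)

lemma interp_eq_0:
  assumes "n \<ge> 1" "interp n U = 0" "k \<le> n"
  shows "U k = 0"
  using poly_interp[of n k U] assms by simp

text \<open>Nodal vectors are plain functions here, of which only the values at 0, ..., n matter;
  this spares carrier conditions when ends and interior are glued together.\<close>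

definition mform :: "nat \<Rightarrow> real mat \<Rightarrow> (nat \<Rightarrow> real) \<Rightarrow> (nat \<Rightarrow> real) \<Rightarrow> real" where
  "mform n M U V = (\<Sum>i\<le>n. \<Sum>j\<le>n. M $$ (i, j) * U i * V j)"

lemma mass_entry:
  "i \<le> n \<Longrightarrow> j \<le> n \<Longrightarrow> mass n $$ (i, j) = Ip (lagrange n i * lagrange n j)"
  by (simp add: mass_def Ip_def poly_mult_fun)

lemma stiff_entry:
  "i \<le> n \<Longrightarrow> j \<le> n \<Longrightarrow> stiff n $$ (i, j) = Ip (pderiv (lagrange n i) * pderiv (lagrange n j))"
  by (simp add: stiff_def Ip_def poly_mult_fun)

lemma mform_mass: "mform n (mass n) U V = Ip (interp n U * interp n V)"
  unfolding mform_def interp_def sum_product Ip_sum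
  by (intro sum.cong refl) (simp add: mass_entry Ip_smult)

lemma pderiv_sum_distrib: "pderiv (sum f A) = (\<Sum>i\<in>A. pderiv (f i))"
  by (induction A rule: infinite_finite_induct) (simp_all add: pderiv_add)

lemma pderiv_interp: "pderiv (interp n U) = (\<Sum>k\<le>n. Polynomial.smult (U k) (pderiv (lagrange n k)))"
  unfolding interp_def pderiv_sum_distrib pderiv_smult ..

lemma mform_stiff: "mform n (stiff n) U V = Ip (pderiv (interp n U) * pderiv (interp n V))"
  unfolding mform_def pderiv_interp sum_product Ip_sum
  by (intro sum.cong refl) (simp add: stiff_entry Ip_smult)

subsection \<open>Block form of the local matrices\<close>

lemma dim_flip [simp]: "dim_vec (flip p) = dim_vec p"
  by (simp add: flip_def)
lemma flip_carrier [simp]: "flip p \<in> carrier_vec N \<longleftrightarrow> p \<in> carrier_vec N"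
  unfolding carrier_vec_def by simp

lemma flip_index: "i < dim_vec p \<Longrightarrow> flip p $ i = p $ (dim_vec p - 1 - i)"
  by (simp add: flip_def)

lemma flip_flip [simp]: "flip (flip p) = p"
  by (rule eq_vecI) (auto simp: flip_def)

lemma flip_add: "p \<in> carrier_vec N \<Longrightarrow> q \<in> carrier_vec N \<Longrightarrow> flip (p + q) = flip p + flip q"
  by (rule eq_vecI) (auto simp: flip_def)

lemma flip_uminus: "flip (- p) = - flip p"
  by (rule eq_vecI) (auto simp: flip_def)

lemma flip_smult: "flip (c \<cdot>\<^sub>v p) = c \<cdot>\<^sub>v flip p"
  by (rule eq_vecI) (auto simp: flip_def)

lemma sum_flip: "(\<Sum>i\<in>{0..<N}. h (N - 1 - i)) = (\<Sum>i\<in>{0..<N}. h (i :: nat))"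
  by (rule sum.reindex_bij_witness[of _ "\<lambda>i. N - 1 - i" "\<lambda>i. N - 1 - i"]) auto

lemma flip_scalar:
  assumes "p \<in> carrier_vec N" "q \<in> carrier_vec N"
  shows "flip p \<bullet> q = p \<bullet> flip q"
proof -
  have "flip p \<bullet> q = (\<Sum>i\<in>{0..<N}. p $ (N - 1 - i) * q $ (N - 1 - (N - 1 - i)))"
    using assms by (auto simp: scalar_prod_def flip_def intro!: sum.cong)
  also have "\<dots> = (\<Sum>i\<in>{0..<N}. p $ i * q $ (N - 1 - i))"
    by (rule sum_flip[of "\<lambda>i. p $ i * q $ (N - 1 - i)"])
  also have "\<dots> = p \<bullet> flip q"
    using assms by (auto simp: scalar_prod_def flip_def intro!: sum.cong)
  finally show ?thesis .
qed

lemma sum_ends: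
  fixes h :: "nat \<Rightarrow> 'a :: comm_monoid_add"
  assumes "n \<ge> 1"
  shows "(\<Sum>i\<le>n. h i) = h 0 + (\<Sum>i\<in>{0..<n-1}. h (i + 1)) + h n"
proof -
  obtain m where n: "n = Suc m" using assms by (cases n) auto
  show ?thesis
    using sum.atMost_shift[of h m] by (simp add: n atLeast0LessThan)
qed

text \<open>Nodal vector with end values \<open>x\<close>, \<open>y\<close> and inner values
  \<open>p\<close>. Inner node k reads entry k - 1, because stored vectors are indexed from
  0.\<close>

definition glue :: "nat \<Rightarrow> real \<Rightarrow> real vec \<Rightarrow> real \<Rightarrow> nat \<Rightarrow> real" where
  "glue n x p y = (\<lambda>k. if k = 0 then x else if k = n then y else p $ (k - 1))"

lemma glue_simps [simp]:
  "glue n x p y 0 = x" "n \<ge> 1 \<Longrightarrow> glue n x p y n = y"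
  "i < n - 1 \<Longrightarrow> glue n x p y (Suc i) = p $ i"
  by (auto simp: glue_def)

text \<open>The bilinear form of one element in block notation, one summand for each block row, with
  the last row and column obtained from the first by reversal.\<close>

definition elem_form :: "nat \<Rightarrow> real mat \<Rightarrow> real \<Rightarrow> real vec \<Rightarrow> real \<Rightarrow> real \<Rightarrow> real vec \<Rightarrow> real \<Rightarrow> real" where
  "elem_form n M x p y x' p' y' =
     x' * (corner0 M * x + side n M \<bullet> p + cornern n M * y)
     + (x * (side n M \<bullet> p') + (inner_block n M *\<^sub>v p) \<bullet> p' + y * (flip (side n M) \<bullet> p'))
     + y' * (cornern n M * x + flip (side n M) \<bullet> p + corner0 M * y)"

text \<open>The two symmetries that the block form presupposes. Stiffness and mass matrix are both
  instances, so each block computation is done once for a generic matrix.\<close>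

locale centrosym =
  fixes n :: nat and M :: "real mat"
  assumes n2: "n \<ge> 2"
    and symm: "i \<le> n \<Longrightarrow> j \<le> n \<Longrightarrow> M $$ (j, i) = M $$ (i, j)"
    and centro: "i \<le> n \<Longrightarrow> j \<le> n \<Longrightarrow> M $$ (n - i, n - j) = M $$ (i, j)"
begin

lemma side_carrier [simp]: "side n M \<in> carrier_vec (n - 1)"
  by (simp add: side_def)

lemma inner_carrier [simp]: "inner_block n M \<in> carrier_mat (n - 1) (n - 1)"
  by (simp add: inner_block_def)

lemma dim_inner [simp]: "dim_vec (inner_block n M *\<^sub>v p) = n - 1" "dim_row (inner_block n M) = n - 1"
  by (simp_all add: inner_block_def)

lemma inner_mult_carrier [simp]: "inner_block n M *\<^sub>v p \<in> carrier_vec (n - 1)"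
  unfolding carrier_vec_def by simp

lemma inner_index:
  "p \<in> carrier_vec (n - 1) \<Longrightarrow> i < n - 1 \<Longrightarrow>
   (inner_block n M *\<^sub>v p) $ i = (\<Sum>j\<in>{0..<n-1}. M $$ (i + 1, j + 1) * p $ j)"
  by (auto simp: inner_block_def scalar_prod_def intro!: sum.cong)

lemma inner_symm:
  assumes "p \<in> carrier_vec (n - 1)" "q \<in> carrier_vec (n - 1)"
  shows "(inner_block n M *\<^sub>v p) \<bullet> q = p \<bullet> (inner_block n M *\<^sub>v q)"
proof -
  have "(inner_block n M *\<^sub>v p) \<bullet> q
      = (\<Sum>i\<in>{0..<n-1}. \<Sum>j\<in>{0..<n-1}. M $$ (i + 1, j + 1) * p $ j * q $ i)"
    using assms by (simp add: scalar_prod_def inner_index sum_distrib_right del: index_mult_mat_vec)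
  also have "\<dots> = (\<Sum>j\<in>{0..<n-1}. \<Sum>i\<in>{0..<n-1}. M $$ (i + 1, j + 1) * p $ j * q $ i)"
    by (rule sum.swap)
  also have "\<dots> = (\<Sum>j\<in>{0..<n-1}. \<Sum>i\<in>{0..<n-1}. p $ j * (M $$ (j + 1, i + 1) * q $ i))"
    using n2 by (intro sum.cong refl) (simp add: symm mult_ac)
  also have "\<dots> = p \<bullet> (inner_block n M *\<^sub>v q)"
    unfolding scalar_prod_def dim_inner using assms
    by (intro sum.cong refl) (simp add: inner_index sum_distrib_left del: index_mult_mat_vec)
  finally show ?thesis .
qed

text \<open>Reversing rows and columns together leaves the inner block unchanged, so reversal
  commutes with it. The parity of the inner eigenvectors rests on this.\<close>

lemma flip_inner:
  assumes "p \<in> carrier_vec (n - 1)"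
  shows "flip (inner_block n M *\<^sub>v p) = inner_block n M *\<^sub>v flip p"
proof (rule eq_vecI)
  fix i assume "i < dim_vec (inner_block n M *\<^sub>v flip p)"
  then have i: "i < n - 1" by (simp add: inner_block_def)
  have "flip (inner_block n M *\<^sub>v p) $ i = (inner_block n M *\<^sub>v p) $ (n - 2 - i)"
    using i by (simp add: flip_def inner_block_def)
  also have "\<dots> = (\<Sum>j\<in>{0..<n-1}. M $$ (n - 2 - i + 1, j + 1) * p $ j)"
    using i assms by (intro inner_index) auto
  also have "\<dots> = (\<Sum>j\<in>{0..<n-1}. M $$ (n - 2 - i + 1, (n - 1 - 1 - j) + 1) * p $ (n - 1 - 1 - j))"
    by (rule sum_flip[symmetric])
  also have "\<dots> = (\<Sum>j\<in>{0..<n-1}. M $$ (i + 1, j + 1) * flip p $ j)"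
  proof (intro sum.cong refl)
    fix j assume "j \<in> {0..<n-1}"
    then have "j < n - 1" by simp
    then show "M $$ (n - 2 - i + 1, (n - 1 - 1 - j) + 1) * p $ (n - 1 - 1 - j)
        = M $$ (i + 1, j + 1) * flip p $ j"
      using i assms centro[of "i + 1" "j + 1"]
      by (simp add: flip_index Suc_diff_Suc numeral_2_eq_2)
  qed
  also have "\<dots> = (inner_block n M *\<^sub>v flip p) $ i"
    using i assms by (intro inner_index[symmetric]) auto
  finally show "flip (inner_block n M *\<^sub>v p) $ i = (inner_block n M *\<^sub>v flip p) $ i" .
qed (simp add: inner_block_def)

text \<open>Splitting off both ends of each sum produces nine blocks; \<open>symm\<close> and
  \<open>centro\<close> express those in the last row and column through \<open>corner0\<close>,
  \<open>cornern\<close> and \<open>side\<close>.\<close>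

lemma mform_glue:
  assumes "p \<in> carrier_vec (n - 1)" "p' \<in> carrier_vec (n - 1)"
  shows "mform n M (glue n x p y) (glue n x' p' y') = elem_form n M x p y x' p' y'"
proof -
  have c1: "M $$ (n, n) = corner0 M" using centro[of 0 0] by (simp add: corner0_def)
  have c2: "M $$ (n, 0) = cornern n M" using symm[of 0 n] by (simp add: cornern_def)
  have s1: "M $$ (Suc i, 0) = side n M $ i" if "i < n - 1" for i using that by (simp add: side_def)
  have s2: "M $$ (0, Suc i) = side n M $ i" if "i < n - 1" for i
    using that s1[OF that] symm[of 0 "Suc i"] by simp
  have s3: "M $$ (Suc i, n) = flip (side n M) $ i" if "i < n - 1" for i
    using that centro[of "Suc (n - 2 - i)" 0] by (simp add: flip_def side_def Suc_diff_Suc numeral_2_eq_2)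
  have s4: "M $$ (n, Suc i) = flip (side n M) $ i" if "i < n - 1" for i
    using that s3[OF that] symm[of n "Suc i"] by simp
  have d: "dim_vec (side n M) = n - 1" "dim_vec p = n - 1" "dim_vec p' = n - 1"
    using assms by (auto simp: side_def)
  have n1: "1 \<le> n" using n2 by simp
  let ?I = "{0..<n-1}"
  have e: "(\<Sum>i\<in>?I. M $$ (0, i + 1) * x * p' $ i) = x * (side n M \<bullet> p')"
    "(\<Sum>i\<in>?I. M $$ (n, i + 1) * y * p' $ i) = y * (flip (side n M) \<bullet> p')"
    "(\<Sum>i\<in>?I. M $$ (i + 1, 0) * p $ i * x') = x' * (side n M \<bullet> p)"
    "(\<Sum>i\<in>?I. M $$ (i + 1, n) * p $ i * y') = y' * (flip (side n M) \<bullet> p)"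
    by (auto simp: scalar_prod_def d sum_distrib_left s1 s2 s3 s4 intro!: sum.cong)
  have e5: "(\<Sum>i\<in>?I. \<Sum>j\<in>?I. M $$ (i + 1, j + 1) * p $ i * p' $ j) = (inner_block n M *\<^sub>v p) \<bullet> p'"
    unfolding inner_symm[OF assms] unfolding scalar_prod_def dim_inner
    by (intro sum.cong refl)
      (simp add: inner_index[OF assms(2)] sum_distrib_left mult_ac del: index_mult_mat_vec)
  have glue': "glue n a q b 0 = a" "glue n a q b n = b" "i \<in> ?I \<Longrightarrow> glue n a q b (i + 1) = q $ i" for a q b i
    using n1 by auto
  have e6: "(\<Sum>i\<in>?I. M $$ (i + 1, 0) * p $ i * x' + (\<Sum>j\<in>?I. M $$ (i + 1, j + 1) * p $ i * p' $ j)
      + M $$ (i + 1, n) * p $ i * y')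
    = x' * (side n M \<bullet> p) + (inner_block n M *\<^sub>v p) \<bullet> p' + y' * (flip (side n M) \<bullet> p)"
    unfolding sum.distrib e e5 ..
  have c3: "M $$ (0, 0) = corner0 M" "M $$ (0, n) = cornern n M"
    by (simp_all add: corner0_def cornern_def)
  have "mform n M (glue n x p y) (glue n x' p' y') =
     (M $$ (0, 0) * x * x' + (\<Sum>i\<in>?I. M $$ (0, i + 1) * x * p' $ i) + M $$ (0, n) * x * y')
     + (\<Sum>i\<in>?I. M $$ (i + 1, 0) * p $ i * x' + (\<Sum>j\<in>?I. M $$ (i + 1, j + 1) * p $ i * p' $ j)
      + M $$ (i + 1, n) * p $ i * y')
     + (M $$ (n, 0) * y * x' + (\<Sum>i\<in>?I. M $$ (n, i + 1) * y * p' $ i) + M $$ (n, n) * y * y')"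
    unfolding mform_def sum_ends[OF n1] glue'(1,2) by (simp only: glue'(3) cong: sum.cong)
  then show ?thesis
    unfolding e e6 c1 c2 c3 elem_form_def by (simp add: algebra_simps)
qed

lemma elem_form_symm:
  assumes "p \<in> carrier_vec (n - 1)" "p' \<in> carrier_vec (n - 1)"
  shows "elem_form n M x p y x' p' y' = elem_form n M x' p' y' x p y"
  unfolding elem_form_def inner_symm[OF assms]
  using comm_scalar_prod[OF inner_mult_carrier assms(1)] assms
  by (simp add: algebra_simps)

end

text \<open>Mirroring sends basis function i to basis function n - i and preserves integrals over
  the symmetric interval.\<close>

lemma centrosym_mass:
  assumes "n \<ge> 2"
  shows "centrosym n (mass n)"
proof
  fix i j assume ij: "i \<le> n" "j \<le> n"
  show "mass n $$ (j, i) = mass n $$ (i, j)"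
    using ij by (simp add: mass_entry mult.commute)
  show "mass n $$ (n - i, n - j) = mass n $$ (i, j)"
    using ij assms by (simp add: mass_entry reflect_lagrange[symmetric] reflect_mult[symmetric] Ip_reflect)
qed fact

text \<open>As for the mass matrix; the two minus signs from differentiating mirrored polynomials
  cancel.\<close>

lemma centrosym_stiff:
  assumes "n \<ge> 2"
  shows "centrosym n (stiff n)"
proof
  fix i j assume ij: "i \<le> n" "j \<le> n"
  show "stiff n $$ (j, i) = stiff n $$ (i, j)"
    using ij by (simp add: stiff_entry mult.commute)
  show "stiff n $$ (n - i, n - j) = stiff n $$ (i, j)"
    using ij assms
    by (simp add: stiff_entry reflect_lagrange[symmetric] pderiv_reflect reflect_mult[symmetric] Ip_reflect)
qed fact

subsection \<open>Symmetric definite pencils\<close>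

lemma det_nonzero_inverse:
  fixes A :: "'a :: field mat"
  assumes A: "A \<in> carrier_mat d d" and "det A \<noteq> 0"
  obtains B where "B \<in> carrier_mat d d" "A * B = 1\<^sub>m d" "B * A = 1\<^sub>m d"
  using det_non_zero_imp_unit[OF assms, of "()"] by (auto simp: Units_def ring_mat_def)

lemma det_nonzeroI:
  fixes A :: "'a :: field mat"
  assumes "A \<in> carrier_mat d d"
    and "\<And>v. v \<in> carrier_vec d \<Longrightarrow> A *\<^sub>v v = 0\<^sub>v d \<Longrightarrow> v = 0\<^sub>v d"
  shows "det A \<noteq> 0"
  using det_0_iff_vec_prod_zero_field[OF assms(1)] assms(2) by blast

text \<open>A square linear system with trivial kernel is solvable, for arbitrary finite index sets
  of equal size. Both completeness arguments, for the inner eigenvectors and for the global modes,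
  are reduced to this count.\<close>

lemma injective_system_surj:
  fixes s :: "'i \<Rightarrow> 'j \<Rightarrow> 'a :: field"
  assumes fin: "finite I" "finite J" and card: "card I = card J"
    and inj: "\<And>c i. (\<And>j. j \<in> J \<Longrightarrow> (\<Sum>i\<in>I. c i * s i j) = 0) \<Longrightarrow> i \<in> I \<Longrightarrow> c i = 0"
  shows "\<exists>c. \<forall>j\<in>J. w j = (\<Sum>i\<in>I. c i * s i j)"
proof -
  let ?N = "card I"
  obtain f where f: "bij_betw f {0..<?N} I" using ex_bij_betw_nat_finite[OF fin(1)] by blast
  obtain g where g: "bij_betw g {0..<?N} J" using ex_bij_betw_nat_finite[OF fin(2)] card by auto
  define fi where "fi = the_inv_into {0..<?N} f"
  define gi where "gi = the_inv_into {0..<?N} g"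
  have fi: "fi (f q) = q" "f q \<in> I" if "q < ?N" for q
    using f that by (auto simp: fi_def bij_betw_def the_inv_into_f_f)
  have gi: "g (gi j) = j" "gi j < ?N" if "j \<in> J" for j
    using g that f_the_inv_into_f[of g "{0..<?N}" j] the_inv_into_into[of g "{0..<?N}" j "{0..<?N}"]
    by (auto simp: gi_def bij_betw_def)
  define A where "A = mat ?N ?N (\<lambda>(r, q). s (f q) (g r))"
  have A: "A \<in> carrier_mat ?N ?N" by (simp add: A_def)
  have Av: "(A *\<^sub>v v) $ gi j = (\<Sum>i\<in>I. v $ fi i * s i j)" if "v \<in> carrier_vec ?N" "j \<in> J" for v j
  proof -
    have "(A *\<^sub>v v) $ gi j = (\<Sum>q\<in>{0..<?N}. s (f q) j * v $ q)"
      using that gi[OF that(2)] by (auto simp: A_def scalar_prod_def intro!: sum.cong)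
    also have "\<dots> = (\<Sum>q\<in>{0..<?N}. v $ fi (f q) * s (f q) j)"
      by (intro sum.cong) (auto simp: fi)
    also have "\<dots> = (\<Sum>i\<in>I. v $ fi i * s i j)"
      by (rule sum.reindex_bij_betw[OF f])
    finally show ?thesis .
  qed
  have "det A \<noteq> 0"
  proof (rule det_nonzeroI[OF A])
    fix v assume v: "v \<in> carrier_vec ?N" and "A *\<^sub>v v = 0\<^sub>v ?N"
    then have "(\<Sum>i\<in>I. v $ fi i * s i j) = 0" if "j \<in> J" for j
      using Av[OF v that] gi[OF that] by simp
    then have "v $ fi i = 0" if "i \<in> I" for i
      using inj[of "\<lambda>i. v $ fi i" i] that by blast
    then show "v = 0\<^sub>v ?N"
      using v fi by (intro eq_vecI) (auto, metis)
  qed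
  then obtain B where B: "B \<in> carrier_mat ?N ?N" "A * B = 1\<^sub>m ?N"
    using det_nonzero_inverse[OF A] by blast
  define u where "u = B *\<^sub>v vec ?N (\<lambda>r. w (g r))"
  have u: "u \<in> carrier_vec ?N" using B(1) unfolding u_def by (rule mult_mat_vec_carrier) simp
  have "A *\<^sub>v u = (A * B) *\<^sub>v vec ?N (\<lambda>r. w (g r))"
    unfolding u_def by (rule assoc_mult_mat_vec[symmetric, OF A B(1)]) simp
  then have Au: "A *\<^sub>v u = vec ?N (\<lambda>r. w (g r))" by (simp add: B(2))
  have "w j = (\<Sum>i\<in>I. u $ fi i * s i j)" if "j \<in> J" for j
    using Av[OF u that] gi[OF that] by (simp add: Au)
  then show ?thesis by (intro exI[of _ "\<lambda>i. u $ fi i"]) simp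
qed

lemma poly_pencil_poly:
  assumes "M \<in> carrier_mat d d" "N \<in> carrier_mat d d"
  shows "poly (pencil_poly d M N) x = det (M - x \<cdot>\<^sub>m N)"
  unfolding pencil_poly_def
  by (rule poly_det_cong[of _ d]) (use assms in auto)

lemma minus_smult_mat_mult_vec:
  fixes M N :: "'a :: comm_ring_1 mat"
  assumes "M \<in> carrier_mat d d" "N \<in> carrier_mat d d" "v \<in> carrier_vec d"
  shows "(M - x \<cdot>\<^sub>m N) *\<^sub>v v = M *\<^sub>v v - x \<cdot>\<^sub>v (N *\<^sub>v v)"
proof -
  have "(x \<cdot>\<^sub>m N) *\<^sub>v v = x \<cdot>\<^sub>v (N *\<^sub>v v)" using assms by (intro eq_vecI) auto
  then show ?thesis using assms by (subst minus_mult_distrib_mat_vec[of _ d d]) auto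
qed

lemma minus_vec_eq_0_iff:
  fixes a b :: "'a :: group_add vec"
  assumes "a \<in> carrier_vec d" "b \<in> carrier_vec d"
  shows "a - b = 0\<^sub>v d \<longleftrightarrow> a = b"
proof
  assume "a - b = 0\<^sub>v d"
  then have "a $ i - b $ i = 0" if "i < d" for i
    using assms that by (metis carrier_vecD index_minus_vec(1) index_zero_vec(1))
  then show "a = b" using assms by (intro eq_vecI) auto
qed (use assms in auto)

lemma pencil_spectrum_det:
  assumes "M \<in> carrier_mat d d" "N \<in> carrier_mat d d"
  shows "\<nu> \<in> pencil_spectrum d M N \<longleftrightarrow> det (M - \<nu> \<cdot>\<^sub>m N) = 0"
proof -
  have c: "M - \<nu> \<cdot>\<^sub>m N \<in> carrier_mat d d" using assms by auto
  have eq: "(M - \<nu> \<cdot>\<^sub>m N) *\<^sub>v v = 0\<^sub>v d \<longleftrightarrow> M *\<^sub>v v = \<nu> \<cdot>\<^sub>v (N *\<^sub>v v)" if v: "v \<in> carrier_vec d" for v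
  proof -
    have "M *\<^sub>v v \<in> carrier_vec d" "\<nu> \<cdot>\<^sub>v (N *\<^sub>v v) \<in> carrier_vec d"
      using assms v by auto
    then show ?thesis
      unfolding minus_smult_mat_mult_vec[OF assms v] by (rule minus_vec_eq_0_iff)
  qed
  show ?thesis
    unfolding det_0_iff_vec_prod_zero_field[OF c] pencil_spectrum_def using eq by blast
qed

lemma simple_root_pderiv:
  fixes p :: "real poly"
  assumes "p \<noteq> 0" "poly p a = 0" "Polynomial.order a p = 1"
  shows "poly (pderiv p) a \<noteq> 0"
proof -
  have "pderiv p \<noteq> 0"
  proof
    assume "pderiv p = 0"
    then obtain c where "p = [:c:]" using pderiv_iszero by blast
    then show False using assms(1,2) by simp
  qed
  then show ?thesis
    using order_pderiv[of p a] assms by (simp add: order_root)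
qed

text \<open>The matrix \<open>B\<close>, the inverse of \<open>N\<close> times \<open>M\<close>, is
  self-adjoint in the inner product given by \<open>N\<close>, so every complex root of its
  characteristic polynomial is real. Algebraic simplicity makes the d roots distinct.\<close>

lemma card_pencil_spectrum:
  fixes M N :: "real mat"
  assumes M: "M \<in> carrier_mat d d" and N: "N \<in> carrier_mat d d"
    and Ms: "\<And>x y. x \<in> carrier_vec d \<Longrightarrow> y \<in> carrier_vec d \<Longrightarrow> (M *\<^sub>v x) \<bullet> y = x \<bullet> (M *\<^sub>v y)"
    and Ns: "\<And>x y. x \<in> carrier_vec d \<Longrightarrow> y \<in> carrier_vec d \<Longrightarrow> (N *\<^sub>v x) \<bullet> y = x \<bullet> (N *\<^sub>v y)"
    and pos: "\<And>x. x \<in> carrier_vec d \<Longrightarrow> x \<noteq> 0\<^sub>v d \<Longrightarrow> (N *\<^sub>v x) \<bullet> x > 0"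
    and simple: "\<And>\<nu>. \<nu> \<in> pencil_spectrum d M N \<Longrightarrow> simple_eigenvalue d M N \<nu>"
  shows "finite (pencil_spectrum d M N) \<and> card (pencil_spectrum d M N) = d"
proof -
  have "det N \<noteq> 0"
  proof (rule det_nonzeroI[OF N])
    fix v assume "v \<in> carrier_vec d" "N *\<^sub>v v = 0\<^sub>v d"
    then show "v = 0\<^sub>v d" using pos[of v] by fastforce
  qed
  then obtain N' where N': "N' \<in> carrier_mat d d" "N * N' = 1\<^sub>m d"
    using det_nonzero_inverse[OF N] by blast
  define B where "B = N' * M"
  have B: "B \<in> carrier_mat d d" using N' M by (simp add: B_def)
  have NB: "N * B = M"
    unfolding B_def using assoc_mult_mat[OF N N'(1) M] N'(2) M by simp
  have NBv: "M *\<^sub>v x = N *\<^sub>v (B *\<^sub>v x)" if "x \<in> carrier_vec d" for x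
    using assoc_mult_mat_vec[OF N B that] NB by simp
  let ?p = "pencil_poly d M N"
  \<comment> \<open>The factor is det (- N) and not det N, because the characteristic polynomial is
    det (x - B) while the pencil is M - x N.\<close>
  have p: "?p = Polynomial.smult (det (- N)) (char_poly B)"
  proof (rule poly_eqI_eval)
    fix x
    have "N * char_matrix B x = M + (- x) \<cdot>\<^sub>m N"
      unfolding char_matrix_def using N B
      by (subst mult_add_distrib_mat[of _ d d _ d]) (auto simp: NB mult_smult_distrib[OF N])
    also have "\<dots> = M - x \<cdot>\<^sub>m N" using M N by (intro eq_matI) auto
    also have "N * char_matrix B x = (- N) * (- char_matrix B x)"
      using carrier_matD[OF N] carrier_matD[OF char_matrix_closed[OF B, of x]] by simp
    finally show "poly ?p x = poly (Polynomial.smult (det (- N)) (char_poly B)) x"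
      unfolding poly_pencil_poly[OF M N] poly_smult char_poly_matrix[OF B]
      using det_mult[of "- N" d "- char_matrix B x"] N char_matrix_closed[OF B, of x] by simp
  qed
  have detN: "det (- N) \<noteq> 0" using \<open>det N \<noteq> 0\<close> det_0_negate[OF N] by simp
  have degB: "degree (char_poly B) = d" and "char_poly B \<noteq> 0"
    using degree_monic_char_poly[OF B] by auto
  have root: "\<nu> \<in> pencil_spectrum d M N \<longleftrightarrow> poly (char_poly B) \<nu> = 0" for \<nu>
    unfolding pencil_spectrum_det[OF M N] poly_pencil_poly[OF M N, symmetric] p using detN by simp
  have sq: "poly (pderiv (char_poly B)) \<nu> \<noteq> 0" if "poly (char_poly B) \<nu> = 0" for \<nu>
    using simple[of \<nu>] that unfolding root simple_eigenvalue_def p order_smult[OF detN]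
    by (intro simple_root_pderiv \<open>char_poly B \<noteq> 0\<close>) auto
  define q where "q = map_poly complex_of_real (char_poly B)"
  let ?Bc = "map_mat complex_of_real B"
  have Bc: "?Bc \<in> carrier_mat d d" using B by simp
  have q: "q = char_poly ?Bc" unfolding q_def by (rule of_real_hom.char_poly_hom[OF B, symmetric])
  have real: "Im z = 0" if "poly q z = 0" for z
  proof -
    from that have "eigenvalue ?Bc z" unfolding q eigenvalue_root_char_poly[OF Bc] .
    then obtain v where "eigenvector ?Bc v z" by (auto simp: eigenvalue_def)
    then have v: "v \<in> carrier_vec d" "v \<noteq> 0\<^sub>v d" "?Bc *\<^sub>v v = z \<cdot>\<^sub>v v"
      using B by (auto simp: eigenvector_def)
    \<comment> \<open>With v = x + i y the eigenvalue equation becomes a real pair for M x and M y.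
      Equating (M x) . y with x . (M y) leaves Im z times (N y) . y + (N x) . x, and the latter is
      positive.\<close>
    define x y where "x = map_vec Re v" and "y = map_vec Im v"
    have xy: "x \<in> carrier_vec d" "y \<in> carrier_vec d" using v by (auto simp: x_def y_def)
    have c: "(?Bc *\<^sub>v v) $ i = z * v $ i" if "i < d" for i using v that by simp
    have "B *\<^sub>v x = Re z \<cdot>\<^sub>v x - Im z \<cdot>\<^sub>v y"
    proof (rule eq_vecI)
      fix i assume "i < dim_vec (Re z \<cdot>\<^sub>v x - Im z \<cdot>\<^sub>v y)"
      then have i: "i < d" using xy by simp
      have "(B *\<^sub>v x) $ i = Re ((?Bc *\<^sub>v v) $ i)"
        using i B v(1) by (simp add: x_def scalar_prod_def)
      also have "\<dots> = (Re z \<cdot>\<^sub>v x - Im z \<cdot>\<^sub>v y) $ i"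
        unfolding c[OF i] using i v(1) by (simp add: x_def y_def)
      finally show "(B *\<^sub>v x) $ i = (Re z \<cdot>\<^sub>v x - Im z \<cdot>\<^sub>v y) $ i" .
    qed (use B xy in simp)
    then have Mx: "M *\<^sub>v x = Re z \<cdot>\<^sub>v (N *\<^sub>v x) - Im z \<cdot>\<^sub>v (N *\<^sub>v y)"
      using xy N by (simp add: NBv mult_minus_distrib_mat_vec[of _ d d] mult_mat_vec[of _ d d])
    have "B *\<^sub>v y = Re z \<cdot>\<^sub>v y + Im z \<cdot>\<^sub>v x"
    proof (rule eq_vecI)
      fix i assume "i < dim_vec (Re z \<cdot>\<^sub>v y + Im z \<cdot>\<^sub>v x)"
      then have i: "i < d" using xy by simp
      have "(B *\<^sub>v y) $ i = Im ((?Bc *\<^sub>v v) $ i)"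
        using i B v(1) by (simp add: y_def scalar_prod_def)
      also have "\<dots> = (Re z \<cdot>\<^sub>v y + Im z \<cdot>\<^sub>v x) $ i"
        unfolding c[OF i] using i v(1) by (simp add: x_def y_def)
      finally show "(B *\<^sub>v y) $ i = (Re z \<cdot>\<^sub>v y + Im z \<cdot>\<^sub>v x) $ i" .
    qed (use B xy in simp)
    then have My: "M *\<^sub>v y = Re z \<cdot>\<^sub>v (N *\<^sub>v y) + Im z \<cdot>\<^sub>v (N *\<^sub>v x)"
      using xy N by (simp add: NBv mult_add_distrib_mat_vec[of _ d d] mult_mat_vec[of _ d d])
    have Nc: "N *\<^sub>v x \<in> carrier_vec d" "N *\<^sub>v y \<in> carrier_vec d" using N xy by auto
    have 1: "(M *\<^sub>v x) \<bullet> y = Re z * ((N *\<^sub>v x) \<bullet> y) - Im z * ((N *\<^sub>v y) \<bullet> y)"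
      unfolding Mx using Nc xy by (subst minus_scalar_prod_distrib[of _ d]) auto
    have 2: "x \<bullet> (M *\<^sub>v y) = Re z * (x \<bullet> (N *\<^sub>v y)) + Im z * (x \<bullet> (N *\<^sub>v x))"
      unfolding My using Nc xy by (subst scalar_prod_add_distrib[of _ d]) auto
    have "Im z * ((N *\<^sub>v y) \<bullet> y + (N *\<^sub>v x) \<bullet> x) = 0"
      using 1 2 Ms[OF xy] Ns[OF xy] Ns[OF xy(1) xy(1)] by (simp add: algebra_simps)
    moreover have "x \<noteq> 0\<^sub>v d \<or> y \<noteq> 0\<^sub>v d"
    proof (rule ccontr)
      assume "\<not> ?thesis"
      then have "x $ i = 0 \<and> y $ i = 0" if "i < d" for i using that by simp
      then have "v = 0\<^sub>v d"
        using v(1) by (intro eq_vecI) (auto simp: x_def y_def complex_eq_iff)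
      then show False using v(2) by simp
    qed
    moreover have "(N *\<^sub>v x) \<bullet> x \<ge> 0" "(N *\<^sub>v y) \<bullet> y \<ge> 0"
      using pos[OF xy(1)] pos[OF xy(2)] Nc
      by (cases "x = 0\<^sub>v d", simp, simp) (cases "y = 0\<^sub>v d", use Nc pos[OF xy(2)] in simp_all)
    ultimately have "(N *\<^sub>v y) \<bullet> y + (N *\<^sub>v x) \<bullet> x \<noteq> 0"
      using pos[OF xy(1)] pos[OF xy(2)] by linarith
    with \<open>Im z * _ = 0\<close> show ?thesis by simp
  qed
  have roots: "{z. poly q z = 0} = complex_of_real ` pencil_spectrum d M N"
  proof (intro equalityI subsetI)
    fix z assume "z \<in> {z. poly q z = 0}"
    then have "poly q z = 0" by simp
    with real[OF this] have "z = complex_of_real (Re z)" by (simp add: complex_eq_iff)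
    moreover have "poly q (complex_of_real (Re z)) = complex_of_real (poly (char_poly B) (Re z))"
      unfolding q_def by (rule of_real_hom.poly_map_poly)
    ultimately have "poly (char_poly B) (Re z) = 0" using \<open>poly q z = 0\<close> by simp
    then show "z \<in> complex_of_real ` pencil_spectrum d M N"
      using root \<open>z = complex_of_real (Re z)\<close> by blast
  qed (auto simp: root q_def)
  \<comment> \<open>Over the complex numbers a square-free polynomial has as many roots as its
    degree. A root shared with the derivative would be real, and \<open>sq\<close> excludes
    it.\<close>
  have "rsquarefree q"
    unfolding rsquarefree_roots
  proof (intro allI notI, elim conjE)
    fix z assume z: "poly q z = 0" "poly (pderiv q) z = 0"
    then obtain \<nu> where \<nu>: "z = complex_of_real \<nu>" "poly (char_poly B) \<nu> = 0"
      using roots root by blast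
    then show False using z(2) sq[OF \<nu>(2)]
      unfolding q_def of_real_hom.map_poly_pderiv[symmetric] by simp
  qed
  moreover have "q \<noteq> 0" using \<open>char_poly B \<noteq> 0\<close> by (simp add: q_def)
  moreover have "degree q = d" using degB by (simp add: q_def)
  ultimately have "card {z. poly q z = 0} = d" "finite {z. poly q z = 0}"
    using rsquarefree_card_degree[of q] poly_roots_finite[of q] by auto
  then show ?thesis
    unfolding roots by (simp add: card_image inj_on_def finite_image_iff)
qed

subsection \<open>Interlacing\<close>

text \<open>Exactly the m - 1 - i factors with j > i are negative.\<close>

lemma prod_sign_alternates:
  fixes \<nu> :: "nat \<Rightarrow> real"
  assumes mono: "\<And>i j. i < j \<Longrightarrow> j < m \<Longrightarrow> \<nu> i < \<nu> j" and "i < m"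
  shows "(-1) ^ (m - 1 - i) * (\<Prod>j\<in>{..<m}-{i}. \<nu> i - \<nu> j) > 0"
proof -
  have s: "{..<m} - {i} = {..<i} \<union> {Suc i..<m}" using assms(2) by auto
  have "(\<Prod>j\<in>{Suc i..<m}. - (\<nu> i - \<nu> j)) = (-1) ^ (m - 1 - i) * (\<Prod>j\<in>{Suc i..<m}. \<nu> i - \<nu> j)"
    using prod_uminus[of "\<lambda>j. \<nu> i - \<nu> j" "{Suc i..<m}"] by simp
  moreover have "(\<Prod>j\<in>{Suc i..<m}. - (\<nu> i - \<nu> j)) > 0"
    using mono by (intro prod_pos) auto
  moreover have "(\<Prod>j\<in>{..<i}. \<nu> i - \<nu> j) > 0"
    using mono assms(2) by (intro prod_pos) auto
  ultimately show ?thesis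
    unfolding s by (subst prod.union_disjoint) (auto simp: zero_less_mult_iff mult_less_0_iff)
qed

text \<open>The products in the hypotheses alternate in sign along the ordered points, hence so does
  \<open>D\<close> at 0 and at the points of \<open>S\<close>. It is positive at the last of these
  and negative far to the right, so each of the \<open>card S + 1\<close> gaps contains a root. The
  degree bound then excludes every further root, real or complex.\<close>

lemma interlacing_roots:
  fixes D :: "real poly"
  assumes fin: "finite S" and pos: "\<And>s. s \<in> S \<Longrightarrow> s > 0"
    and deg: "degree D \<le> card S + 1" and lead: "coeff D (card S + 1) < 0"
    and at_0: "poly D 0 * (\<Prod>s\<in>S. - s) > 0"
    and at_S: "\<And>s. s \<in> S \<Longrightarrow> poly D s * (\<Prod>t\<in>S-{s}. s - t) > 0"
  shows "{z. poly (map_poly complex_of_real D) z = 0} = complex_of_real ` {x. x > 0 \<and> poly D x = 0}"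
    and "card {x. x > 0 \<and> poly D x = 0} = card S + 1"
proof -
  let ?m = "card S"
  define xs where "xs = sorted_list_of_set S"
  have xs: "set xs = S" "length xs = ?m" "sorted_wrt (<) xs" "distinct xs"
    using fin by (auto simp: xs_def)
  have S: "bij_betw ((!) xs) {..<?m} S" using bij_betw_nth[OF xs(4)] xs by auto
  have mono: "xs ! i < xs ! j" if "i < j" "j < ?m" for i j
    using sorted_wrt_nth_less[OF xs(3)] that xs(2) by simp
  have inS: "xs ! i \<in> S" if "i < ?m" for i using that xs by (metis nth_mem)
  have "degree D = ?m + 1" using deg lead le_degree[of D "?m + 1"] by fastforce
  then have "lead_coeff (- D) > 0" using lead by simp
  then obtain R0 where R0: "\<And>x. x \<ge> R0 \<Longrightarrow> poly (- D) x \<ge> lead_coeff (- D)"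
    using poly_pinfty_gt_lc by blast
  \<comment> \<open>Beyond \<open>R0\<close> the sign of \<open>D\<close> is that of its leading
    coefficient; including 0 in the maximum makes \<open>R\<close> positive even for empty
    \<open>S\<close>.\<close>
  define R where "R = max R0 (Max (insert 0 S) + 1)"
  have "R \<ge> R0" by (simp add: R_def)
  then have DR: "poly D R < 0" using R0[of R] \<open>lead_coeff (- D) > 0\<close> by simp
  have "s < R" if "s \<in> insert 0 S" for s
  proof -
    have "s \<le> Max (insert 0 S)" using fin that by (intro Max_ge) auto
    then show ?thesis unfolding R_def by linarith
  qed
  then have R: "R > 0" "\<And>s. s \<in> S \<Longrightarrow> s < R" by auto
  \<comment> \<open>The grid 0, then the points of \<open>S\<close> in increasing order (the list
    starts at index 0, hence i - 1), then \<open>R\<close>.\<close>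
  define x where "x i = (if i = 0 then 0 else if i \<le> ?m then xs ! (i - 1) else R)" for i
  have x_mono: "x i < x (Suc i)" if "i \<le> ?m" for i
    using that R inS pos mono[of "i - 1" i] by (auto simp: x_def)
  have x_less: "x i < x j" if "i < j" "j \<le> Suc ?m" for i j
    using that
  proof (induction j)
    case (Suc j)
    then show ?case using x_mono[of j] by (cases "i = j") force+
  qed simp
  have sgn: "(-1) ^ (?m - i) * poly D (x i) > 0" if "i \<le> ?m" for i
  proof (cases i)
    case 0
    have "(\<Prod>s\<in>S. - s) = (-1) ^ ?m * \<Prod>S" by (simp add: prod_uminus)
    moreover have "\<Prod>S > 0" using pos by (intro prod_pos) auto
    ultimately show ?thesis
      using at_0 0 by (auto simp: x_def zero_less_mult_iff mult_less_0_iff)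
  next
    case (Suc k)
    then have k: "k < ?m" using that by simp
    have "(\<Prod>t\<in>S-{xs ! k}. xs ! k - t) = (\<Prod>j\<in>{..<?m}-{k}. xs ! k - xs ! j)"
    proof (rule prod.reindex_bij_betw[symmetric])
      show "bij_betw ((!) xs) ({..<?m} - {k}) (S - {xs ! k})"
        using bij_betw_DiffI[OF S, of "{k}" "{xs ! k}"] k inS[OF k] by (simp add: bij_betw_def)
    qed
    then have "poly D (xs ! k) * (\<Prod>j\<in>{..<?m}-{k}. xs ! k - xs ! j) > 0"
      using at_S[OF inS[OF k]] by simp
    moreover have "(-1) ^ (?m - 1 - k) * (\<Prod>j\<in>{..<?m}-{k}. xs ! k - xs ! j) > 0"
      by (rule prod_sign_alternates) (use mono k in auto)
    ultimately show ?thesis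
      using Suc k by (auto simp: x_def zero_less_mult_iff mult_less_0_iff)
  qed
  have "\<exists>r. x i < r \<and> r < x (Suc i) \<and> poly D r = 0" if "i \<le> ?m" for i
  proof (rule poly_IVT[OF x_mono[OF that]])
    show "poly D (x i) * poly D (x (Suc i)) < 0"
    proof (cases "i = ?m")
      case True
      then show ?thesis using sgn[of i] DR by (auto simp: x_def mult_less_0_iff)
    next
      case False
      then have "(-1::real) ^ (?m - i) = - ((-1) ^ (?m - Suc i))"
        using that by (subst Suc_diff_Suc[symmetric]) auto
      then show ?thesis
        using sgn[of i] sgn[of "Suc i"] that False by (auto simp: zero_less_mult_iff mult_less_0_iff)
    qed
  qed
  then obtain r where r: "\<And>i. i \<le> ?m \<Longrightarrow> x i < r i \<and> r i < x (Suc i) \<and> poly D (r i) = 0"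
    by metis
  have r_less: "r i < r j" if "i < j" "j \<le> ?m" for i j
  proof -
    have "x (Suc i) \<le> x j" using x_less[of "Suc i" j] that by (cases "Suc i = j") auto
    then show ?thesis using r[of i] r[of j] that by fastforce
  qed
  have inj: "inj_on r {..?m}"
    using r_less by (intro linorder_inj_onI) (auto dest: less_imp_neq)
  have pos_r: "r i > 0" if "i \<le> ?m" for i
    using r[OF that] x_less[of 0 i] that by (cases "i = 0") (auto simp: x_def)
  have "D \<noteq> 0" using lead by auto
  let ?q = "map_poly complex_of_real D" and ?P = "{x. x > 0 \<and> poly D x = 0}"
  have q: "?q \<noteq> 0" "degree ?q = ?m + 1" using \<open>D \<noteq> 0\<close> \<open>degree D = ?m + 1\<close> by simp_all
  have fP: "finite ?P" using poly_roots_finite[OF \<open>D \<noteq> 0\<close>] by (rule rev_finite_subset) auto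
  have "r ` {..?m} \<subseteq> ?P" using r pos_r by auto
  then have ge: "?m + 1 \<le> card ?P"
    using card_mono[OF fP, of "r ` {..?m}"] card_image[OF inj] by simp
  have sub: "complex_of_real ` ?P \<subseteq> {z. poly ?q z = 0}" by auto
  have cP: "card (complex_of_real ` ?P) = card ?P" by (intro card_image) (simp add: inj_on_def)
  have fq: "finite {z. poly ?q z = 0}" by (rule poly_roots_finite[OF q(1)])
  have le: "card {z. poly ?q z = 0} \<le> ?m + 1" using card_poly_roots_bound[OF q(1)] q(2) by simp
  have "card (complex_of_real ` ?P) \<le> card {z. poly ?q z = 0}" by (rule card_mono[OF fq sub])
  then show "card ?P = ?m + 1" using ge le cP by linarith
  then show "{z. poly ?q z = 0} = complex_of_real ` ?P"
    using card_seteq[OF fq sub] le cP by simp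
qed

subsection \<open>Local eigenpairs\<close>

text \<open>Otherwise \<open>n - 1\<close> is rewritten to \<open>n - Suc 0\<close>, and the carrier facts no longer match.\<close>

declare One_nat_def [simp del]

lemma vec_self_prod_pos:
  fixes q :: "real vec"
  assumes "q \<in> carrier_vec d" "q \<noteq> 0\<^sub>v d"
  shows "q \<bullet> q > 0"
proof -
  obtain i where i: "i < d" "q $ i \<noteq> 0"
    using assms by (metis carrier_vecD eq_vecI index_zero_vec)
  have "0 < (\<Sum>i\<in>{0..<d}. q $ i * q $ i)"
    by (rule sum_pos2[of _ i]) (use i in \<open>auto simp: zero_less_mult_iff\<close>)
  then show ?thesis using assms(1) by (simp add: scalar_prod_def)
qed

context centrosym
begin

text \<open>The even and odd parts of the nodal vector \<open>(1, p, 0)\<close> enter with the weights \<open>1 + \<theta>\<close> and \<open>1 - \<theta>\<close>.\<close>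

lemma condensed_form_pos:
  assumes p: "p \<in> carrier_vec (n - 1)" and Tp: "inner_block n M *\<^sub>v p = - side n M"
    and nonneg: "\<And>q. q \<in> carrier_vec (n - 1) \<Longrightarrow> elem_form n M 1 q 1 1 q 1 \<ge> 0"
    and pos: "\<And>q. q \<in> carrier_vec (n - 1) \<Longrightarrow> elem_form n M 1 q (-1) 1 q (-1) > 0"
    and \<theta>: "\<bar>\<theta>\<bar> < 1"
  shows "corner0 M + \<theta> * cornern n M + (side n M \<bullet> p + \<theta> * (flip (side n M) \<bullet> p)) > 0"
proof -
  let ?m = "side n M" and ?f = "flip (side n M)"
  have fp: "flip p \<in> carrier_vec (n - 1)" and fm: "?f \<in> carrier_vec (n - 1)" using p by simp_all
  have Tfp: "inner_block n M *\<^sub>v flip p = - ?f"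
    using flip_inner[OF p] by (simp add: Tp flip_uminus)
  have ff: "?f \<bullet> flip p = ?m \<bullet> p" "?m \<bullet> flip p = ?f \<bullet> p"
    using flip_scalar[OF side_carrier fp] flip_scalar[OF side_carrier p] by simp_all
  have dims: "dim_vec ?m = n - 1" "dim_vec ?f = n - 1" "dim_vec p = n - 1" using p by (simp_all add: side_def)
  \<comment> \<open>For end values 1, 1 the inner values p + flip p annihilate the inner block row,
    so only the two end rows contribute: this is the even Schur complement. With end values 1, -1
    and p - flip p the same happens for the odd one.\<close>
  have "elem_form n M 1 (p + flip p) 1 1 (p + flip p) 1
      = 2 * ((corner0 M + cornern n M) + (?m \<bullet> p + ?f \<bullet> p))"
    unfolding elem_form_def mult_add_distrib_mat_vec[OF inner_carrier p fp] Tp Tfp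
    using p fp fm side_carrier
    by (simp add: scalar_prod_add_distrib[of _ "n - 1"] add_scalar_prod_distrib[of _ "n - 1"] ff dims)
  with nonneg[of "p + flip p"] p fp
  have plus: "(corner0 M + cornern n M) + (?m \<bullet> p + ?f \<bullet> p) \<ge> 0" by simp
  have "elem_form n M 1 (p - flip p) (-1) 1 (p - flip p) (-1)
      = 2 * ((corner0 M - cornern n M) + (?m \<bullet> p - ?f \<bullet> p))"
    unfolding elem_form_def mult_minus_distrib_mat_vec[OF inner_carrier p fp] Tp Tfp
    using p fp fm side_carrier
    by (simp add: scalar_prod_minus_distrib[of _ "n - 1"] minus_scalar_prod_distrib[of _ "n - 1"] ff dims)
  with pos[of "p - flip p"] p fp
  have minus: "(corner0 M - cornern n M) + (?m \<bullet> p - ?f \<bullet> p) > 0" by simp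
  \<comment> \<open>The strict inequality has to come from the odd part: for the stiffness matrix
    the even part is the energy of a constant, which is zero.\<close>
  have "0 < ((1 + \<theta>) * ((corner0 M + cornern n M) + (?m \<bullet> p + ?f \<bullet> p))
      + (1 - \<theta>) * ((corner0 M - cornern n M) + (?m \<bullet> p - ?f \<bullet> p)))"
    using \<theta> by (intro add_nonneg_pos mult_nonneg_nonneg[OF _ plus] mult_pos_pos[OF _ minus]) auto
  also have "\<dots> = 2 * (corner0 M + \<theta> * cornern n M + (?m \<bullet> p + \<theta> * (?f \<bullet> p)))"
    by (simp add: algebra_simps)
  finally show ?thesis by simp
qed

end

locale fem =
  fixes n :: nat
  assumes n2: "n \<ge> 2"

sublocale fem \<subseteq> A: centrosym n "stiff n"
  by (rule centrosym_stiff[OF n2])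

sublocale fem \<subseteq> C: centrosym n "mass n"
  by (rule centrosym_mass[OF n2])

context fem
begin

lemma n1: "n \<ge> 1" using n2 by simp

lemma mass_form_pos:
  assumes "p \<in> carrier_vec (n - 1)" "x \<noteq> 0 \<or> y \<noteq> 0 \<or> p \<noteq> 0\<^sub>v (n - 1)"
  shows "elem_form n (mass n) x p y x p y > 0"
proof -
  have "interp n (glue n x p y) \<noteq> 0"
  proof
    assume "interp n (glue n x p y) = 0"
    then have U: "glue n x p y k = 0" if "k \<le> n" for k using interp_eq_0[OF n1] that by blast
    have "x = 0" "y = 0" using U[of 0] U[of n] n1 by simp_all
    moreover have "p $ i = 0" if "i < n - 1" for i using U[of "Suc i"] that by simp
    then have "p = 0\<^sub>v (n - 1)" using assms(1) by (intro eq_vecI) auto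
    ultimately show False using assms(2) by blast
  qed
  then show ?thesis
    unfolding C.mform_glue[OF assms(1) assms(1), symmetric] mform_mass by (rule Ip_square_pos)
qed

lemma stiff_form_nonneg:
  assumes "p \<in> carrier_vec (n - 1)"
  shows "elem_form n (stiff n) x p y x p y \<ge> 0"
  unfolding A.mform_glue[OF assms assms, symmetric] mform_stiff by (rule Ip_square_nonneg)

text \<open>The energy vanishes only for constant polynomials; different end values, or a zero end
  value with non-zero interior, rule these out.\<close>

lemma stiff_form_pos:
  assumes p: "p \<in> carrier_vec (n - 1)" and ne: "x \<noteq> y \<or> x = 0 \<and> p \<noteq> 0\<^sub>v (n - 1)"
  shows "elem_form n (stiff n) x p y x p y > 0"
proof -
  let ?f = "interp n (glue n x p y)"
  have "pderiv ?f \<noteq> 0"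
  proof
    assume "pderiv ?f = 0"
    then obtain c where "?f = [:c:]" using pderiv_iszero by blast
    then have U: "glue n x p y k = c" if "k \<le> n" for k using poly_interp[OF n1 that, of "glue n x p y"] by simp
    have "x = c" "y = c" using U[of 0] U[of n] n1 by simp_all
    moreover have "p $ i = c" if "i < n - 1" for i using U[of "Suc i"] that by simp
    then have "x = 0 \<Longrightarrow> p = 0\<^sub>v (n - 1)" using p \<open>x = c\<close> by (intro eq_vecI) auto
    ultimately show False using ne by blast
  qed
  then show ?thesis
    unfolding A.mform_glue[OF p p, symmetric] mform_stiff by (rule Ip_square_pos)
qed

lemma mform_cong:
  "(\<And>k. k \<le> n \<Longrightarrow> V k = V' k) \<Longrightarrow> mform n M U V = mform n M U V'"
  unfolding mform_def by (intro sum.cong refl) simp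

text \<open>The hypothesis says that \<open>p\<close>, extended by zero end values, satisfies all n
  + 1 rows of the full pencil. Every polynomial of degree at most n is then an admissible test
  function, in particular the one needed for \<open>pohozaev\<close>.\<close>

lemma no_full_eigenvector:
  assumes p: "p \<in> carrier_vec (n - 1)" "p \<noteq> 0\<^sub>v (n - 1)" and \<nu>: "\<nu> > 0"
    and eig: "\<And>x q y. q \<in> carrier_vec (n - 1) \<Longrightarrow>
      elem_form n (stiff n) 0 p 0 x q y = \<nu> * elem_form n (mass n) 0 p 0 x q y"
  shows False
proof -
  let ?U = "glue n 0 p 0"
  define f where "f = interp n ?U"
  define v where "v = pCons 0 (pderiv f)"
  have "degree f \<le> n" unfolding f_def by (rule degree_interp[OF n1])
  \<comment> \<open>The factor x only restores the degree lost by differentiation, so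
    \<open>v\<close> is recovered from its nodal values.\<close>
  then have "degree v \<le> n"
    using n1 pderiv_eq_0_iff[of f] unfolding v_def by (auto simp: degree_pCons_eq_if degree_pderiv)
  define V where "V = (\<lambda>k. poly v (fem_node n k))"
  have iV: "interp n V = v" unfolding V_def by (rule interp_nodes[OF n1 \<open>degree v \<le> n\<close>])
  let ?q = "vec (n - 1) (\<lambda>i. V (Suc i))"
  have V: "V k = glue n (V 0) ?q (V n) k" if "k \<le> n" for k
    using that by (auto simp: glue_def)
  have "mform n M ?U V = mform n M ?U (glue n (V 0) ?q (V n))" for M
    by (rule mform_cong[OF V])
  then have "mform n (stiff n) ?U V = \<nu> * mform n (mass n) ?U V"
    using eig[of ?q "V 0" "V n"] A.mform_glue[OF p(1), of ?q] C.mform_glue[OF p(1), of ?q] by simp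
  then have "Ip (pderiv f * pderiv v) = \<nu> * Ip (f * v)"
    unfolding mform_stiff mform_mass iV f_def[symmetric] .
  moreover have "f \<noteq> 0"
    using mass_form_pos[OF p(1), of 0 0] p(2)
    unfolding C.mform_glue[OF p(1) p(1), symmetric] mform_mass f_def[symmetric] by auto
  moreover have "poly f 1 = 0" "poly f (-1) = 0"
    using poly_interp[OF n1, of n ?U] poly_interp[OF n1, of 0 ?U] n1 by (simp_all add: f_def)
  ultimately show False using pohozaev[of f \<nu>] \<nu> unfolding v_def by blast
qed

abbreviation "St \<equiv> inner_block n (stiff n)"
abbreviation "Ct \<equiv> inner_block n (mass n)"
abbreviation "sa \<equiv> side n (stiff n)"
abbreviation "sc \<equiv> side n (mass n)"

lemma Ct_pos:
  assumes "p \<in> carrier_vec (n - 1)" "p \<noteq> 0\<^sub>v (n - 1)"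
  shows "(Ct *\<^sub>v p) \<bullet> p > 0"
  using mass_form_pos[of p 0 0] assms by (simp add: elem_form_def)

lemma St_pos:
  assumes "p \<in> carrier_vec (n - 1)" "p \<noteq> 0\<^sub>v (n - 1)"
  shows "(St *\<^sub>v p) \<bullet> p > 0"
  using stiff_form_pos[of p 0 0] assms by (simp add: elem_form_def)

lemma S_tilde_pos:
  assumes "\<nu> \<in> S_tilde n"
  shows "\<nu> > 0"
proof -
  obtain p where p: "p \<in> carrier_vec (n - 1)" "p \<noteq> 0\<^sub>v (n - 1)" "St *\<^sub>v p = \<nu> \<cdot>\<^sub>v (Ct *\<^sub>v p)"
    using assms by (auto simp: S_tilde_def pencil_spectrum_def)
  have "(St *\<^sub>v p) \<bullet> p = \<nu> * ((Ct *\<^sub>v p) \<bullet> p)"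
    unfolding p(3) using p(1) by simp
  then show ?thesis using Ct_pos[OF p(1,2)] St_pos[OF p(1,2)] by (simp add: zero_less_mult_iff)
qed

lemma card_S_tilde:
  assumes "S_tilde_simple n"
  shows "finite (S_tilde n)" "card (S_tilde n) = n - 1"
  using card_pencil_spectrum[OF A.inner_carrier C.inner_carrier A.inner_symm C.inner_symm Ct_pos] assms
  by (simp_all add: S_tilde_def S_tilde_simple_def)

text \<open>Simplicity yields n - 1 different eigenvalues, which can therefore be enumerated by
  {1..n-1}; rescaling by the positive mass norm normalises the eigenvectors.\<close>

lemma ex_local_eigenpairs:
  assumes "S_tilde_simple n"
  shows "\<exists>lam0 e. local_eigenpairs n lam0 e"
proof -
  obtain lam0 where b: "bij_betw lam0 {1..n-1} (S_tilde n)"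
    using card_S_tilde[OF assms] by (metis card_atLeastAtMost diff_Suc_1 finite_atLeastAtMost finite_same_card_bij)
  have "\<exists>q. q \<in> carrier_vec (n - 1) \<and> St *\<^sub>v q = lam0 l \<cdot>\<^sub>v (Ct *\<^sub>v q) \<and> (Ct *\<^sub>v q) \<bullet> q = 1"
    if "l \<in> {1..n-1}" for l
  proof -
    have "lam0 l \<in> S_tilde n" using b that by (auto simp: bij_betw_def)
    then obtain p where p: "p \<in> carrier_vec (n - 1)" "p \<noteq> 0\<^sub>v (n - 1)" "St *\<^sub>v p = lam0 l \<cdot>\<^sub>v (Ct *\<^sub>v p)"
      by (auto simp: S_tilde_def pencil_spectrum_def)
    define r where "r = 1 / sqrt ((Ct *\<^sub>v p) \<bullet> p)"
    have r: "r * r * ((Ct *\<^sub>v p) \<bullet> p) = 1" using Ct_pos[OF p(1,2)] by (simp add: r_def)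
    have "St *\<^sub>v (r \<cdot>\<^sub>v p) = lam0 l \<cdot>\<^sub>v (Ct *\<^sub>v (r \<cdot>\<^sub>v p))"
      using mult_mat_vec[OF A.inner_carrier p(1), of r] mult_mat_vec[OF C.inner_carrier p(1), of r]
      by (simp add: p(3) smult_smult_assoc mult.commute)
    moreover have "(Ct *\<^sub>v (r \<cdot>\<^sub>v p)) \<bullet> (r \<cdot>\<^sub>v p) = 1"
      using mult_mat_vec[OF C.inner_carrier p(1), of r] p(1) r by (simp add: mult.assoc)
    ultimately show ?thesis using p(1) by (intro exI[of _ "r \<cdot>\<^sub>v p"]) simp
  qed
  then obtain e where "\<forall>l\<in>{1..n-1}. e l \<in> carrier_vec (n - 1) \<and> St *\<^sub>v e l = lam0 l \<cdot>\<^sub>v (Ct *\<^sub>v e l)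
      \<and> (Ct *\<^sub>v e l) \<bullet> e l = 1" by metis
  then show ?thesis using b unfolding local_eigenpairs_def by blast
qed

lemma eigenvectors_orthogonal:
  assumes "p \<in> carrier_vec (n - 1)" "St *\<^sub>v p = \<mu> \<cdot>\<^sub>v (Ct *\<^sub>v p)"
    and "q \<in> carrier_vec (n - 1)" "St *\<^sub>v q = \<nu> \<cdot>\<^sub>v (Ct *\<^sub>v q)" and "\<mu> \<noteq> \<nu>"
  shows "(Ct *\<^sub>v p) \<bullet> q = 0"
proof -
  have "\<mu> * ((Ct *\<^sub>v p) \<bullet> q) = (St *\<^sub>v p) \<bullet> q" unfolding assms(2) using assms(3) by simp
  also have "\<dots> = p \<bullet> (St *\<^sub>v q)" by (rule A.inner_symm[OF assms(1,3)])
  also have "\<dots> = \<nu> * (p \<bullet> (Ct *\<^sub>v q))" unfolding assms(4) using assms(1) by simp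
  also have "p \<bullet> (Ct *\<^sub>v q) = (Ct *\<^sub>v p) \<bullet> q" by (rule C.inner_symm[OF assms(1,3), symmetric])
  finally show ?thesis using assms(5) by simp
qed

end

text \<open>From here on, simplicity of the inner spectrum is present as the bijectivity of
  \<open>lam0\<close> contained in \<open>local_eigenpairs\<close>.\<close>

locale fem_eig = fem +
  fixes lam0 :: "nat \<Rightarrow> real" and e :: "nat \<Rightarrow> real vec"
  assumes pairs: "local_eigenpairs n lam0 e"
begin

abbreviation "I \<equiv> {1..n-1}"

lemma lam0_bij: "bij_betw lam0 I (S_tilde n)"
  and e_carrier [simp]: "l \<in> I \<Longrightarrow> e l \<in> carrier_vec (n - 1)"
  and e_eig: "l \<in> I \<Longrightarrow> St *\<^sub>v e l = lam0 l \<cdot>\<^sub>v (Ct *\<^sub>v e l)"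
  and e_norm: "l \<in> I \<Longrightarrow> (Ct *\<^sub>v e l) \<bullet> e l = 1"
  using pairs by (auto simp: local_eigenpairs_def)

lemma lam0_inj: "inj_on lam0 I" and lam0_image: "lam0 ` I = S_tilde n"
  using lam0_bij by (auto simp: bij_betw_def)

lemma lam0_in: "l \<in> I \<Longrightarrow> lam0 l \<in> S_tilde n"
  using bij_betwE[OF lam0_bij] by blast

lemma lam0_pos: "l \<in> I \<Longrightarrow> lam0 l > 0"
  by (rule S_tilde_pos[OF lam0_in])

lemma e_orth: "l \<in> I \<Longrightarrow> m \<in> I \<Longrightarrow> (Ct *\<^sub>v e l) \<bullet> e m = (if l = m then 1 else 0)"
  using eigenvectors_orthogonal[of "e l" "lam0 l" "e m" "lam0 m"] lam0_inj
  by (auto simp: e_norm e_eig inj_on_eq_iff)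

definition comb :: "(nat \<Rightarrow> real) \<Rightarrow> real vec" where
  "comb \<beta> = vec (n - 1) (\<lambda>i. \<Sum>l\<in>I. \<beta> l * e l $ i)"

lemma comb_carrier [simp]: "comb \<beta> \<in> carrier_vec (n - 1)"
  by (simp add: comb_def)

lemma scalar_comb:
  assumes "q \<in> carrier_vec (n - 1)"
  shows "q \<bullet> comb \<beta> = (\<Sum>l\<in>I. \<beta> l * (q \<bullet> e l))"
proof -
  have "q \<bullet> comb \<beta> = (\<Sum>i\<in>{0..<n-1}. \<Sum>l\<in>I. \<beta> l * (q $ i * e l $ i))"
    by (simp add: scalar_prod_def comb_def sum_distrib_left mult_ac)
  also have "\<dots> = (\<Sum>l\<in>I. \<Sum>i\<in>{0..<n-1}. \<beta> l * (q $ i * e l $ i))" by (rule sum.swap)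
  also have "\<dots> = (\<Sum>l\<in>I. \<beta> l * (q \<bullet> e l))"
  proof (intro sum.cong refl)
    fix l assume "l \<in> I"
    then have "dim_vec (e l) = n - 1" by (rule carrier_vecD[OF e_carrier])
    then show "(\<Sum>i\<in>{0..<n-1}. \<beta> l * (q $ i * e l $ i)) = \<beta> l * (q \<bullet> e l)"
      by (simp add: scalar_prod_def sum_distrib_left)
  qed
  finally show ?thesis .
qed

text \<open>Orthonormality in the inner mass product gives independence, and the number of
  eigenvectors equals the number of entries.\<close>

lemma ex_comb:
  assumes "q \<in> carrier_vec (n - 1)"
  shows "\<exists>\<beta>. q = comb \<beta>"
proof -
  have "\<exists>c. \<forall>j\<in>{0..<n-1}. q $ j = (\<Sum>i\<in>I. c i * e i $ j)"
  proof (rule injective_system_surj)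
    fix c m assume 0: "\<And>j. j \<in> {0..<n-1} \<Longrightarrow> (\<Sum>i\<in>I. c i * e i $ j) = 0" and m: "m \<in> I"
    have "comb c = 0\<^sub>v (n - 1)" using 0 by (intro eq_vecI) (auto simp: comb_def)
    then have "0 = (Ct *\<^sub>v e m) \<bullet> comb c" by simp
    also have "\<dots> = (\<Sum>l\<in>I. if m = l then c l else 0)"
      unfolding scalar_comb[OF C.inner_mult_carrier] using m by (intro sum.cong refl) (auto simp: e_orth)
    also have "\<dots> = c m" using m by simp
    finally show "c m = 0" by simp
  qed auto
  then obtain \<beta> where "\<forall>j\<in>{0..<n-1}. q $ j = (\<Sum>i\<in>I. \<beta> i * e i $ j)" by blast
  then have "q = comb \<beta>" using assms by (intro eq_vecI) (auto simp: comb_def)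
  then show ?thesis by blast
qed

lemma e_complete:
  assumes "q \<in> carrier_vec (n - 1)" "\<And>l. l \<in> I \<Longrightarrow> q \<bullet> e l = 0"
  shows "q = 0\<^sub>v (n - 1)"
proof (rule ccontr)
  assume "q \<noteq> 0\<^sub>v (n - 1)"
  then have "q \<bullet> q > 0" by (rule vec_self_prod_pos[OF assms(1)])
  moreover obtain \<beta> where "q = comb \<beta>" using ex_comb[OF assms(1)] by blast
  then have "q \<bullet> q = 0" using scalar_comb[OF assms(1), of \<beta>] assms(2) by simp
  ultimately show False by simp
qed

lemma
  assumes "m \<in> I"
  shows Ct_comb: "(Ct *\<^sub>v comb \<beta>) \<bullet> e m = \<beta> m"
    and St_comb: "(St *\<^sub>v comb \<beta>) \<bullet> e m = lam0 m * \<beta> m"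
proof -
  note em = e_carrier[OF assms]
  have "(Ct *\<^sub>v comb \<beta>) \<bullet> e m = (Ct *\<^sub>v e m) \<bullet> comb \<beta>"
    using C.inner_symm[OF comb_carrier em] comm_scalar_prod[OF comb_carrier C.inner_mult_carrier] by simp
  also have "\<dots> = (\<Sum>l\<in>I. if m = l then \<beta> l else 0)"
    unfolding scalar_comb[OF C.inner_mult_carrier] using assms by (intro sum.cong refl) (auto simp: e_orth)
  finally show c: "(Ct *\<^sub>v comb \<beta>) \<bullet> e m = \<beta> m" using assms by simp
  have "(St *\<^sub>v comb \<beta>) \<bullet> e m = comb \<beta> \<bullet> (St *\<^sub>v e m)" by (rule A.inner_symm[OF comb_carrier em])
  also have "\<dots> = lam0 m * (comb \<beta> \<bullet> (Ct *\<^sub>v e m))" unfolding e_eig[OF assms] by simp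
  also have "\<dots> = lam0 m * ((Ct *\<^sub>v comb \<beta>) \<bullet> e m)" using C.inner_symm[OF comb_carrier em] by simp
  finally show "(St *\<^sub>v comb \<beta>) \<bullet> e m = lam0 m * \<beta> m" unfolding c .
qed

text \<open>In the eigenbasis \<open>Gtilde n \<nu>\<close> is diagonal with entries lam0 l - nu.
  Dividing by them produces precisely the fractions of the secular equation, which is how the
  elimination of the inner unknowns leads to it.\<close>

lemma inner_system_solution:
  assumes q: "q \<in> carrier_vec (n - 1)" and "\<nu> \<notin> S_tilde n"
  shows "Gtilde n \<nu> *\<^sub>v comb (\<lambda>l. (q \<bullet> e l) / (\<nu> - lam0 l)) = - q"
proof -
  let ?\<beta> = "\<lambda>l. (q \<bullet> e l) / (\<nu> - lam0 l)"
  have G: "Gtilde n \<nu> *\<^sub>v comb ?\<beta> = St *\<^sub>v comb ?\<beta> - \<nu> \<cdot>\<^sub>v (Ct *\<^sub>v comb ?\<beta>)"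
    unfolding Gtilde_def by (rule minus_smult_mat_mult_vec[of _ "n - 1"]) auto
  have c: "Gtilde n \<nu> *\<^sub>v comb ?\<beta> \<in> carrier_vec (n - 1)" unfolding G by simp
  have "Gtilde n \<nu> *\<^sub>v comb ?\<beta> - (- q) = 0\<^sub>v (n - 1)"
  proof (rule e_complete)
    fix m assume m: "m \<in> I"
    then have "\<nu> \<noteq> lam0 m" using assms(2) lam0_image by auto
    have "(Gtilde n \<nu> *\<^sub>v comb ?\<beta>) \<bullet> e m = lam0 m * ?\<beta> m - \<nu> * ?\<beta> m"
      unfolding G
      using minus_scalar_prod_distrib[OF A.inner_mult_carrier smult_carrier_vec[THEN iffD2, OF C.inner_mult_carrier]
          e_carrier[OF m], of "comb ?\<beta>" \<nu> "comb ?\<beta>"]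
        smult_scalar_prod_distrib[OF C.inner_mult_carrier e_carrier[OF m], of \<nu> "comb ?\<beta>"]
      by (simp only: St_comb[OF m] Ct_comb[OF m])
    also have "\<dots> = - ((\<nu> - lam0 m) * ?\<beta> m)"
      by (simp only: left_diff_distrib minus_diff_eq)
    also have "\<dots> = - (q \<bullet> e m)"
      using \<open>\<nu> \<noteq> lam0 m\<close> by simp
    finally have 1: "(Gtilde n \<nu> *\<^sub>v comb ?\<beta>) \<bullet> e m = - (q \<bullet> e m)" .
    have "dim_vec q = dim_vec (e m)" using q e_carrier[OF m] by simp
    then have "- q \<bullet> e m = - (q \<bullet> e m)" by simp
    then show "(Gtilde n \<nu> *\<^sub>v comb ?\<beta> - (- q)) \<bullet> e m = 0"
      using minus_scalar_prod_distrib[OF c _ e_carrier[OF m], of "- q"] q 1 by simp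
  qed (use c q in auto)
  then show ?thesis using minus_vec_eq_0_iff[OF c, of "- q"] q by simp
qed

text \<open>The counterpart of \<open>inner_system_solution\<close> for the mass block alone, which
  governs the leading coefficient of the secular polynomial.\<close>

lemma Ct_solution:
  assumes q: "q \<in> carrier_vec (n - 1)"
  shows "Ct *\<^sub>v comb (\<lambda>l. - (q \<bullet> e l)) = - q"
proof -
  let ?\<beta> = "\<lambda>l. - (q \<bullet> e l)"
  have "Ct *\<^sub>v comb ?\<beta> - (- q) = 0\<^sub>v (n - 1)"
  proof (rule e_complete)
    fix m assume m: "m \<in> I"
    have "dim_vec q = dim_vec (e m)" using q e_carrier[OF m] by simp
    then have "- q \<bullet> e m = - (q \<bullet> e m)" by simp
    then show "(Ct *\<^sub>v comb ?\<beta> - (- q)) \<bullet> e m = 0"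
      using minus_scalar_prod_distrib[OF C.inner_mult_carrier _ e_carrier[OF m], of "- q"] q Ct_comb[OF m] by simp
  qed (use q in auto)
  then show ?thesis using minus_vec_eq_0_iff[OF C.inner_mult_carrier, of "- q"] q by simp
qed

text \<open>The parity sign, 1 for even and -1 for odd \<open>e l\<close>, written as the component
  of \<open>flip (e l)\<close> along \<open>e l\<close> so that no case distinction is
  needed.\<close>

definition \<sigma> :: "nat \<Rightarrow> real" where
  "\<sigma> l = (Ct *\<^sub>v flip (e l)) \<bullet> e l"

text \<open>Reversal commutes with both blocks, so \<open>flip (e l)\<close> is an eigenvector for
  the same eigenvalue and thus orthogonal to all \<open>e m\<close> with m different from l. It is a
  multiple of \<open>e l\<close>, and reversing twice forces the factor to square to 1.\<close>

lemma flip_e: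
  assumes l: "l \<in> I"
  shows "flip (e l) = \<sigma> l \<cdot>\<^sub>v e l" and "\<sigma> l = 1 \<or> \<sigma> l = -1"
proof -
  note el = e_carrier[OF l]
  have fe: "flip (e l) \<in> carrier_vec (n - 1)" using el by simp
  have feig: "St *\<^sub>v flip (e l) = lam0 l \<cdot>\<^sub>v (Ct *\<^sub>v flip (e l))"
    unfolding A.flip_inner[OF el, symmetric] C.flip_inner[OF el, symmetric] e_eig[OF l] flip_smult ..
  obtain \<beta> where \<beta>: "flip (e l) = comb \<beta>" using ex_comb[OF fe] by blast
  have "\<beta> m = 0" if m: "m \<in> I" "m \<noteq> l" for m
  proof -
    have "lam0 l \<noteq> lam0 m" using lam0_inj l m by (auto simp: inj_on_eq_iff)
    then have "(Ct *\<^sub>v flip (e l)) \<bullet> e m = 0"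
      using eigenvectors_orthogonal[OF fe feig e_carrier[OF m(1)] e_eig[OF m(1)]] by simp
    then show ?thesis using Ct_comb[OF m(1), of \<beta>] \<beta> by simp
  qed
  moreover have "\<beta> l = \<sigma> l" unfolding \<sigma>_def \<beta> by (rule Ct_comb[OF l, symmetric])
  ultimately have "(\<Sum>m\<in>I. \<beta> m * e m $ i) = \<sigma> l * e l $ i" for i
    using l by (subst sum.remove[of _ l]) (auto intro!: sum.neutral)
  then show f: "flip (e l) = \<sigma> l \<cdot>\<^sub>v e l"
    unfolding \<beta> comb_def using el by (intro eq_vecI) auto
  have "e l = flip (\<sigma> l \<cdot>\<^sub>v e l)" unfolding f[symmetric] by simp
  then have "e l = (\<sigma> l * \<sigma> l) \<cdot>\<^sub>v e l" unfolding flip_smult f by (simp add: smult_smult_assoc)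
  then have "(Ct *\<^sub>v e l) \<bullet> e l = (\<sigma> l * \<sigma> l) * ((Ct *\<^sub>v e l) \<bullet> e l)"
    using el by (metis C.inner_mult_carrier scalar_prod_smult_distrib)
  then have "\<sigma> l * \<sigma> l = 1" unfolding e_norm[OF l] by simp
  then show "\<sigma> l = 1 \<or> \<sigma> l = -1" by (simp add: square_eq_1_iff)
qed

lemma flip_scalar_e:
  assumes "l \<in> I" "q \<in> carrier_vec (n - 1)"
  shows "flip q \<bullet> e l = \<sigma> l * (q \<bullet> e l)"
  using flip_scalar[OF assms(2) e_carrier[OF assms(1)]] flip_e(1)[OF assms(1)] assms by simp

text \<open>If the product with the first end row vanished, parity would make that with the last end
  row vanish as well, and \<open>e l\<close> extended by zero would solve the full pencil.\<close>

lemma gvec_e_nonzero: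
  assumes l: "l \<in> I"
  shows "sa \<bullet> e l - lam0 l * (sc \<bullet> e l) \<noteq> 0"
proof
  assume 0: "sa \<bullet> e l - lam0 l * (sc \<bullet> e l) = 0"
  note el = e_carrier[OF l]
  have "e l \<noteq> 0\<^sub>v (n - 1)" using e_norm[OF l] by auto
  then show False
  proof (rule no_full_eigenvector[OF el _ lam0_pos[OF l]])
    fix x and q :: "real vec" and y :: real assume q: "q \<in> carrier_vec (n - 1)"
    have "(St *\<^sub>v e l) \<bullet> q = lam0 l * ((Ct *\<^sub>v e l) \<bullet> q)" unfolding e_eig[OF l] using q by simp
    then show "elem_form n (stiff n) 0 (e l) 0 x q y = lam0 l * elem_form n (mass n) 0 (e l) 0 x q y"
      using 0 by (simp add: elem_form_def flip_scalar_e[OF l] algebra_simps)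
  qed
qed

end

subsection \<open>The secular equation\<close>

text \<open>The secular function multiplied by all z - mu_l. Being a polynomial, it has values at
  the poles and a degree; the generic field allows the same expression over the reals and over the
  complex numbers.\<close>

definition secular ::
  "'i set \<Rightarrow> ('i \<Rightarrow> 'a) \<Rightarrow> 'a \<Rightarrow> 'a \<Rightarrow> ('i \<Rightarrow> 'a) \<Rightarrow> ('i \<Rightarrow> 'a) \<Rightarrow> ('i \<Rightarrow> 'a) \<Rightarrow> 'a :: field poly" where
  "secular J \<mu> a0 c0 \<kappa> a c =
     [:a0, - c0:] * (\<Prod>l\<in>J. [:- \<mu> l, 1:])
     + (\<Sum>l\<in>J. Polynomial.smult (\<kappa> l) ([:a l, - c l:] ^ 2 * (\<Prod>m\<in>J-{l}. [:- \<mu> m, 1:])))"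

lemma poly_secular:
  assumes "finite J" "\<And>l. l \<in> J \<Longrightarrow> z \<noteq> \<mu> l"
  shows "poly (secular J \<mu> a0 c0 \<kappa> a c) z =
    (\<Prod>l\<in>J. z - \<mu> l) * (a0 - z * c0 + (\<Sum>l\<in>J. \<kappa> l * (a l - z * c l)^2 / (z - \<mu> l)))"
proof -
  have 1: "(\<Prod>m\<in>J-{l}. z - \<mu> m) = (\<Prod>m\<in>J. z - \<mu> m) / (z - \<mu> l)" if "l \<in> J" for l
    using assms that by (simp add: prod.remove)
  have "poly (secular J \<mu> a0 c0 \<kappa> a c) z = (a0 - z * c0) * (\<Prod>l\<in>J. z - \<mu> l)
      + (\<Sum>l\<in>J. \<kappa> l * ((a l - z * c l)^2 * (\<Prod>m\<in>J-{l}. z - \<mu> m)))"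
    by (simp add: secular_def poly_sum poly_prod left_diff_distrib)
  also have "(\<Sum>l\<in>J. \<kappa> l * ((a l - z * c l)^2 * (\<Prod>m\<in>J-{l}. z - \<mu> m)))
      = (\<Sum>l\<in>J. (\<Prod>m\<in>J. z - \<mu> m) * (\<kappa> l * (a l - z * c l)^2 / (z - \<mu> l)))"
    by (intro sum.cong refl) (simp add: 1)
  finally show ?thesis
    unfolding sum_distrib_left[symmetric] by (simp only: distrib_left mult.commute)
qed

text \<open>Only the summand in which the factor z - mu_j has been cancelled survives.\<close>

lemma poly_secular_at_pole:
  assumes "finite J" "j \<in> J"
  shows "poly (secular J \<mu> a0 c0 \<kappa> a c) (\<mu> j)
    = \<kappa> j * (a j - \<mu> j * c j)^2 * (\<Prod>m\<in>J-{j}. \<mu> j - \<mu> m)"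
proof -
  have "(\<Prod>m\<in>J-{l}. \<mu> j - \<mu> m) = 0" if "l \<in> J" "l \<noteq> j" for l
    using assms that by (intro prod_zero) auto
  moreover have "(\<Prod>m\<in>J. \<mu> j - \<mu> m) = 0"
    using assms by (intro prod_zero) auto
  ultimately have "poly (secular J \<mu> a0 c0 \<kappa> a c) (\<mu> j)
      = (\<Sum>l\<in>J. if l = j then \<kappa> l * ((a l - \<mu> j * c l)^2 * (\<Prod>m\<in>J-{l}. \<mu> j - \<mu> m)) else 0)"
    by (auto simp: secular_def poly_sum poly_prod intro!: sum.cong)
  then show ?thesis using assms by (simp add: mult.assoc)
qed

text \<open>A leading coefficient rule for mere degree bounds, as the linear factors below may have
  zero slope.\<close>

lemma coeff_mult_le:
  assumes "degree p \<le> a" "degree q \<le> b"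
  shows "coeff (p * q) (a + b) = coeff p a * coeff q b"
proof (cases "degree p = a \<and> degree q = b")
  case True
  then show ?thesis using coeff_mult_degree_sum[of p q] by auto
next
  case False
  then have "degree p < a \<or> degree q < b" using assms by auto
  moreover from this have "degree (p * q) < a + b"
    using assms degree_mult_le[of p q] by linarith
  ultimately show ?thesis by (auto simp: coeff_eq_0)
qed

lemma
  fixes \<mu> :: "'i \<Rightarrow> 'a :: field"
  assumes "finite J"
  shows degree_prod_linear: "degree (\<Prod>l\<in>J. [:- \<mu> l, 1:]) = card J"
    and coeff_prod_linear: "coeff (\<Prod>l\<in>J. [:- \<mu> l, 1:]) (card J) = 1"
proof -
  show d: "degree (\<Prod>l\<in>J. [:- \<mu> l, 1:]) = card J"
    by (subst degree_prod_eq_sum_degree) auto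
  have "lead_coeff (\<Prod>l\<in>J. [:- \<mu> l, 1:]) = 1" by (simp add: lead_coeff_prod)
  then show "coeff (\<Prod>l\<in>J. [:- \<mu> l, 1:]) (card J) = 1" unfolding d .
qed

lemma
  assumes "finite J"
  shows degree_secular: "degree (secular J \<mu> a0 c0 \<kappa> a c) \<le> card J + 1"
    and coeff_secular: "coeff (secular J \<mu> a0 c0 \<kappa> a c) (card J + 1) = - c0 + (\<Sum>l\<in>J. \<kappa> l * c l ^ 2)"
proof -
  note dp = degree_prod_linear[of _ \<mu>] and cp = coeff_prod_linear[of _ \<mu>]
  have d1: "degree ([:a0, - c0:] * (\<Prod>l\<in>J. [:- \<mu> l, 1:])) \<le> card J + 1"
    using degree_mult_le[of "[:a0, - c0:]" "\<Prod>l\<in>J. [:- \<mu> l, 1:]"] dp[OF assms] by (simp split: if_splits)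
  have c1: "coeff ([:a0, - c0:] * (\<Prod>l\<in>J. [:- \<mu> l, 1:])) (card J + 1) = - c0"
    using coeff_mult_le[of "[:a0, - c0:]" 1 "\<Prod>l\<in>J. [:- \<mu> l, 1:]" "card J"] dp[OF assms] cp[OF assms]
    by (simp add: add.commute One_nat_def)
  have sq: "degree ([:a l, - c l:] ^ 2) \<le> 2" "coeff ([:a l, - c l:] ^ 2) 2 = c l ^ 2" for l
    using degree_power_le[of "[:a l, - c l:]" 2] coeff_mult_le[of "[:a l, - c l:]" 1 "[:a l, - c l:]" 1]
    by (auto simp: power2_eq_square One_nat_def numeral_2_eq_2 split: if_splits)
  have cJ: "card J + 1 = 2 + card (J - {l})" if "l \<in> J" for l
    using assms that card_Suc_Diff1[of J l] by simp
  have d2: "degree ([:a l, - c l:] ^ 2 * (\<Prod>m\<in>J-{l}. [:- \<mu> m, 1:])) \<le> card J + 1" if "l \<in> J" for l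
    using degree_mult_le[of "[:a l, - c l:] ^ 2" "\<Prod>m\<in>J-{l}. [:- \<mu> m, 1:]"] dp[of "J - {l}"] sq(1)[of l]
      cJ[OF that] assms by simp
  have c2: "coeff ([:a l, - c l:] ^ 2 * (\<Prod>m\<in>J-{l}. [:- \<mu> m, 1:])) (card J + 1) = c l ^ 2" if "l \<in> J" for l
  proof -
    have "coeff ([:a l, - c l:] ^ 2 * (\<Prod>m\<in>J-{l}. [:- \<mu> m, 1:])) (2 + card (J - {l}))
        = coeff ([:a l, - c l:] ^ 2) 2 * coeff (\<Prod>m\<in>J-{l}. [:- \<mu> m, 1:]) (card (J - {l}))"
      by (rule coeff_mult_le[OF sq(1)]) (use dp[of "J - {l}"] assms in simp)
    then show ?thesis
      unfolding cJ[OF that] using sq(2)[of l] cp[of "J - {l}"] assms by simp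
  qed
  show "degree (secular J \<mu> a0 c0 \<kappa> a c) \<le> card J + 1"
    unfolding secular_def using d1 d2 assms
    by (intro degree_add_le degree_sum_le) (auto intro: order_trans[OF degree_smult_le])
  show "coeff (secular J \<mu> a0 c0 \<kappa> a c) (card J + 1) = - c0 + (\<Sum>l\<in>J. \<kappa> l * c l ^ 2)"
    unfolding secular_def coeff_add coeff_sum coeff_smult c1 using c2 by simp
qed

lemma map_poly_secular:
  "map_poly complex_of_real (secular J \<mu> a0 c0 \<kappa> a c)
   = secular J (\<lambda>l. complex_of_real (\<mu> l)) (complex_of_real a0) (complex_of_real c0)
       (\<lambda>l. complex_of_real (\<kappa> l)) (\<lambda>l. complex_of_real (a l)) (\<lambda>l. complex_of_real (c l))"
proof -
  interpret h: map_poly_inj_idom_hom complex_of_real ..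
  show ?thesis
    unfolding secular_def
    by (simp only: h.hom_add h.hom_mult h.hom_sum h.hom_prod h.hom_power of_real_hom.map_poly_hom_smult
        of_real_hom.map_poly_pCons_hom of_real_minus h.hom_zero of_real_1)
qed

context fem_eig
begin

text \<open>The characteristic equation with all terms on one side and denominators cleared. Parity
  replaces each accented factor by \<open>\<sigma> l\<close> times the plain one, whence the weights
  \<open>1 + \<theta> * \<sigma> l\<close>.\<close>

definition secpoly :: "real \<Rightarrow> real poly" where
  "secpoly \<theta> = secular I lam0 (corner0 (stiff n) + \<theta> * cornern n (stiff n))
     (corner0 (mass n) + \<theta> * cornern n (mass n)) (\<lambda>l. 1 + \<theta> * \<sigma> l) (\<lambda>l. sa \<bullet> e l) (\<lambda>l. sc \<bullet> e l)"

lemma scalar_comb_flip: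
  assumes "q \<in> carrier_vec (n - 1)"
  shows "q \<bullet> comb \<beta> + \<theta> * (flip q \<bullet> comb \<beta>) = (\<Sum>l\<in>I. (1 + \<theta> * \<sigma> l) * (q \<bullet> e l) * \<beta> l)"
proof -
  have "flip q \<in> carrier_vec (n - 1)" using assms by simp
  then show ?thesis
    unfolding scalar_comb[OF assms] scalar_comb[OF \<open>flip q \<in> _\<close>] sum_distrib_left sum.distrib[symmetric]
    using assms by (intro sum.cong refl) (simp add: flip_scalar_e algebra_simps)
qed

lemma zero_notin_S_tilde: "0 \<notin> S_tilde n"
  using S_tilde_pos by fastforce

text \<open>At nu = 0 the fractions are the coordinates of the solution of St p = - sa, so the value
  is the Schur complement treated in \<open>condensed_form_pos\<close>.\<close>

lemma secular_at_0_pos: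
  assumes "\<bar>\<theta>\<bar> < 1"
  shows "corner0 (stiff n) + \<theta> * cornern n (stiff n)
    + (\<Sum>l\<in>I. (1 + \<theta> * \<sigma> l) * (sa \<bullet> e l)^2 / (0 - lam0 l)) > 0"
proof -
  let ?\<beta> = "\<lambda>l. (sa \<bullet> e l) / (0 - lam0 l)"
  have "Gtilde n 0 = St" unfolding Gtilde_def
    by (intro eq_matI) (use carrier_matD[OF A.inner_carrier] carrier_matD[OF C.inner_carrier] in simp_all)
  then have "St *\<^sub>v comb ?\<beta> = - sa"
    using inner_system_solution[OF A.side_carrier zero_notin_S_tilde] by simp
  then have "corner0 (stiff n) + \<theta> * cornern n (stiff n) + (sa \<bullet> comb ?\<beta> + \<theta> * (flip sa \<bullet> comb ?\<beta>)) > 0"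
    by (intro A.condensed_form_pos stiff_form_nonneg stiff_form_pos assms comb_carrier) auto
  then show ?thesis unfolding scalar_comb_flip[OF A.side_carrier] by (simp add: power2_eq_square mult.assoc)
qed

text \<open>The negated leading coefficient is the same Schur complement, formed with the mass
  matrix.\<close>

lemma secular_lead_neg:
  assumes "\<bar>\<theta>\<bar> < 1"
  shows "- (corner0 (mass n) + \<theta> * cornern n (mass n)) + (\<Sum>l\<in>I. (1 + \<theta> * \<sigma> l) * (sc \<bullet> e l)^2) < 0"
proof -
  let ?\<beta> = "\<lambda>l. - (sc \<bullet> e l)"
  have "Ct *\<^sub>v comb ?\<beta> = - sc" by (rule Ct_solution[OF C.side_carrier])
  then have "corner0 (mass n) + \<theta> * cornern n (mass n) + (sc \<bullet> comb ?\<beta> + \<theta> * (flip sc \<bullet> comb ?\<beta>)) > 0"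
    by (intro C.condensed_form_pos less_imp_le[OF mass_form_pos] mass_form_pos assms comb_carrier) auto
  then show ?thesis
    unfolding scalar_comb_flip[OF C.side_carrier] by (simp add: power2_eq_square mult.assoc sum_negf)
qed

lemma prod_S_tilde: "(\<Prod>s\<in>S_tilde n. h s) = (\<Prod>l\<in>I. h (lam0 l))"
  unfolding lam0_image[symmetric] using lam0_inj by (simp add: prod.reindex)

lemma finite_S_tilde: "finite (S_tilde n)" and card_S_tilde_eq: "card (S_tilde n) = n - 1"
  unfolding lam0_image[symmetric] card_image[OF lam0_inj] by simp_all

lemma one_plus_\<sigma>_pos: "\<bar>\<theta>\<bar> < 1 \<Longrightarrow> l \<in> I \<Longrightarrow> 1 + \<theta> * \<sigma> l > 0"
  using flip_e(2)[of l] by auto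

lemma mult_square_pos: "P \<noteq> 0 \<Longrightarrow> F > 0 \<Longrightarrow> P * (P * F) > (0 :: real)"
  by (metis mult.assoc mult_pos_pos not_real_square_gt_zero)

text \<open>At 0 and at each pole, the quantity whose sign is required is the square of a non-zero
  product times a positive factor: the Schur complement in the first case, the weighted squared
  residue term in the second. Strictness at the poles also shows that no root is an inner
  eigenvalue.\<close>

lemma secpoly_roots:
  assumes \<theta>: "\<bar>\<theta>\<bar> < 1"
  shows "{z. poly (map_poly complex_of_real (secpoly \<theta>)) z = 0} = complex_of_real ` {x. x > 0 \<and> poly (secpoly \<theta>) x = 0}"
    and "card {x. x > 0 \<and> poly (secpoly \<theta>) x = 0} = n"
    and "poly (secpoly \<theta>) x = 0 \<Longrightarrow> x \<notin> S_tilde n"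
proof -
  have c: "card (S_tilde n) + 1 = n" "card I = card (S_tilde n)" using card_S_tilde_eq n2 by simp_all
  have deg: "degree (secpoly \<theta>) \<le> card (S_tilde n) + 1"
    unfolding secpoly_def c(2)[symmetric] by (rule degree_secular) simp
  have lead: "coeff (secpoly \<theta>) (card (S_tilde n) + 1) < 0"
    unfolding secpoly_def c(2)[symmetric] using secular_lead_neg[OF \<theta>]
    by (subst coeff_secular) auto
  have at_0: "poly (secpoly \<theta>) 0 * (\<Prod>s\<in>S_tilde n. - s) > 0"
  proof -
    have "0 \<noteq> lam0 l" if "l \<in> I" for l using lam0_pos[OF that] by simp
    then have "poly (secpoly \<theta>) 0 = (\<Prod>l\<in>I. - lam0 l) * (corner0 (stiff n) + \<theta> * cornern n (stiff n)
      + (\<Sum>l\<in>I. (1 + \<theta> * \<sigma> l) * (sa \<bullet> e l)^2 / (0 - lam0 l)))"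
      unfolding secpoly_def by (subst poly_secular) auto
    moreover have "(\<Prod>l\<in>I. - lam0 l) \<noteq> 0" using lam0_pos by (auto simp: less_le)
    ultimately show ?thesis
      using mult_square_pos[OF _ secular_at_0_pos[OF \<theta>]] unfolding prod_S_tilde
      by (simp only: mult.commute mult.left_commute)
  qed
  have pole: "poly (secpoly \<theta>) (lam0 l) * (\<Prod>t\<in>S_tilde n - {lam0 l}. lam0 l - t) > 0" if l: "l \<in> I" for l
  proof -
    have "(\<Prod>t\<in>S_tilde n - {lam0 l}. lam0 l - t) = (\<Prod>m\<in>I-{l}. lam0 l - lam0 m)"
    proof (rule prod.reindex_bij_betw[symmetric])
      show "bij_betw lam0 (I - {l}) (S_tilde n - {lam0 l})"
        unfolding bij_betw_def
        using lam0_inj l by (auto simp: lam0_image[symmetric] inj_on_eq_iff intro: inj_on_subset)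
    qed
    moreover have "(\<Prod>m\<in>I-{l}. lam0 l - lam0 m) \<noteq> 0"
      using lam0_inj l by (auto simp: inj_on_eq_iff)
    moreover have eq: "poly (secpoly \<theta>) (lam0 l) = (1 + \<theta> * \<sigma> l) * (sa \<bullet> e l - lam0 l * (sc \<bullet> e l))^2
        * (\<Prod>m\<in>I-{l}. lam0 l - lam0 m)"
      unfolding secpoly_def using l by (subst poly_secular_at_pole) auto
    moreover have "(1 + \<theta> * \<sigma> l) * (sa \<bullet> e l - lam0 l * (sc \<bullet> e l))^2 > 0"
      using one_plus_\<sigma>_pos[OF \<theta> l] gvec_e_nonzero[OF l] by simp
    ultimately show ?thesis
      using mult_square_pos[of "\<Prod>m\<in>I-{l}. lam0 l - lam0 m"
          "(1 + \<theta> * \<sigma> l) * (sa \<bullet> e l - lam0 l * (sc \<bullet> e l))^2"]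
      by (simp only: mult.commute mult.left_commute simp_thms)
  qed
  then have at_S: "poly (secpoly \<theta>) s * (\<Prod>t\<in>S_tilde n - {s}. s - t) > 0" if "s \<in> S_tilde n" for s
    using that unfolding lam0_image[symmetric] by auto
  show "{z. poly (map_poly complex_of_real (secpoly \<theta>)) z = 0} = complex_of_real ` {x. x > 0 \<and> poly (secpoly \<theta>) x = 0}"
    by (rule interlacing_roots(1)[OF finite_S_tilde S_tilde_pos deg lead at_0 at_S])
  show "card {x. x > 0 \<and> poly (secpoly \<theta>) x = 0} = n"
    using interlacing_roots(2)[OF finite_S_tilde S_tilde_pos deg lead at_0 at_S] c by simp
  show "x \<notin> S_tilde n" if "poly (secpoly \<theta>) x = 0" for x
    using at_S[of x] that by auto
qed

lemma char_equation_iff: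
  assumes z: "z \<notin> complex_of_real ` S_tilde n"
  shows "char_equation n lam0 e \<theta> z \<longleftrightarrow> poly (map_poly complex_of_real (secpoly \<theta>)) z = 0"
proof -
  let ?c = complex_of_real
  have ne: "z \<noteq> ?c (lam0 l)" if "l \<in> I" for l using z that lam0_image by blast
  define a where "a l = ?c (sa \<bullet> e l)" for l
  define c where "c l = ?c (sc \<bullet> e l)" for l
  define F where "F = ?c (corner0 (stiff n) + \<theta> * cornern n (stiff n)) - z * ?c (corner0 (mass n) + \<theta> * cornern n (mass n))
    + (\<Sum>l\<in>I. ?c (1 + \<theta> * \<sigma> l) * (a l - z * c l)^2 / (z - ?c (lam0 l)))"
  have "poly (map_poly ?c (secpoly \<theta>)) z = (\<Prod>l\<in>I. z - ?c (lam0 l)) * F"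
    unfolding secpoly_def map_poly_secular F_def a_def c_def using ne by (subst poly_secular) auto
  moreover have "(\<Prod>l\<in>I. z - ?c (lam0 l)) \<noteq> 0" using ne by simp
  ultimately have 1: "poly (map_poly ?c (secpoly \<theta>)) z = 0 \<longleftrightarrow> F = 0" by simp
  \<comment> \<open>Parity is a property of the real vectors, so it acts on the factors for every
    complex z.\<close>
  have s: "(\<Sum>l\<in>I. (?c (flip sa \<bullet> e l) - z * ?c (flip sc \<bullet> e l)) * (a l - z * c l) / (z - ?c (lam0 l)))
      = (\<Sum>l\<in>I. ?c (\<sigma> l) * (a l - z * c l)^2 / (z - ?c (lam0 l)))"
  proof (intro sum.cong refl)
    fix l assume "l \<in> I"
    then have "?c (flip sa \<bullet> e l) - z * ?c (flip sc \<bullet> e l) = ?c (\<sigma> l) * (a l - z * c l)"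
      by (simp add: flip_scalar_e a_def c_def right_diff_distrib mult.left_commute)
    then show "(?c (flip sa \<bullet> e l) - z * ?c (flip sc \<bullet> e l)) * (a l - z * c l) / (z - ?c (lam0 l))
      = ?c (\<sigma> l) * (a l - z * c l)^2 / (z - ?c (lam0 l))"
      by (simp only: power2_eq_square mult.assoc)
  qed
  have split: "(\<Sum>l\<in>I. ?c (1 + \<theta> * \<sigma> l) * (a l - z * c l)^2 / (z - ?c (lam0 l)))
     = (\<Sum>l\<in>I. (a l - z * c l)^2 / (z - ?c (lam0 l)))
      + ?c \<theta> * (\<Sum>l\<in>I. ?c (\<sigma> l) * (a l - z * c l)^2 / (z - ?c (lam0 l)))"
    unfolding sum_distrib_left sum.distrib[symmetric]
    by (intro sum.cong refl) (simp only: of_real_add of_real_mult of_real_1 distrib_right add_divide_distrib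
        mult_1_left mult.assoc times_divide_eq_right)
  have arith: "a + t * b - z * (c + t * d) + (s1 + t * s2) = (a - z * c + s1) + t * (b - z * d + s2)"
    for a b c d s1 s2 t :: complex by (simp add: algebra_simps)
  have F: "F = (?c (corner0 (stiff n)) - z * ?c (corner0 (mass n)) + (\<Sum>l\<in>I. (a l - z * c l)^2 / (z - ?c (lam0 l))))
    + ?c \<theta> * (?c (cornern n (stiff n)) - z * ?c (cornern n (mass n))
       + (\<Sum>l\<in>I. ?c (\<sigma> l) * (a l - z * c l)^2 / (z - ?c (lam0 l))))"
    unfolding F_def split unfolding of_real_add of_real_mult by (rule arith)
  show ?thesis
    unfolding 1 F char_equation_def Let_def a_def[symmetric] c_def[symmetric] s
    by (simp add: eq_neg_iff_add_eq_0)
qed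

lemma char_solutions_eq:
  assumes \<theta>: "\<bar>\<theta>\<bar> < 1"
  shows "char_solutions n lam0 e \<theta> = complex_of_real ` {x. x > 0 \<and> poly (secpoly \<theta>) x = 0}"
proof -
  have "z \<notin> complex_of_real ` S_tilde n" if "z \<in> complex_of_real ` {x. x > 0 \<and> poly (secpoly \<theta>) x = 0}" for z
    using that secpoly_roots(3)[OF \<theta>] by auto
  then have *: "z \<in> char_solutions n lam0 e \<theta> \<longleftrightarrow> z \<in> {z. poly (map_poly complex_of_real (secpoly \<theta>)) z = 0}" for z
    unfolding char_solutions_def secpoly_roots(1)[OF \<theta>, symmetric] mem_Collect_eq
    using char_equation_iff[of z \<theta>] by metis
  show ?thesis using Set.set_eqI[OF *] unfolding secpoly_roots(1)[OF \<theta>] .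
qed

section \<open>Solvability of the inner system and elimination of the inner unknowns\<close>

lemma Gtilde_carrier [simp]: "Gtilde n \<nu> \<in> carrier_mat (n - 1) (n - 1)"
  unfolding Gtilde_def by (rule minus_carrier_mat) simp

lemma det_Gtilde: "\<nu> \<notin> S_tilde n \<Longrightarrow> det (Gtilde n \<nu>) \<noteq> 0"
  unfolding Gtilde_def S_tilde_def pencil_spectrum_det[OF A.inner_carrier C.inner_carrier] by simp

lemma invertible_Gtilde:
  assumes "\<nu> \<notin> S_tilde n"
  shows "invertible_mat (Gtilde n \<nu>)"
proof -
  obtain B where "B \<in> carrier_mat (n - 1) (n - 1)" "Gtilde n \<nu> * B = 1\<^sub>m (n - 1)" "B * Gtilde n \<nu> = 1\<^sub>m (n - 1)"
    by (rule det_nonzero_inverse[OF Gtilde_carrier det_Gtilde[OF assms]]) (rule that)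
  then show ?thesis
    unfolding invertible_mat_def inverts_mat_def
    using carrier_matD[OF Gtilde_carrier[of \<nu>]] by (intro conjI exI[of _ B]) auto
qed

lemma gvec_carrier [simp]: "gvec n \<nu> \<in> carrier_vec (n - 1)"
  by (simp add: gvec_def)

lemma gvec_e: "l \<in> I \<Longrightarrow> gvec n \<nu> \<bullet> e l = sa \<bullet> e l - \<nu> * (sc \<bullet> e l)"
  unfolding gvec_def
  using minus_scalar_prod_distrib[OF A.side_carrier _ e_carrier, of "\<nu> \<cdot>\<^sub>v sc" l]
    smult_scalar_prod_distrib[OF C.side_carrier e_carrier, of l \<nu>] by simp

lemma p_sol_eq:
  assumes "\<nu> \<notin> S_tilde n"
  shows "p_sol n \<nu> = comb (\<lambda>l. (gvec n \<nu> \<bullet> e l) / (\<nu> - lam0 l))"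
  unfolding p_sol_def
proof (rule the_equality)
  let ?p = "comb (\<lambda>l. (gvec n \<nu> \<bullet> e l) / (\<nu> - lam0 l))"
  show *: "?p \<in> carrier_vec (n - 1) \<and> Gtilde n \<nu> *\<^sub>v ?p = - gvec n \<nu>"
    using inner_system_solution[OF gvec_carrier assms] by simp
  fix p assume p: "p \<in> carrier_vec (n - 1) \<and> Gtilde n \<nu> *\<^sub>v p = - gvec n \<nu>"
  have "Gtilde n \<nu> *\<^sub>v (p - ?p) = 0\<^sub>v (n - 1)"
    using p * by (subst mult_minus_distrib_mat_vec[OF Gtilde_carrier]) auto
  moreover have "p - ?p \<in> carrier_vec (n - 1)" using p by simp
  ultimately have "p - ?p = 0\<^sub>v (n - 1)"
    using det_Gtilde[OF assms] unfolding det_0_iff_vec_prod_zero_field[OF Gtilde_carrier] by metis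
  then show "p = ?p" using minus_vec_eq_0_iff[of p "n - 1" ?p] p by simp
qed

lemma
  assumes "\<nu> \<notin> S_tilde n"
  shows p_sol_carrier: "p_sol n \<nu> \<in> carrier_vec (n - 1)"
    and Gtilde_p_sol: "Gtilde n \<nu> *\<^sub>v p_sol n \<nu> = - gvec n \<nu>"
  unfolding p_sol_eq[OF assms] using inner_system_solution[OF gvec_carrier assms] by simp_all

text \<open>The partial fractions are read back as scalar products with
  \<open>p_sol n \<nu>\<close>. In this form the root condition is exactly what the vertex rows of
  the global problem demand.\<close>

lemma condensed_equation:
  assumes root: "poly (secpoly \<theta>) \<nu> = 0" and \<nu>: "\<nu> \<notin> S_tilde n"
  shows "corner0 (stiff n) - \<nu> * corner0 (mass n) + \<theta> * (cornern n (stiff n) - \<nu> * cornern n (mass n))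
    + (gvec n \<nu> \<bullet> p_sol n \<nu> + \<theta> * (flip (gvec n \<nu>) \<bullet> p_sol n \<nu>)) = 0"
proof -
  have ne: "\<nu> \<noteq> lam0 l" if "l \<in> I" for l using \<nu> that lam0_image by blast
  let ?F = "corner0 (stiff n) + \<theta> * cornern n (stiff n) - \<nu> * (corner0 (mass n) + \<theta> * cornern n (mass n))
    + (\<Sum>l\<in>I. (1 + \<theta> * \<sigma> l) * (sa \<bullet> e l - \<nu> * (sc \<bullet> e l))^2 / (\<nu> - lam0 l))"
  have "poly (secpoly \<theta>) \<nu> = (\<Prod>l\<in>I. \<nu> - lam0 l) * ?F"
    unfolding secpoly_def using ne by (subst poly_secular) auto
  moreover have "(\<Prod>l\<in>I. \<nu> - lam0 l) \<noteq> 0" using ne by simp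
  ultimately have "?F = 0" using root by simp
  moreover have "gvec n \<nu> \<bullet> p_sol n \<nu> + \<theta> * (flip (gvec n \<nu>) \<bullet> p_sol n \<nu>)
    = (\<Sum>l\<in>I. (1 + \<theta> * \<sigma> l) * (sa \<bullet> e l - \<nu> * (sc \<bullet> e l))^2 / (\<nu> - lam0 l))"
    unfolding p_sol_eq[OF \<nu>] scalar_comb_flip[OF gvec_carrier]
    by (intro sum.cong refl) (simp add: gvec_e power2_eq_square)
  ultimately show ?thesis by (simp add: algebra_simps)
qed

end

subsection \<open>The assembled problem\<close>

text \<open>The carrier property holds for every j, since the default outside the range is a zero
  vector of the right dimension.\<close>

lemma SK_D:
  assumes "w \<in> SK n K"
  shows "j \<notin> {1..K-1} \<Longrightarrow> fst w j = 0" and "snd w j \<in> carrier_vec (n - 1)"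
    and "j \<notin> {1..K} \<Longrightarrow> snd w j = 0\<^sub>v (n - 1)"
proof -
  show "snd w j \<in> carrier_vec (n - 1)"
    using assms by (cases "j \<in> {1..K}") (auto simp: SK_def simp del: atLeastAtMost_iff)
qed (use assms in \<open>auto simp: SK_def\<close>)

lemma sum_shift_down:
  fixes h :: "nat \<Rightarrow> 'a :: comm_monoid_add"
  assumes "K \<ge> 1" "h 0 = 0"
  shows "(\<Sum>j=1..K. h (j - 1)) = (\<Sum>j=1..K-1. h j)"
proof -
  obtain k where k: "K = Suc k" using assms(1) by (cases K) auto
  have "(\<Sum>j=1..K. h (j - 1)) = (\<Sum>j=0..k. h j)"
    unfolding k One_nat_def sum.shift_bounds_cl_Suc_ivl by simp
  also have "\<dots> = (\<Sum>j=1..k. h j)" by (simp add: sum.atLeast_Suc_atMost assms(2) One_nat_def)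
  finally show ?thesis by (simp add: k)
qed

lemma sum_drop_last:
  fixes h :: "nat \<Rightarrow> 'a :: comm_monoid_add"
  assumes "K \<ge> 1" "h K = 0"
  shows "(\<Sum>j=1..K. h j) = (\<Sum>j=1..K-1. h j)"
proof -
  obtain k where k: "K = Suc k" using assms(1) by (cases K) auto
  show ?thesis using assms(2) by (simp add: k One_nat_def)
qed

context centrosym
begin

abbreviation "assembled_form \<equiv> (\<lambda>y v j. elem_form n M (fst y (j - 1)) (snd y j) (fst y j)
     (fst v (j - 1)) (snd v j) (fst v j))"

lemma snd_assemble_carrier:
  "snd w j \<in> carrier_vec (n - 1) \<Longrightarrow> snd (assemble n K M w) j \<in> carrier_vec (n - 1)"
  by (simp add: assemble_def)

text \<open>Assembly undone: the global form is the sum of the element forms, which transfers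
  symmetry and positivity from one element to the whole. The zero end values of \<open>v\<close>
  allow the vertex sums to be extended over all elements.\<close>

lemma inner_assemble:
  assumes y: "y \<in> SK n K" and v: "v \<in> SK n K" and K: "K \<ge> 1"
  shows "SK_inner K (assemble n K M y) v = (\<Sum>j=1..K. assembled_form y v j)"
proof -
  \<comment> \<open>A vertex row splits into \<open>L j\<close>, the first row of element j + 1, and
    \<open>R j\<close>, the last row of element j.\<close>
  define L where "L j = corner0 M * fst y j + side n M \<bullet> snd y (j + 1) + cornern n M * fst y (j + 1)" for j
  define R where "R j = cornern n M * fst y (j - 1) + flip (side n M) \<bullet> snd y j + corner0 M * fst y j" for j
  have v0: "fst v 0 = 0" "fst v K = 0" using SK_D(1)[OF v] K by auto
  have 1: "(\<Sum>j=1..K-1. fst (assemble n K M y) j * fst v j) = (\<Sum>j=1..K-1. fst v j * L j) + (\<Sum>j=1..K-1. fst v j * R j)"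
    unfolding sum.distrib[symmetric]
    by (intro sum.cong refl) (simp add: assemble_def L_def R_def algebra_simps)
  have 2: "(\<Sum>j=1..K-1. fst v j * L j) = (\<Sum>j=1..K. fst v (j - 1) * L (j - 1))"
    by (rule sum_shift_down[OF K, symmetric]) (simp add: v0)
  have 3: "(\<Sum>j=1..K-1. fst v j * R j) = (\<Sum>j=1..K. fst v j * R j)"
    by (rule sum_drop_last[OF K, symmetric]) (simp add: v0)
  have "SK_inner K (assemble n K M y) v
      = (\<Sum>j=1..K. fst v (j - 1) * L (j - 1) + fst v j * R j + snd (assemble n K M y) j \<bullet> snd v j)"
    unfolding SK_inner_def 1 2 3 sum.distrib ..
  also have "\<dots> = (\<Sum>j=1..K. assembled_form y v j)"
  proof (intro sum.cong refl)
    fix j assume j: "j \<in> {1..K}"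
    note c = SK_D(2)[OF y, of j] SK_D(2)[OF v, of j]
    have "snd (assemble n K M y) j \<bullet> snd v j = fst y (j - 1) * (side n M \<bullet> snd v j)
        + (inner_block n M *\<^sub>v snd y j) \<bullet> snd v j + fst y j * (flip (side n M) \<bullet> snd v j)"
      using j c by (simp add: assemble_def add_scalar_prod_distrib[of _ "n - 1"])
    then show "fst v (j - 1) * L (j - 1) + fst v j * R j + snd (assemble n K M y) j \<bullet> snd v j
       = assembled_form y v j"
      using j by (simp add: elem_form_def L_def R_def)
  qed
  finally show ?thesis .
qed

lemma inner_assemble_symm:
  assumes y: "y \<in> SK n K" and v: "v \<in> SK n K" and K: "K \<ge> 1"
  shows "SK_inner K (assemble n K M y) v = SK_inner K (assemble n K M v) y"
  unfolding inner_assemble[OF y v K] inner_assemble[OF v y K]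
  by (intro sum.cong refl elem_form_symm SK_D(2)[OF y] SK_D(2)[OF v])

end

lemma SK_inner_scale_left:
  assumes "\<And>j. snd a j \<in> carrier_vec d" "\<And>j. snd b j \<in> carrier_vec d"
  shows "SK_inner K (SK_scale c a) b = c * SK_inner K a b"
  using assms
  by (simp add: SK_inner_def SK_scale_def distrib_left sum_distrib_left mult.assoc smult_scalar_prod_distrib[of _ d])

lemma SK_inner_lincomb:
  assumes "\<And>i j. i \<in> J \<Longrightarrow> snd (s i) j \<in> carrier_vec (n - 1)"
  shows "SK_inner K a (SK_lincomb n J c s) = (\<Sum>i\<in>J. c i * SK_inner K a (s i))"
proof -
  have 1: "snd a j \<bullet> snd (SK_lincomb n J c s) j = (\<Sum>i\<in>J. c i * (snd a j \<bullet> snd (s i) j))" for j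
  proof -
    have "snd a j \<bullet> snd (SK_lincomb n J c s) j
        = (\<Sum>m\<in>{0..<n-1}. \<Sum>i\<in>J. c i * (snd a j $ m * snd (s i) j $ m))"
      by (simp add: scalar_prod_def SK_lincomb_def sum_distrib_left mult.left_commute)
    also have "\<dots> = (\<Sum>i\<in>J. \<Sum>m\<in>{0..<n-1}. c i * (snd a j $ m * snd (s i) j $ m))" by (rule sum.swap)
    also have "\<dots> = (\<Sum>i\<in>J. c i * (snd a j \<bullet> snd (s i) j))"
      by (intro sum.cong refl) (simp add: scalar_prod_def sum_distrib_left carrier_vecD[OF assms])
    finally show ?thesis .
  qed
  have 2: "fst a j * fst (SK_lincomb n J c s) j = (\<Sum>i\<in>J. c i * (fst a j * fst (s i) j))" for j
    by (simp add: SK_lincomb_def sum_distrib_left mult.left_commute)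
  show ?thesis
    unfolding SK_inner_def 1 2 distrib_left sum.distrib sum_distrib_left
    by (simp only: sum.swap[of _ J])
qed

section \<open>Sampled sines\<close>

definition sn :: "nat \<Rightarrow> nat \<Rightarrow> real \<Rightarrow> real" where
  "sn K k t = sin (pi * real k * t / real K)"

lemma sn_0 [simp]: "sn K k 0 = 0"
  by (simp add: sn_def)

lemma sn_K [simp]: "K \<ge> 1 \<Longrightarrow> sn K k (real K) = 0"
  by (simp add: sn_def)

text \<open>This three-term recurrence is where theta enters the problem. The real argument keeps t
  - 1 free of truncated subtraction.\<close>

lemma sn_rec: "sn K k (t - 1) + sn K k (t + 1) = 2 * cos (pi * real k / real K) * sn K k t"
proof -
  have "pi * real k * (t - 1) / real K = pi * real k * t / real K - pi * real k / real K"
    "pi * real k * (t + 1) / real K = pi * real k * t / real K + pi * real k / real K"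
    by (simp_all add: diff_divide_distrib add_divide_distrib right_diff_distrib distrib_left)
  then show ?thesis unfolding sn_def by (simp add: sin_add sin_diff)
qed

lemma node_angle:
  assumes "k \<in> {1..K-1}"
  shows "0 < pi * real k / real K" "pi * real k / real K < pi"
proof -
  have k: "0 < real k" "real k < real K" using assms by auto
  then show "0 < pi * real k / real K" by simp
  have "pi * real k < pi * real K" using k by (intro mult_strict_left_mono) auto
  then show "pi * real k / real K < pi" using k by (simp add: divide_less_eq)
qed

lemma sn_1_nonzero: "k \<in> {1..K-1} \<Longrightarrow> sn K k 1 \<noteq> 0"
  using sin_gt_zero[OF node_angle] by (fastforce simp: sn_def)

lemma cos_node_inj:
  assumes "k \<in> {1..K-1}" "k' \<in> {1..K-1}" "k \<noteq> k'"
  shows "cos (pi * real k / real K) \<noteq> cos (pi * real k' / real K)"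
proof
  assume "cos (pi * real k / real K) = cos (pi * real k' / real K)"
  then have "pi * real k / real K = pi * real k' / real K"
    by (rule cos_inj_pi[OF less_imp_le[OF node_angle(1)[OF assms(1)]] less_imp_le[OF node_angle(2)[OF assms(1)]]
        less_imp_le[OF node_angle(1)[OF assms(2)]] less_imp_le[OF node_angle(2)[OF assms(2)]]])
  moreover have "real K > 0" using assms(1) by auto
  ultimately show False using assms(3) by simp
qed

lemma abs_cos_node: "k \<in> {1..K-1} \<Longrightarrow> \<bar>cos (pi * real k / real K)\<bar> < 1"
proof -
  assume k: "k \<in> {1..K-1}"
  have "sin (pi * real k / real K) \<noteq> 0" using sn_1_nonzero[OF k] by (simp add: sn_def)
  then have "(cos (pi * real k / real K))\<^sup>2 < 1"
    using sin_cos_squared_add[of "pi * real k / real K"] zero_less_power2[of "sin (pi * real k / real K)"] by linarith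
  then show ?thesis by (simp add: abs_square_less_1)
qed

text \<open>Both samples satisfy the recurrence, with different cosines. The discrete Wronskian
  \<open>W\<close> has increments proportional to the summands and vanishes at both ends.\<close>

lemma sn_orthogonal:
  assumes k: "k \<in> {1..K-1}" "k' \<in> {1..K-1}" "k \<noteq> k'"
  shows "(\<Sum>j=1..K-1. sn K k (real j) * sn K k' (real j)) = 0"
proof -
  have K: "K \<ge> 1" using k by auto
  let ?s = "sn K k" and ?t = "sn K k'"
  let ?c = "cos (pi * real k / real K)" and ?d = "cos (pi * real k' / real K)"
  define W where "W j = ?s (real j + 1) * ?t (real j) - ?s (real j) * ?t (real j + 1)" for j
  have "(2 * ?c - 2 * ?d) * (\<Sum>j=1..K-1. ?s (real j) * ?t (real j))
      = (\<Sum>j=1..K-1. (2 * ?c * ?s (real j)) * ?t (real j) - ?s (real j) * (2 * ?d * ?t (real j)))"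
    unfolding sum_distrib_left by (intro sum.cong refl) (simp add: algebra_simps)
  also have "\<dots> = (\<Sum>j=1..K-1. W j - W (j - 1))"
  proof (intro sum.cong refl)
    fix j assume "j \<in> {1..K-1}"
    then have "real (j - 1) = real j - 1" by auto
    then show "(2 * ?c * ?s (real j)) * ?t (real j) - ?s (real j) * (2 * ?d * ?t (real j)) = W j - W (j - 1)"
      unfolding W_def sn_rec[symmetric] by (simp add: algebra_simps)
  qed
  also have "\<dots> = W (K - 1) - W 0"
    using sum_telescope''[of 0 "K - 1" W] by (simp add: One_nat_def)
  also have "\<dots> = 0"
    using K by (simp add: W_def of_nat_diff)
  finally show ?thesis using cos_node_inj[OF k] by simp
qed

lemma dim_side [simp]: "dim_vec (side n M) = n - 1"
  by (simp add: side_def)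

text \<open>The sine vanishes at 0 and K, in agreement with the default zero, so the first and last
  vertex need no special treatment.\<close>

lemma fst_s_vec:
  assumes "K \<ge> 1" "j \<le> K"
  shows "fst (s_vec n K k p) j = sn K k (real j)"
proof (cases "j \<in> {1..K-1}")
  case False
  then have "j = 0 \<or> j = K" using assms by auto
  then show ?thesis using assms(1) by (auto simp: s_vec_def sn_def)
qed (simp add: s_vec_def sn_def)

lemma snd_s_vec:
  "j \<in> {1..K} \<Longrightarrow> snd (s_vec n K k p) j = sn K k (real j - 1) \<cdot>\<^sub>v p + sn K k (real j) \<cdot>\<^sub>v flip p"
  by (simp add: s_vec_def sn_def)

lemma s_vec_SK: "p \<in> carrier_vec (n - 1) \<Longrightarrow> s_vec n K k p \<in> SK n K"
  by (simp add: SK_def s_vec_def)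

context centrosym
begin

text \<open>In a vertex row reversal symmetry gives equal coefficients to the samples at j - 1 and j
  + 1, and \<open>sn_rec\<close> merges them into 2 theta times the sample at j. In an inner row
  everything is \<open>r\<close> and its reversal with the same amplitudes as \<open>p\<close>. So
  one scalar and one vector describe the whole image.\<close>

lemma assemble_s_vec:
  fixes k K p
  defines "\<theta> \<equiv> cos (pi * real k / real K)" and "r \<equiv> side n M + inner_block n M *\<^sub>v p"
  assumes K: "K \<ge> 1" and p: "p \<in> carrier_vec (n - 1)"
  shows "j \<in> {1..K-1} \<Longrightarrow> fst (assemble n K M (s_vec n K k p)) j =
      2 * sn K k (real j) * (corner0 M + \<theta> * cornern n M + (side n M \<bullet> p + \<theta> * (flip (side n M) \<bullet> p)))"
    and "j \<in> {1..K} \<Longrightarrow> snd (assemble n K M (s_vec n K k p)) j =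
      sn K k (real j - 1) \<cdot>\<^sub>v r + sn K k (real j) \<cdot>\<^sub>v flip r"
proof -
  let ?s = "\<lambda>t. sn K k t"
  have fp: "flip p \<in> carrier_vec (n - 1)" using p by simp
  have fm: "flip (side n M) \<in> carrier_vec (n - 1)" by simp
  have ff: "flip (side n M) \<bullet> flip p = side n M \<bullet> p" "side n M \<bullet> flip p = flip (side n M) \<bullet> p"
    using flip_scalar[OF side_carrier fp] flip_scalar[OF side_carrier p] by simp_all
  have lin: "q \<bullet> (a \<cdot>\<^sub>v p + b \<cdot>\<^sub>v flip p) = a * (q \<bullet> p) + b * (q \<bullet> flip p)"
    if "q \<in> carrier_vec (n - 1)" for q a b
    using that p fp by (simp add: scalar_prod_add_distrib[of _ "n - 1"])
  show "fst (assemble n K M (s_vec n K k p)) j =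
      2 * ?s (real j) * (corner0 M + \<theta> * cornern n M + (side n M \<bullet> p + \<theta> * (flip (side n M) \<bullet> p)))"
    if j: "j \<in> {1..K-1}"
  proof -
    have r: "real (j - 1) = real j - 1" "real (j + 1) = real j + 1" "real (j + 1) - 1 = real j"
      using j by (auto simp: of_nat_diff)
    have a: "fst (s_vec n K k p) (j - 1) = ?s (real j - 1)" "fst (s_vec n K k p) j = ?s (real j)"
      "fst (s_vec n K k p) (j + 1) = ?s (real j + 1)"
      using j fst_s_vec[OF K, of "j - 1"] fst_s_vec[OF K, of j] fst_s_vec[OF K, of "j + 1"] r by auto
    have b: "snd (s_vec n K k p) j = ?s (real j - 1) \<cdot>\<^sub>v p + ?s (real j) \<cdot>\<^sub>v flip p"
      "snd (s_vec n K k p) (j + 1) = ?s (real j) \<cdot>\<^sub>v p + ?s (real j + 1) \<cdot>\<^sub>v flip p"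
      using j snd_s_vec[of j K n k p] snd_s_vec[of "j + 1" K n k p] r by auto
    have eq: "fst (assemble n K M (s_vec n K k p)) j
        = cornern n M * fst (s_vec n K k p) (j - 1) + flip (side n M) \<bullet> snd (s_vec n K k p) j
          + 2 * corner0 M * fst (s_vec n K k p) j
          + side n M \<bullet> snd (s_vec n K k p) (j + 1) + cornern n M * fst (s_vec n K k p) (j + 1)"
      using j by (simp add: assemble_def)
    have "fst (assemble n K M (s_vec n K k p)) j
        = (?s (real j - 1) + ?s (real j + 1)) * (cornern n M + flip (side n M) \<bullet> p)
          + 2 * ?s (real j) * (corner0 M + side n M \<bullet> p)"
      unfolding eq a b lin[OF side_carrier] lin[OF fm] ff by (simp add: algebra_simps)
    then show ?thesis
      unfolding sn_rec \<theta>_def by (simp add: algebra_simps)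
  qed
  show "snd (assemble n K M (s_vec n K k p)) j = ?s (real j - 1) \<cdot>\<^sub>v r + ?s (real j) \<cdot>\<^sub>v flip r"
    if j: "j \<in> {1..K}"
  proof -
    have r: "real (j - 1) = real j - 1" using j by (auto simp: of_nat_diff)
    have a: "fst (s_vec n K k p) (j - 1) = ?s (real j - 1)" "fst (s_vec n K k p) j = ?s (real j)"
      using j fst_s_vec[OF K, of "j - 1"] fst_s_vec[OF K, of j] r by auto
    have T: "inner_block n M *\<^sub>v (x \<cdot>\<^sub>v p + y \<cdot>\<^sub>v flip p)
        = x \<cdot>\<^sub>v (inner_block n M *\<^sub>v p) + y \<cdot>\<^sub>v flip (inner_block n M *\<^sub>v p)" for x y
      using p fp mult_mat_vec[OF inner_carrier p, of x] mult_mat_vec[OF inner_carrier fp, of y]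
      by (subst mult_add_distrib_mat_vec[OF inner_carrier]) (simp_all add: flip_inner)
    have fr: "flip r = flip (side n M) + flip (inner_block n M *\<^sub>v p)"
      unfolding r_def by (rule flip_add[of _ "n - 1"]) simp_all
    have "snd (assemble n K M (s_vec n K k p)) j = ?s (real j - 1) \<cdot>\<^sub>v side n M
        + (?s (real j - 1) \<cdot>\<^sub>v (inner_block n M *\<^sub>v p) + ?s (real j) \<cdot>\<^sub>v flip (inner_block n M *\<^sub>v p))
        + ?s (real j) \<cdot>\<^sub>v flip (side n M)"
      using j unfolding assemble_def by (simp add: a snd_s_vec T)
    also have "\<dots> = ?s (real j - 1) \<cdot>\<^sub>v r + ?s (real j) \<cdot>\<^sub>v flip r"
      unfolding fr unfolding r_def
      by (intro eq_vecI) (simp_all add: distrib_left del: index_mult_mat_vec)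
    finally show ?thesis .
  qed
qed

end

context fem
begin

lemma mass_op_pos:
  assumes w: "w \<in> SK n K" "w \<noteq> SK_zero n" and K: "K \<ge> 1"
  shows "SK_inner K (mass_op n K w) w > 0"
proof -
  let ?t = "\<lambda>j. elem_form n (mass n) (fst w (j - 1)) (snd w j) (fst w j) (fst w (j - 1)) (snd w j) (fst w j)"
  have nonneg: "?t j \<ge> 0" for j
  proof (cases "fst w (j - 1) \<noteq> 0 \<or> fst w j \<noteq> 0 \<or> snd w j \<noteq> 0\<^sub>v (n - 1)")
    case True
    then show ?thesis by (rule less_imp_le[OF mass_form_pos[OF SK_D(2)[OF w(1)]]])
  qed (simp add: elem_form_def)
  have "\<exists>j\<in>{1..K}. fst w j \<noteq> 0 \<or> snd w j \<noteq> 0\<^sub>v (n - 1)"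
  proof (rule ccontr)
    assume *: "\<not> ?thesis"
    have "fst w j = 0" for j using * SK_D(1)[OF w(1), of j] by (cases "j \<in> {1..K}") auto
    moreover have "snd w j = 0\<^sub>v (n - 1)" for j using * SK_D(3)[OF w(1), of j] by blast
    ultimately have "w = SK_zero n" unfolding SK_zero_def by (intro prod_eqI ext) simp_all
    then show False using w(2) by contradiction
  qed
  then obtain i where i: "i \<in> {1..K}" "fst w i \<noteq> 0 \<or> snd w i \<noteq> 0\<^sub>v (n - 1)" by blast
  have "0 < (\<Sum>j=1..K. ?t j)"
    by (rule sum_pos2[OF _ i(1)]) (use nonneg mass_form_pos[OF SK_D(2)[OF w(1)]] i(2) in auto)
  then show ?thesis unfolding mass_op_def C.inner_assemble[OF w(1) w(1) K] .
qed

lemma mass_op_symm: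
  assumes "y \<in> SK n K" "v \<in> SK n K" "K \<ge> 1"
  shows "SK_inner K (mass_op n K y) v = SK_inner K (mass_op n K v) y"
  unfolding mass_op_def by (rule C.inner_assemble_symm[OF assms])

lemma eigenpairs_orthogonal:
  assumes y: "is_eigenpair n K \<mu> y" and v: "is_eigenpair n K \<nu> v" and "\<mu> \<noteq> \<nu>" and K: "K \<ge> 1"
  shows "SK_inner K (mass_op n K y) v = 0"
proof -
  have yS: "y \<in> SK n K" and ye: "stiff_op n K y = SK_scale \<mu> (mass_op n K y)"
    and vS: "v \<in> SK n K" and ve: "stiff_op n K v = SK_scale \<nu> (mass_op n K v)"
    using y v by (auto simp: is_eigenpair_def)
  have c: "snd (mass_op n K y) j \<in> carrier_vec (n - 1)" "snd (mass_op n K v) j \<in> carrier_vec (n - 1)" for j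
    unfolding mass_op_def by (intro C.snd_assemble_carrier SK_D(2)[OF yS] SK_D(2)[OF vS])+
  have "\<mu> * SK_inner K (mass_op n K y) v = SK_inner K (stiff_op n K y) v"
    unfolding ye by (rule SK_inner_scale_left[OF c(1) SK_D(2)[OF vS], symmetric])
  also have "\<dots> = SK_inner K (stiff_op n K v) y"
    unfolding stiff_op_def by (rule A.inner_assemble_symm[OF yS vS K])
  also have "\<dots> = \<nu> * SK_inner K (mass_op n K v) y"
    unfolding ve by (rule SK_inner_scale_left[OF c(2) SK_D(2)[OF yS]])
  also have "SK_inner K (mass_op n K v) y = SK_inner K (mass_op n K y) v"
    by (rule mass_op_symm[OF vS yS K])
  finally show ?thesis using \<open>\<mu> \<noteq> \<nu>\<close> by simp
qed

text \<open>Since \<open>p\<close> and \<open>p'\<close> are arbitrary, this covers equal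
  eigenvalues for different k. The vertex part is a multiple of an orthogonal sine sum; the inner
  part consists of such sums and of sums with neighbouring arguments.\<close>

lemma s_vec_orthogonal:
  assumes k: "k \<in> {1..K-1}" "k' \<in> {1..K-1}" "k \<noteq> k'"
    and p: "p \<in> carrier_vec (n - 1)" and p': "p' \<in> carrier_vec (n - 1)"
  shows "SK_inner K (mass_op n K (s_vec n K k p)) (s_vec n K k' p') = 0"
proof -
  have K: "K \<ge> 1" using k by auto
  let ?s = "sn K k" and ?t = "sn K k'"
  define r where "r = sc + Ct *\<^sub>v p"
  have r: "r \<in> carrier_vec (n - 1)" by (simp add: r_def)
  define \<alpha> where "\<alpha> = corner0 (mass n) + cos (pi * real k / real K) * cornern n (mass n)
    + (sc \<bullet> p + cos (pi * real k / real K) * (flip sc \<bullet> p))"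
  let ?X = "\<Sum>j=1..K-1. ?s (real j) * ?t (real j)"
  have X: "?X = 0" by (rule sn_orthogonal[OF k])
  have f: "(\<Sum>j=1..K-1. fst (mass_op n K (s_vec n K k p)) j * fst (s_vec n K k' p') j) = 0"
  proof -
    have "(\<Sum>j=1..K-1. fst (mass_op n K (s_vec n K k p)) j * fst (s_vec n K k' p') j)
        = (\<Sum>j=1..K-1. 2 * \<alpha> * (?s (real j) * ?t (real j)))"
    proof (intro sum.cong refl)
      fix j assume j: "j \<in> {1..K-1}"
      then have "fst (s_vec n K k' p') j = ?t (real j)" by (intro fst_s_vec[OF K]) auto
      then show "fst (mass_op n K (s_vec n K k p)) j * fst (s_vec n K k' p') j = 2 * \<alpha> * (?s (real j) * ?t (real j))"
        unfolding mass_op_def C.assemble_s_vec(1)[OF K p j] \<alpha>_def by simp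
    qed
    then show ?thesis unfolding sum_distrib_left[symmetric] X by simp
  qed
  have fr: "flip r \<bullet> p' = r \<bullet> flip p'" "flip r \<bullet> flip p' = r \<bullet> p'"
    using flip_scalar[OF r p'] flip_scalar[of r "n - 1" "flip p'"] r p' by simp_all
  have g: "(\<Sum>j=1..K. snd (mass_op n K (s_vec n K k p)) j \<bullet> snd (s_vec n K k' p') j)
    = (\<Sum>j=1..K. (r \<bullet> p') * (?s (real j - 1) * ?t (real j - 1) + ?s (real j) * ?t (real j))
       + (r \<bullet> flip p') * (?s (real j - 1) * ?t (real j) + ?s (real j) * ?t (real j - 1)))"
  proof (intro sum.cong refl)
    fix j assume j: "j \<in> {1..K}"
    have fp': "flip p' \<in> carrier_vec (n - 1)" and frc: "flip r \<in> carrier_vec (n - 1)" using p' r by simp_all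
    show "snd (mass_op n K (s_vec n K k p)) j \<bullet> snd (s_vec n K k' p') j
      = (r \<bullet> p') * (?s (real j - 1) * ?t (real j - 1) + ?s (real j) * ?t (real j))
       + (r \<bullet> flip p') * (?s (real j - 1) * ?t (real j) + ?s (real j) * ?t (real j - 1))"
      unfolding mass_op_def C.assemble_s_vec(2)[OF K p j] r_def[symmetric] snd_s_vec[OF j]
      using r p' fp' frc
      by (simp add: add_scalar_prod_distrib[of _ "n - 1"] scalar_prod_add_distrib[of _ "n - 1"] fr
          smult_scalar_prod_distrib[of _ "n - 1"] scalar_prod_smult_distrib[of _ "n - 1"] algebra_simps)
  qed
  have s0: "(\<Sum>j=1..K. h (real j - 1)) = (\<Sum>j=1..K-1. h (real j))" if "h 0 = 0" for h :: "real \<Rightarrow> real"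
  proof -
    have "(\<Sum>j=1..K. h (real j - 1)) = (\<Sum>j=1..K. h (real (j - 1)))"
      by (intro sum.cong refl) (simp add: of_nat_diff)
    then show ?thesis using sum_shift_down[OF K, of "\<lambda>j. h (real j)"] that by simp
  qed
  have s1: "(\<Sum>j=1..K. h (real j)) = (\<Sum>j=1..K-1. h (real j))" if "h (real K) = 0" for h :: "real \<Rightarrow> real"
    using sum_drop_last[OF K, of "\<lambda>j. h (real j)"] that by simp
  have a: "(\<Sum>j=1..K. ?s (real j - 1) * ?t (real j - 1)) = 0"
    using s0[of "\<lambda>x. ?s x * ?t x"] X by simp
  have b: "(\<Sum>j=1..K. ?s (real j) * ?t (real j)) = 0"
    using s1[of "\<lambda>x. ?s x * ?t x"] X K by simp
  have c: "(\<Sum>j=1..K. ?s (real j - 1) * ?t (real j)) = (\<Sum>j=1..K-1. ?s (real j) * ?t (real j + 1))"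
    using s0[of "\<lambda>x. ?s x * ?t (x + 1)"] by simp
  have d: "(\<Sum>j=1..K. ?s (real j) * ?t (real j - 1)) = (\<Sum>j=1..K-1. ?s (real j) * ?t (real j - 1))"
    using s1[of "\<lambda>x. ?s x * ?t (x - 1)"] K by simp
  \<comment> \<open>The two neighbouring sums need not vanish separately; by the recurrence their
    total is a multiple of the orthogonal sum \<open>?X\<close>.\<close>
  have "(\<Sum>j=1..K-1. ?s (real j) * ?t (real j + 1)) + (\<Sum>j=1..K-1. ?s (real j) * ?t (real j - 1))
      = (\<Sum>j=1..K-1. 2 * cos (pi * real k' / real K) * (?s (real j) * ?t (real j)))"
    unfolding sum.distrib[symmetric]
  proof (intro sum.cong refl)
    fix j :: nat
    have "?s (real j) * ?t (real j + 1) + ?s (real j) * ?t (real j - 1)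
        = ?s (real j) * (?t (real j - 1) + ?t (real j + 1))" by (simp add: distrib_left)
    then show "?s (real j) * ?t (real j + 1) + ?s (real j) * ?t (real j - 1)
        = 2 * cos (pi * real k' / real K) * (?s (real j) * ?t (real j))"
      unfolding sn_rec by simp
  qed
  also have "\<dots> = 0" unfolding sum_distrib_left[symmetric] X by simp
  finally have cd: "(\<Sum>j=1..K. ?s (real j - 1) * ?t (real j)) + (\<Sum>j=1..K. ?s (real j) * ?t (real j - 1)) = 0"
    unfolding c d .
  show ?thesis
    unfolding SK_inner_def f g sum.distrib sum_distrib_left[symmetric] a b
    using cd by simp
qed

end

section \<open>The two families of global eigenvectors\<close>

context fem_eig
begin

lemma neg_flip_pow_e:
  assumes "l \<in> I"
  shows "neg_flip_pow m (e l) = (- \<sigma> l) ^ m \<cdot>\<^sub>v e l"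
proof (induction m)
  case (Suc m)
  have "neg_flip_pow (Suc m) (e l) = - flip (neg_flip_pow m (e l))" by (simp add: neg_flip_pow_def)
  also have "\<dots> = - ((- \<sigma> l) ^ m \<cdot>\<^sub>v (\<sigma> l \<cdot>\<^sub>v e l))" unfolding Suc flip_smult flip_e(1)[OF assms] ..
  also have "\<dots> = (- \<sigma> l) ^ Suc m \<cdot>\<^sub>v e l" by (intro eq_vecI) simp_all
  finally show ?case .
qed (simp add: neg_flip_pow_def)

lemma parity:
  assumes "l \<in> I"
  shows "(even_vec (e l) \<and> (\<forall>j\<in>{1..K}. neg_flip_pow (j - 1) (e l) = (-1)^(j - 1) \<cdot>\<^sub>v e l)) \<or>
         (odd_vec (e l) \<and> (\<forall>j\<in>{1..K}. neg_flip_pow (j - 1) (e l) = e l))"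
proof -
  have "- 1 \<cdot>\<^sub>v e l = - e l" by (intro eq_vecI) simp_all
  then show ?thesis
    using flip_e[OF assms] unfolding even_vec_def odd_vec_def neg_flip_pow_e[OF assms] by auto
qed

text \<open>From one element to the next the amplitude is multiplied by \<open>- \<sigma> l\<close>,
  while the reversed side vector has \<open>\<sigma> l\<close> times the product with
  \<open>e l\<close>. The contributions of the two elements at a vertex therefore cancel, and inside
  each element the local equation remains.\<close>

lemma s_zero_eigenpair:
  assumes l: "l \<in> I" and K: "K \<ge> 1"
  shows "is_eigenpair n K (lam0 l) (s_zero n K (e l))"
proof -
  note el = e_carrier[OF l]
  let ?s = "s_zero n K (e l)"
  have snd: "snd ?s j = (- \<sigma> l) ^ (j - 1) \<cdot>\<^sub>v e l" if "j \<in> {1..K}" for j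
    using that by (simp add: s_zero_def neg_flip_pow_e[OF l])
  have fst: "fst ?s j = 0" for j by (simp add: s_zero_def)
  have out: "snd ?s j = 0\<^sub>v (n - 1)" if "j \<notin> {1..K}" for j
    unfolding s_zero_def snd_conv using that by (rule if_not_P)
  have SK: "?s \<in> SK n K"
    unfolding SK_def using el out
    by (intro CollectI conjI allI ballI impI) (simp_all add: fst snd del: atLeastAtMost_iff)
  have "snd ?s 1 = e l" using K snd[of 1] by simp
  moreover have "e l \<noteq> 0\<^sub>v (n - 1)" using e_norm[OF l] by auto
  ultimately have nz: "?s \<noteq> SK_zero n" unfolding SK_zero_def by (metis snd_conv)
  have f0: "fst (assemble n K M ?s) j = 0" if "centrosym n M" for M j
  proof (cases "j \<in> {1..K-1}")
    case True
    interpret centrosym n M by fact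
    have j: "j \<in> {1..K}" "j + 1 \<in> {1..K}" using True by auto
    have fm: "flip (side n M) \<in> carrier_vec (n - 1)" by simp
    have "flip (side n M) \<bullet> snd ?s j + side n M \<bullet> snd ?s (j + 1) = 0"
    proof -
      have i: "(- \<sigma> l) ^ (j + 1 - 1) = - \<sigma> l * (- \<sigma> l) ^ (j - 1)" using True by (cases j) (auto simp: power_add)
      show ?thesis
        unfolding snd[OF j(1)] snd[OF j(2)] scalar_prod_smult_distrib[OF fm el]
          scalar_prod_smult_distrib[OF side_carrier el] flip_scalar_e[OF l side_carrier] i
        by simp
    qed
    then show ?thesis using True by (simp add: assemble_def fst)
  qed (auto simp: assemble_def)
  have sM: "snd (assemble n K M ?s) j = (- \<sigma> l) ^ (j - 1) \<cdot>\<^sub>v (inner_block n M *\<^sub>v e l)"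
    if "centrosym n M" "j \<in> {1..K}" for M j
  proof -
    interpret centrosym n M by fact
    have fm: "flip (side n M) \<in> carrier_vec (n - 1)" by simp
    have c: "inner_block n M *\<^sub>v snd ?s j \<in> carrier_vec (n - 1)" by simp
    have "0 \<cdot>\<^sub>v side n M + inner_block n M *\<^sub>v snd ?s j + 0 \<cdot>\<^sub>v flip (side n M) = inner_block n M *\<^sub>v snd ?s j"
      by (intro eq_vecI) (simp_all del: index_mult_mat_vec)
    then show ?thesis
      using that(2) unfolding assemble_def by (simp add: fst snd mult_mat_vec[OF inner_carrier el])
  qed
  have "stiff_op n K ?s = SK_scale (lam0 l) (mass_op n K ?s)"
  proof (rule prod_eqI; rule ext)
    fix j
    show "fst (stiff_op n K ?s) j = fst (SK_scale (lam0 l) (mass_op n K ?s)) j"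
      by (simp add: stiff_op_def mass_op_def SK_scale_def f0 A.centrosym_axioms C.centrosym_axioms)
    show "snd (stiff_op n K ?s) j = snd (SK_scale (lam0 l) (mass_op n K ?s)) j"
    proof (cases "j \<in> {1..K}")
      case True
      then show ?thesis
        unfolding stiff_op_def mass_op_def SK_scale_def
        by (simp add: sM A.centrosym_axioms C.centrosym_axioms e_eig[OF l] smult_smult_assoc mult.commute)
    next
      case False
      then show ?thesis by (auto simp: stiff_op_def mass_op_def SK_scale_def assemble_def)
    qed
  qed
  then show ?thesis using SK nz by (simp add: is_eigenpair_def)
qed

text \<open>The image of the mode under either operator is given by a scalar and a vector. Their
  proportionality with factor nu is \<open>e1\<close>, the condensed equation, for the vertex rows
  and \<open>e2\<close>, the system defining \<open>p_sol\<close>, for the inner rows.\<close>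

lemma s_vec_eigenpair:
  assumes k: "k \<in> {1..K-1}" and root: "poly (secpoly (cos (pi * real k / real K))) \<nu> = 0" and \<nu>: "\<nu> \<notin> S_tilde n"
  shows "is_eigenpair n K \<nu> (s_vec n K k (p_sol n \<nu>))"
proof -
  have K: "K \<ge> 1" using k by auto
  let ?p = "p_sol n \<nu>" and ?\<theta> = "cos (pi * real k / real K)"
  note p = p_sol_carrier[OF \<nu>]
  let ?s = "s_vec n K k ?p"
  have "fst ?s 1 \<noteq> 0" using fst_s_vec[OF K, of 1 n k ?p] K sn_1_nonzero[OF k] by simp
  then have nz: "?s \<noteq> SK_zero n" by (auto simp: SK_zero_def)
  have fsc: "flip sc \<in> carrier_vec (n - 1)" and fsa: "flip sa \<in> carrier_vec (n - 1)" by simp_all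
  have fg: "flip (gvec n \<nu>) = flip sa - \<nu> \<cdot>\<^sub>v flip sc"
    by (intro eq_vecI) (simp_all add: gvec_def flip_def)
  have g: "gvec n \<nu> \<bullet> ?p = sa \<bullet> ?p - \<nu> * (sc \<bullet> ?p)" "flip (gvec n \<nu>) \<bullet> ?p = flip sa \<bullet> ?p - \<nu> * (flip sc \<bullet> ?p)"
    unfolding fg unfolding gvec_def using p fsc fsa
    by (simp_all add: minus_scalar_prod_distrib[of _ "n - 1"] smult_scalar_prod_distrib[of _ "n - 1"])
  have e1: "corner0 (stiff n) + ?\<theta> * cornern n (stiff n) + (sa \<bullet> ?p + ?\<theta> * (flip sa \<bullet> ?p))
      = \<nu> * (corner0 (mass n) + ?\<theta> * cornern n (mass n) + (sc \<bullet> ?p + ?\<theta> * (flip sc \<bullet> ?p)))"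
    using condensed_equation[OF root \<nu>] unfolding g by (simp add: algebra_simps)
  have "St *\<^sub>v ?p - \<nu> \<cdot>\<^sub>v (Ct *\<^sub>v ?p) = - gvec n \<nu>"
    using Gtilde_p_sol[OF \<nu>] minus_smult_mat_mult_vec[OF A.inner_carrier C.inner_carrier p] by (simp add: Gtilde_def)
  then have *: "(St *\<^sub>v ?p - \<nu> \<cdot>\<^sub>v (Ct *\<^sub>v ?p)) $ i = (- gvec n \<nu>) $ i" for i by simp
  have "(St *\<^sub>v ?p) $ i - \<nu> * (Ct *\<^sub>v ?p) $ i = - (sa $ i - \<nu> * sc $ i)" if "i < n - 1" for i
    using that *[of i] by (simp add: gvec_def del: index_mult_mat_vec)
  then have e2: "sa + St *\<^sub>v ?p = \<nu> \<cdot>\<^sub>v (sc + Ct *\<^sub>v ?p)"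
    by (intro eq_vecI) (simp_all add: algebra_simps del: index_mult_mat_vec)
  have "stiff_op n K ?s = SK_scale \<nu> (mass_op n K ?s)"
  proof (rule prod_eqI; rule ext)
    fix j
    show "fst (stiff_op n K ?s) j = fst (SK_scale \<nu> (mass_op n K ?s)) j"
    proof (cases "j \<in> {1..K-1}")
      case True
      show ?thesis
        unfolding stiff_op_def mass_op_def SK_scale_def fst_conv A.assemble_s_vec(1)[OF K p True]
          C.assemble_s_vec(1)[OF K p True] e1 by simp
    next
      case False
      then show ?thesis by (auto simp: stiff_op_def mass_op_def SK_scale_def assemble_def)
    qed
    show "snd (stiff_op n K ?s) j = snd (SK_scale \<nu> (mass_op n K ?s)) j"
    proof (cases "j \<in> {1..K}")
      case True
      show ?thesis
        unfolding stiff_op_def mass_op_def SK_scale_def snd_conv A.assemble_s_vec(2)[OF K p True]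
          C.assemble_s_vec(2)[OF K p True] e2 flip_smult
        by (intro eq_vecI) (simp_all add: algebra_simps del: index_mult_mat_vec)
    next
      case False
      then show ?thesis by (auto simp: stiff_op_def mass_op_def SK_scale_def assemble_def)
    qed
  qed
  then show ?thesis using s_vec_SK[OF p] nz by (simp add: is_eigenpair_def)
qed

end

subsection \<open>Completeness\<close>

text \<open>Scalar coordinates of a global vector: \<open>Inl\<close> for vertices,
  \<open>Inr\<close> for inner entries. They make the expansion a finite linear system.\<close>

definition coord :: "gvector \<Rightarrow> nat + nat \<times> nat \<Rightarrow> real" where
  "coord w d = (case d of Inl j \<Rightarrow> fst w j | Inr (j, m) \<Rightarrow> snd w j $ m)"

definition coords :: "nat \<Rightarrow> nat \<Rightarrow> (nat + nat \<times> nat) set" where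
  "coords n K = {1..K-1} <+> {1..K} \<times> {0..<n-1}"

lemma SK_eqI:
  assumes v: "v \<in> SK n K" and w: "w \<in> SK n K" and eq: "\<And>d. d \<in> coords n K \<Longrightarrow> coord v d = coord w d"
  shows "v = w"
proof (rule prod_eqI; rule ext)
  fix j
  show "fst v j = fst w j"
    using eq[of "Inl j"] SK_D(1)[OF v, of j] SK_D(1)[OF w, of j]
    by (cases "j \<in> {1..K-1}") (simp_all add: coord_def coords_def InlI del: atLeastAtMost_iff)
  show "snd v j = snd w j"
  proof (cases "j \<in> {1..K}")
    case True
    show ?thesis
    proof (rule eq_vecI)
      fix m assume "m < dim_vec (snd w j)"
      then have "m < n - 1" using carrier_vecD[OF SK_D(2)[OF w]] by simp
      then show "snd v j $ m = snd w j $ m"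
        using eq[of "Inr (j, m)"] True by (simp add: coord_def coords_def InrI)
    qed (simp add: carrier_vecD[OF SK_D(2)[OF w]] carrier_vecD[OF SK_D(2)[OF v]])
  qed (simp add: SK_D(3)[OF v] SK_D(3)[OF w])
qed

lemma SK_zero_in: "SK_zero n \<in> SK n K"
  by (simp add: SK_zero_def SK_def)

lemma SK_lincomb_in:
  assumes "\<And>i. i \<in> J \<Longrightarrow> s i \<in> SK n K"
  shows "SK_lincomb n J c s \<in> SK n K"
proof -
  have "fst (SK_lincomb n J c s) j = 0" if "j \<notin> {1..K-1}" for j
    using SK_D(1)[OF assms that] by (simp add: SK_lincomb_def)
  moreover have "snd (SK_lincomb n J c s) j = 0\<^sub>v (n - 1)" if "j \<notin> {1..K}" for j
    using SK_D(3)[OF assms that] by (intro eq_vecI) (simp_all add: SK_lincomb_def)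
  ultimately show ?thesis by (simp add: SK_def del: atLeastAtMost_iff) (simp add: SK_lincomb_def)
qed

lemma coord_lincomb:
  "d \<in> coords n K \<Longrightarrow> coord (SK_lincomb n J c s) d = (\<Sum>i\<in>J. c i * coord (s i) d)"
  by (auto simp: coords_def coord_def SK_lincomb_def)

lemma coord_zero: "d \<in> coords n K \<Longrightarrow> coord (SK_zero n) d = 0"
  by (auto simp: coords_def coord_def SK_zero_def)

lemma modes_eq:
  "K \<ge> 1 \<Longrightarrow> modes n K = {0} \<times> {1..n-1} \<union> {1..K-1} \<times> {1..n}"
  by (auto simp: modes_def split: if_splits)

lemma
  assumes "n \<ge> 1" "K \<ge> 1"
  shows finite_modes: "finite (modes n K)" and card_modes: "card (modes n K) = card (coords n K)"
proof -
  obtain m k where mk: "n = Suc m" "K = Suc k" using assms by (metis One_nat_def Suc_le_D)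
  show "finite (modes n K)" unfolding modes_eq[OF assms(2)] by simp
  have "card (modes n K) = (n - 1) + (K - 1) * n"
    unfolding modes_eq[OF assms(2)] by (subst card_Un_disjoint) (auto simp: card_cartesian_product)
  moreover have "card (coords n K) = (K - 1) + K * (n - 1)"
    unfolding coords_def by (subst card_Plus) (auto simp: card_cartesian_product)
  ultimately show "card (modes n K) = card (coords n K)" by (simp add: mk)
qed

context fem
begin

text \<open>Positivity of the mass form makes an orthogonal family independent, and there are as
  many modes as coordinates, so the expansion system is square and injective.\<close>

lemma orthogonal_family_basis:
  assumes K: "K \<ge> 1"
    and sS: "\<And>i. i \<in> modes n K \<Longrightarrow> s i \<in> SK n K" and nz: "\<And>i. i \<in> modes n K \<Longrightarrow> s i \<noteq> SK_zero n"
    and orth: "\<And>i i'. i \<in> modes n K \<Longrightarrow> i' \<in> modes n K \<Longrightarrow> i \<noteq> i' \<Longrightarrow> SK_inner K (mass_op n K (s i)) (s i') = 0"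
    and w: "w \<in> SK n K"
  shows "\<exists>!c. c \<in> extensional (modes n K) \<and> w = SK_lincomb n (modes n K) c s"
proof -
  let ?J = "modes n K"
  note fin = finite_modes[OF n1 K]
  have inner: "SK_inner K (mass_op n K (s i)) (SK_lincomb n ?J c s) = c i * SK_inner K (mass_op n K (s i)) (s i)"
    if i: "i \<in> ?J" for i c
  proof -
    have "SK_inner K (mass_op n K (s i)) (SK_lincomb n ?J c s)
        = (\<Sum>i'\<in>?J. c i' * SK_inner K (mass_op n K (s i)) (s i'))"
      by (rule SK_inner_lincomb[OF SK_D(2)[OF sS]])
    also have "\<dots> = (\<Sum>i'\<in>?J. if i = i' then c i' * SK_inner K (mass_op n K (s i)) (s i') else 0)"
      using orth[OF i] by (intro sum.cong refl) auto
    also have "\<dots> = c i * SK_inner K (mass_op n K (s i)) (s i)" using i fin by simp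
    finally show ?thesis .
  qed
  have uniq: "c i = c' i" if "SK_lincomb n ?J c s = SK_lincomb n ?J c' s" "i \<in> ?J" for c c' i
    using inner[OF that(2), of c] inner[OF that(2), of c'] that(1)
      mass_op_pos[OF sS[OF that(2)] nz[OF that(2)] K] by simp
  have zero: "SK_lincomb n ?J (\<lambda>i. 0) s = SK_zero n"
    by (simp add: SK_lincomb_def SK_zero_def zero_vec_def)
  have "\<exists>c. \<forall>d\<in>coords n K. coord w d = (\<Sum>i\<in>?J. c i * coord (s i) d)"
  proof (rule injective_system_surj[OF fin _ card_modes[OF n1 K]])
    show "finite (coords n K)" by (simp add: coords_def)
    fix c i assume *: "\<And>d. d \<in> coords n K \<Longrightarrow> (\<Sum>i\<in>?J. c i * coord (s i) d) = 0" and i: "i \<in> ?J"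
    have "SK_lincomb n ?J c s = SK_zero n"
      by (rule SK_eqI[OF SK_lincomb_in[OF sS] SK_zero_in]) (simp_all add: coord_lincomb coord_zero *)
    then show "c i = 0" using uniq[OF _ i, of c "\<lambda>i. 0"] zero by simp
  qed
  then obtain c where c: "\<And>d. d \<in> coords n K \<Longrightarrow> coord w d = (\<Sum>i\<in>?J. c i * coord (s i) d)" by metis
  \<comment> \<open>Fixing the values outside the index set makes the coefficients unique as a total
    function.\<close>
  have "w = SK_lincomb n ?J (restrict c ?J) s"
    by (rule SK_eqI[OF w SK_lincomb_in[OF sS]]) (simp_all add: coord_lincomb c)
  moreover have "restrict c ?J \<in> extensional ?J" by simp
  ultimately show ?thesis
  proof (intro ex1I[of _ "restrict c ?J"] conjI)
    fix c' assume c': "c' \<in> extensional ?J \<and> w = SK_lincomb n ?J c' s"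
    have "c' i = restrict c ?J i" if "i \<in> ?J" for i
      using uniq[OF _ that, of c' "restrict c ?J"] c' \<open>w = SK_lincomb n ?J (restrict c ?J) s\<close> by simp
    then show "c' = restrict c ?J"
      using c' by (intro extensionalityI[of _ ?J]) auto
  qed
qed

text \<open>An eigenvector for an eigenvalue outside the list is orthogonal to every mode, hence by
  expansion to itself, against positivity of the mass form.\<close>

lemma global_spectrum_eq:
  assumes K: "K \<ge> 1"
    and s: "\<And>i. i \<in> modes n K \<Longrightarrow> is_eigenpair n K (\<kappa> i) (s i)"
    and orth: "\<And>i i'. i \<in> modes n K \<Longrightarrow> i' \<in> modes n K \<Longrightarrow> i \<noteq> i' \<Longrightarrow> SK_inner K (mass_op n K (s i)) (s i') = 0"
  shows "global_spectrum n K = \<kappa> ` modes n K"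
proof (intro equalityI subsetI)
  fix \<nu> assume "\<nu> \<in> global_spectrum n K"
  then obtain v where v: "is_eigenpair n K \<nu> v" by (auto simp: global_spectrum_def)
  then have vS: "v \<in> SK n K" "v \<noteq> SK_zero n" by (auto simp: is_eigenpair_def)
  have sS: "s i \<in> SK n K" "s i \<noteq> SK_zero n" if "i \<in> modes n K" for i
    using s[OF that] by (auto simp: is_eigenpair_def)
  obtain c where c: "v = SK_lincomb n (modes n K) c s"
    using orthogonal_family_basis[where s = s, OF K sS orth vS(1)] by auto
  show "\<nu> \<in> \<kappa> ` modes n K"
  proof (rule ccontr)
    assume "\<nu> \<notin> \<kappa> ` modes n K"
    then have 0: "SK_inner K (mass_op n K v) (s i) = 0" if "i \<in> modes n K" for i
      using eigenpairs_orthogonal[OF v s[OF that] _ K] that by blast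
    have "SK_inner K (mass_op n K v) v = (\<Sum>i\<in>modes n K. c i * SK_inner K (mass_op n K v) (s i))"
      by (subst (2) c) (rule SK_inner_lincomb[OF SK_D(2)[OF sS(1)]])
    then have "SK_inner K (mass_op n K v) v = 0" by (simp add: 0)
    then show False using mass_op_pos[OF vS K] by simp
  qed
next
  fix \<nu> assume "\<nu> \<in> \<kappa> ` modes n K"
  then obtain i where "i \<in> modes n K" "\<nu> = \<kappa> i" by blast
  then have "is_eigenpair n K \<nu> (s i)" using s by simp
  then show "\<nu> \<in> global_spectrum n K" unfolding global_spectrum_def by blast
qed

end

text \<open>Any enumeration of the positive roots will do. The root condition is kept because the
  construction of the eigenvector starts from it.\<close>

lemma (in fem_eig) ex_lam:
  assumes "\<bar>\<theta>\<bar> < 1"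
  shows "\<exists>f. bij_betw (\<lambda>l. complex_of_real (f l)) {1..n} (char_solutions n lam0 e \<theta>) \<and>
    (\<forall>l\<in>{1..n}. f l > 0 \<and> f l \<notin> S_tilde n \<and> poly (secpoly \<theta>) (f l) = 0)"
proof -
  let ?P = "{x. x > 0 \<and> poly (secpoly \<theta>) x = 0}"
  have "finite ?P" using secpoly_roots(2)[OF assms] n2 by (intro card_ge_0_finite) simp
  moreover have "card {1..n} = card ?P" using secpoly_roots(2)[OF assms] by simp
  ultimately have "\<exists>f. bij_betw f {1..n} ?P" by (intro finite_same_card_bij finite_atLeastAtMost)
  then obtain f where f: "bij_betw f {1..n} ?P" ..
  have "bij_betw complex_of_real ?P (char_solutions n lam0 e \<theta>)"
    unfolding char_solutions_eq[OF assms] by (intro bij_betw_imageI) (simp_all add: inj_on_def)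
  from bij_betw_trans[OF f this] have "bij_betw (\<lambda>l. complex_of_real (f l)) {1..n} (char_solutions n lam0 e \<theta>)"
    by (simp add: comp_def)
  moreover have "f l \<in> ?P" if "l \<in> {1..n}" for l using bij_betwE[OF f] that by blast
  ultimately show ?thesis using secpoly_roots(3)[OF assms] by (intro exI[of _ f]) auto
qed

theorem theorem2p3:
  fixes n K :: nat
  assumes "n \<ge> 2" and "K \<ge> 1"
    and "S_full_simple n" and "S_tilde_simple n"
  shows "(\<exists>lam0 e. local_eigenpairs n lam0 e) \<and>
    (\<forall>lam0 e. local_eigenpairs n lam0 e \<longrightarrow>
      (\<exists>lam :: nat \<Rightarrow> nat \<Rightarrow> real.
        \<comment> \<open>item 1\<close>
        (\<forall>k\<in>{1..K-1}.
           bij_betw (\<lambda>l. complex_of_real (lam k l)) {1..n}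
             (char_solutions n lam0 e (cos (pi * real k / real K))) \<and>
           (\<forall>l\<in>{1..n}. lam k l > 0 \<and> lam k l \<notin> S_tilde n)) \<and>
        global_spectrum n K = S_tilde n \<union> {lam k l | k l. k \<in> {1..K-1} \<and> l \<in> {1..n}} \<and>
        \<comment> \<open>item 2\<close>
        (\<forall>l\<in>{1..n-1}.
           is_eigenpair n K (lam0 l) (s_zero n K (e l)) \<and>
           ((even_vec (e l) \<and> (\<forall>j\<in>{1..K}. neg_flip_pow (j - 1) (e l) = (-1)^(j - 1) \<cdot>\<^sub>v e l)) \<or>
            (odd_vec (e l) \<and> (\<forall>j\<in>{1..K}. neg_flip_pow (j - 1) (e l) = e l)))) \<and>
        \<comment> \<open>item 3\<close>
        (\<forall>k\<in>{1..K-1}. \<forall>l\<in>{1..n}.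
           invertible_mat (Gtilde n (lam k l)) \<and>
           p_sol n (lam k l) \<in> carrier_vec (n - 1) \<and>
           Gtilde n (lam k l) *\<^sub>v p_sol n (lam k l) = - gvec n (lam k l) \<and>
           is_eigenpair n K (lam k l) (s_vec n K k (p_sol n (lam k l)))) \<and>
        \<comment> \<open>item 4\<close>
        (\<forall>i\<in>modes n K. \<forall>i'\<in>modes n K. i \<noteq> i' \<longrightarrow>
           SK_inner K (mass_op n K (s_mode n K e lam i)) (s_mode n K e lam i') = 0) \<and>
        (\<forall>w\<in>SK n K. \<exists>!c. c \<in> extensional (modes n K) \<and>
           w = SK_lincomb n (modes n K) c (s_mode n K e lam))))"
proof (intro conjI allI impI)
  interpret fem n by unfold_locales (rule assms(1))
  show "\<exists>lam0 e. local_eigenpairs n lam0 e" by (rule ex_local_eigenpairs[OF assms(4)])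
  fix lam0 e assume "local_eigenpairs n lam0 e"
  then interpret fem_eig n lam0 e by unfold_locales
  have "\<exists>f. bij_betw (\<lambda>l. complex_of_real (f l)) {1..n} (char_solutions n lam0 e (cos (pi * real k / real K))) \<and>
    (\<forall>l\<in>{1..n}. f l > 0 \<and> f l \<notin> S_tilde n \<and> poly (secpoly (cos (pi * real k / real K))) (f l) = 0)"
    if "k \<in> {1..K-1}" for k
    by (rule ex_lam[OF abs_cos_node[OF that]])
  then obtain lam where lam_bij: "\<And>k. k \<in> {1..K-1} \<Longrightarrow>
      bij_betw (\<lambda>l. complex_of_real (lam k l)) {1..n} (char_solutions n lam0 e (cos (pi * real k / real K)))"
    and lam: "\<And>k l. k \<in> {1..K-1} \<Longrightarrow> l \<in> {1..n} \<Longrightarrow>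
      lam k l > 0 \<and> lam k l \<notin> S_tilde n \<and> poly (secpoly (cos (pi * real k / real K))) (lam k l) = 0"
    by metis
  have lam_inj: "lam k l \<noteq> lam k l'" if "k \<in> {1..K-1}" "l \<in> {1..n}" "l' \<in> {1..n}" "l \<noteq> l'" for k l l'
    using inj_onD[OF bij_betw_imp_inj_on[OF lam_bij[OF that(1)]] _ that(2,3)] that(4) by auto
  have eig: "is_eigenpair n K (lam k l) (s_vec n K k (p_sol n (lam k l)))"
    if "k \<in> {1..K-1}" "l \<in> {1..n}" for k l
    using s_vec_eigenpair[OF that(1)] lam[OF that] by blast
  let ?\<kappa> = "\<lambda>(k, l). if k = 0 then lam0 l else lam k l"
  let ?s = "s_mode n K e lam"
  have modeE: thesis
    if "i \<in> modes n K" "\<And>l. i = (0, l) \<Longrightarrow> l \<in> {1..n-1} \<Longrightarrow> thesis"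
      "\<And>k l. i = (k, l) \<Longrightarrow> k \<in> {1..K-1} \<Longrightarrow> l \<in> {1..n} \<Longrightarrow> thesis" for i thesis
    using that unfolding modes_eq[OF assms(2)] by blast
  have eig_mode: "is_eigenpair n K (?\<kappa> i) (?s i)" if "i \<in> modes n K" for i
    using that
  proof (rule modeE)
    fix l assume "i = (0, l)" "l \<in> {1..n-1}"
    then show ?thesis using s_zero_eigenpair[OF _ assms(2), of l] by (simp add: s_mode_def)
  next
    fix k l assume "i = (k, l)" "k \<in> {1..K-1}" "l \<in> {1..n}"
    then show ?thesis using eig[of k l] by (simp add: s_mode_def)
  qed
  have orth: "SK_inner K (mass_op n K (?s i)) (?s i') = 0"
    if i: "i \<in> modes n K" and i': "i' \<in> modes n K" and ne: "i \<noteq> i'" for i i'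
  proof (cases "?\<kappa> i = ?\<kappa> i'")
    case False
    then show ?thesis by (rule eigenpairs_orthogonal[OF eig_mode[OF i] eig_mode[OF i'] _ assms(2)])
  next
    \<comment> \<open>Equal eigenvalues cannot occur between the two families, since the roots avoid
      the inner spectrum, nor inside one family for a fixed k. What remains is different positive k,
      settled by the sampled sines.\<close>
    case True
    show ?thesis
    proof (rule modeE[OF i]; rule modeE[OF i'])
      fix l l' assume "i' = (0, l)" "i = (0, l')" "l \<in> {1..n-1}" "l' \<in> {1..n-1}"
      then show ?thesis using True ne lam0_inj by (auto simp: inj_on_eq_iff)
    next
      fix k l l' assume "i' = (k, l)" "i = (0, l')" "k \<in> {1..K-1}" "l \<in> {1..n}" "l' \<in> {1..n-1}"
      then show ?thesis using True lam[of k l] lam0_in[of l'] by simp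
    next
      fix k l l' assume "i = (k, l)" "i' = (0, l')" "k \<in> {1..K-1}" "l \<in> {1..n}" "l' \<in> {1..n-1}"
      then show ?thesis using True lam[of k l] lam0_in[of l'] by simp
    next
      fix k l k' l' assume *: "i = (k, l)" "i' = (k', l')" "k \<in> {1..K-1}" "l \<in> {1..n}" "k' \<in> {1..K-1}" "l' \<in> {1..n}"
      then have "k \<noteq> k'" using True ne lam_inj[of k l l'] by auto
      then show ?thesis
        using s_vec_orthogonal[of k K k' "p_sol n (lam k l)" "p_sol n (lam k' l')"] *
          p_sol_carrier[of "lam k l"] p_sol_carrier[of "lam k' l'"] lam[of k l] lam[of k' l']
        by (simp add: s_mode_def)
    qed
  qed
  have "?\<kappa> ` modes n K = S_tilde n \<union> {lam k l | k l. k \<in> {1..K-1} \<and> l \<in> {1..n}}"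
  proof -
    have "{0 :: nat} \<times> {1..n-1} = Pair 0 ` {1..n-1}" by auto
    then have 1: "?\<kappa> ` ({0} \<times> {1..n-1}) = S_tilde n"
      unfolding lam0_image[symmetric] by (simp add: image_image)
    have "?\<kappa> ` ({1..K-1} \<times> {1..n}) = (\<lambda>(k, l). lam k l) ` ({1..K-1} \<times> {1..n})"
      by (intro image_cong refl) auto
    also have "\<dots> = {lam k l | k l. k \<in> {1..K-1} \<and> l \<in> {1..n}}"
      unfolding image_def by (auto simp del: atLeastAtMost_iff)
    finally show ?thesis unfolding modes_eq[OF assms(2)] image_Un 1 by simp
  qed
  then have spectrum: "global_spectrum n K = S_tilde n \<union> {lam k l | k l. k \<in> {1..K-1} \<and> l \<in> {1..n}}"
    using global_spectrum_eq[where \<kappa> = ?\<kappa>, OF assms(2) eig_mode orth] by simp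
  have basis: "\<exists>!c. c \<in> extensional (modes n K) \<and> w = SK_lincomb n (modes n K) c ?s" if "w \<in> SK n K" for w
    by (rule orthogonal_family_basis[OF assms(2) _ _ orth that])
      (use eig_mode in \<open>auto simp: is_eigenpair_def\<close>)
  show "\<exists>lam :: nat \<Rightarrow> nat \<Rightarrow> real.
        (\<forall>k\<in>{1..K-1}.
           bij_betw (\<lambda>l. complex_of_real (lam k l)) {1..n}
             (char_solutions n lam0 e (cos (pi * real k / real K))) \<and>
           (\<forall>l\<in>{1..n}. lam k l > 0 \<and> lam k l \<notin> S_tilde n)) \<and>
        global_spectrum n K = S_tilde n \<union> {lam k l | k l. k \<in> {1..K-1} \<and> l \<in> {1..n}} \<and>
        (\<forall>l\<in>{1..n-1}.
           is_eigenpair n K (lam0 l) (s_zero n K (e l)) \<and>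
           ((even_vec (e l) \<and> (\<forall>j\<in>{1..K}. neg_flip_pow (j - 1) (e l) = (-1)^(j - 1) \<cdot>\<^sub>v e l)) \<or>
            (odd_vec (e l) \<and> (\<forall>j\<in>{1..K}. neg_flip_pow (j - 1) (e l) = e l)))) \<and>
        (\<forall>k\<in>{1..K-1}. \<forall>l\<in>{1..n}.
           invertible_mat (Gtilde n (lam k l)) \<and>
           p_sol n (lam k l) \<in> carrier_vec (n - 1) \<and>
           Gtilde n (lam k l) *\<^sub>v p_sol n (lam k l) = - gvec n (lam k l) \<and>
           is_eigenpair n K (lam k l) (s_vec n K k (p_sol n (lam k l)))) \<and>
        (\<forall>i\<in>modes n K. \<forall>i'\<in>modes n K. i \<noteq> i' \<longrightarrow>
           SK_inner K (mass_op n K (s_mode n K e lam i)) (s_mode n K e lam i') = 0) \<and>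
        (\<forall>w\<in>SK n K. \<exists>!c. c \<in> extensional (modes n K) \<and>
           w = SK_lincomb n (modes n K) c (s_mode n K e lam))"
  proof (rule exI[of _ lam], intro conjI[OF _ conjI[OF spectrum]] conjI ballI impI)
    fix k assume k: "k \<in> {1..K-1}"
    show "bij_betw (\<lambda>l. complex_of_real (lam k l)) {1..n} (char_solutions n lam0 e (cos (pi * real k / real K)))"
      by (rule lam_bij[OF k])
    fix l assume l: "l \<in> {1..n}"
    show "lam k l > 0" "lam k l \<notin> S_tilde n" using lam[OF k l] by blast+
  next
    fix l assume l: "l \<in> {1..n-1}"
    show "is_eigenpair n K (lam0 l) (s_zero n K (e l))" by (rule s_zero_eigenpair[OF l assms(2)])
    show "(even_vec (e l) \<and> (\<forall>j\<in>{1..K}. neg_flip_pow (j - 1) (e l) = (-1)^(j - 1) \<cdot>\<^sub>v e l)) \<or>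
            (odd_vec (e l) \<and> (\<forall>j\<in>{1..K}. neg_flip_pow (j - 1) (e l) = e l))"
      by (rule parity[OF l])
  next
    fix k l assume kl: "k \<in> {1..K-1}" "l \<in> {1..n}"
    have *: "lam k l \<notin> S_tilde n" using lam[OF kl] by blast
    show "invertible_mat (Gtilde n (lam k l))" by (rule invertible_Gtilde[OF *])
    show "p_sol n (lam k l) \<in> carrier_vec (n - 1)" by (rule p_sol_carrier[OF *])
    show "Gtilde n (lam k l) *\<^sub>v p_sol n (lam k l) = - gvec n (lam k l)" by (rule Gtilde_p_sol[OF *])
    show "is_eigenpair n K (lam k l) (s_vec n K k (p_sol n (lam k l)))" by (rule eig[OF kl])
  next
    fix i i' assume "i \<in> modes n K" "i' \<in> modes n K" "i \<noteq> i'"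
    then show "SK_inner K (mass_op n K (?s i)) (?s i') = 0" by (rule orth)
  next
    fix w assume "w \<in> SK n K"
    then show "\<exists>!c. c \<in> extensional (modes n K) \<and> w = SK_lincomb n (modes n K) c ?s" by (rule basis)
  qed
qed

end
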